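(* Let $g\ge5$ be odd, let $C$ be the rosary of genus $g$, canonically embedded in $\mathbb{P}\mathrm{H}^0(C,\omega_C)\cong\mathbb{P}^{g-1}$, and let $m\ge2$. Then the $m$-th Hilbert point $[C]_m$ is semistable if and only if $g\le 2m+1$.
   Context: The rosary of genus $g$ is obtained from $g-1$ copies $P_i$ of $\mathbb{P}^1$, $i\in\mathbb{Z}/(g-1)$, with coordinate $u_i$ at $0$ and $v_i=1/u_i$ at $\infty$, by gluing $\infty\in P_i$ to $0\in P_{i+1}$ into a tacnode with local ring consisting of pairs of germs $(f(v_i),h(u_{i+1}))$ with $f(0)=h(0)$, $f'(0)=h'(0)$; its dualizing sheaf $\omega_C$ is very ample for odd $g\ge5$ and $\operatorname{Sym}^m\mathrm{H}^0(\omega_C)\to\mathrm{H}^0(\omega_C^m)$ is surjective. The $m$-th Hilbert point of $X\subset\mathbb{P}V$ is the point of $\mathbb{P}(\bigwedge^{N_m}\mathrm{H}^0(\mathbb{P}V,\mathcal{O}(m))^\vee)$ dual to the top wedge power of the restriction map, $N_m=h^0(X,\mathcal{O}_X(m))$; semistable means $0$ is not in the closure of the $\mathrm{SL}(V)$-orbit of a lift. *)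

theory Defs
  imports Complex_Main "HOL-Computational_Algebra.Polynomial" "Jordan_Normal_Form.Determinant"
begin

(* The rosary of genus g has components P_i, i < g-1 (indices mod g-1).
   A global section of omega_C^m (m >= 1) is described on the normalization:
   on P_i it is the m-differential  q_i(u_i) (du_i)^m / u_i^(2m)  with q_i a
   polynomial of degree <= 2m (this is exactly regularity w.r.t. the local
   generator (dv/v^2, -du/u^2)^m of omega at each tacnode), subject to the
   tacnode conditions at the node joining infinity of P_i to 0 of P_(i+1):
   coeff q_(i+1) 0 = coeff q_i (2m), coeff q_(i+1) 1 = coeff q_i (2m-1).
   Components with index >= g-1 are set to 0. *)
definition rosary_sections :: "nat \<Rightarrow> nat \<Rightarrow> (nat \<Rightarrow> complex poly) set" where
  "rosary_sections g m =
     {q. \<forall>i. (g - 1 \<le> i \<longrightarrow> q i = 0) \<and>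
          (i < g - 1 \<longrightarrow>
             degree (q i) \<le> 2 * m \<and>
             coeff (q (Suc i mod (g - 1))) 0 = coeff (q i) (2 * m) \<and>
             coeff (q (Suc i mod (g - 1))) 1 = coeff (q i) (2 * m - 1))}"

definition lincomb :: "nat \<Rightarrow> (nat \<Rightarrow> complex) \<Rightarrow> (nat \<Rightarrow> nat \<Rightarrow> complex poly) \<Rightarrow> (nat \<Rightarrow> complex poly)" where
  "lincomb N a b = (\<lambda>i. \<Sum>k<N. smult (a k) (b k i))"

definition is_basis_of :: "(nat \<Rightarrow> complex poly) set \<Rightarrow> nat \<Rightarrow> (nat \<Rightarrow> nat \<Rightarrow> complex poly) \<Rightarrow> bool" where
  "is_basis_of S N b \<longleftrightarrow> (\<forall>k<N. b k \<in> S) \<and>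
     (\<forall>s\<in>S. \<exists>!a. (\<forall>k. N \<le> k \<longrightarrow> a k = 0) \<and> s = lincomb N a b)"

definition coords :: "nat \<Rightarrow> (nat \<Rightarrow> nat \<Rightarrow> complex poly) \<Rightarrow> (nat \<Rightarrow> complex poly) \<Rightarrow> nat \<Rightarrow> complex" where
  "coords N b s = (THE a. (\<forall>k. N \<le> k \<longrightarrow> a k = 0) \<and> s = lincomb N a b)"

definition monomials :: "nat \<Rightarrow> nat \<Rightarrow> (nat \<Rightarrow> nat) set" where
  "monomials g m = {\<alpha>. (\<forall>j. g \<le> j \<longrightarrow> \<alpha> j = 0) \<and> (\<Sum>j<g. \<alpha> j) = m}"

(* restriction of the monomial x^alpha to C, where x_j is the basis element w_j
   of H^0(omega_C) (so the canonical embedding is C -> P^(g-1) via w) *)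
definition restrict_mon :: "nat \<Rightarrow> (nat \<Rightarrow> nat \<Rightarrow> complex poly) \<Rightarrow> (nat \<Rightarrow> nat) \<Rightarrow> (nat \<Rightarrow> complex poly)" where
  "restrict_mon g w \<alpha> = (\<lambda>i. \<Prod>j<g. (w j i) ^ (\<alpha> j))"

definition act_basis :: "nat \<Rightarrow> complex mat \<Rightarrow> (nat \<Rightarrow> nat \<Rightarrow> complex poly) \<Rightarrow> (nat \<Rightarrow> nat \<Rightarrow> complex poly)" where
  "act_basis g A w = (\<lambda>j i. \<Sum>l<g. smult (A $$ (j, l)) (w l i))"

(* The m-th Hilbert point: the alternating N-form on Sym^m H^0(omega_C)
   f_1 ... f_N |-> det( coordinates of f_r|_C ), i.e. the top wedge power of
   the restriction map followed by wedge^N H^0(omega^m) = C (via basis b),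
   recorded by its values on N-tuples of monomials. *)
definition hilbert_point :: "nat \<Rightarrow> nat \<Rightarrow> (nat \<Rightarrow> nat \<Rightarrow> complex poly) \<Rightarrow> (nat \<Rightarrow> nat \<Rightarrow> complex poly) \<Rightarrow> nat \<Rightarrow> (nat \<Rightarrow> nat \<Rightarrow> nat) \<Rightarrow> complex" where
  "hilbert_point g m w b N \<sigma> =
     det (mat N N (\<lambda>(r, k). coords N b (restrict_mon g w (\<sigma> r)) k))"

definition hilbert_semistable :: "nat \<Rightarrow> nat \<Rightarrow> (nat \<Rightarrow> nat \<Rightarrow> complex poly) \<Rightarrow> (nat \<Rightarrow> nat \<Rightarrow> complex poly) \<Rightarrow> nat \<Rightarrow> bool" where
  "hilbert_semistable g m w b N \<longleftrightarrow>
     \<not> (\<exists>A :: nat \<Rightarrow> complex mat.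
          (\<forall>n. A n \<in> carrier_mat g g \<and> det (A n) = 1) \<and>
          (\<forall>\<sigma>. (\<forall>r<N. \<sigma> r \<in> monomials g m) \<longrightarrow>
               (\<lambda>n. hilbert_point g m (act_basis g (A n) w) b N \<sigma>) \<longlonglongrightarrow> 0))"

end

theory Submission
  imports Defs
begin

text \<open>
  Write n = g - 1 = 2k. The forms of degree one are spanned by x_i (equal to 1 on P_i and to u^2 on
  P_(i-1)) and by y (equal to u on every P_i); the coefficients of u^e, e < 2m - 1, on the components
  are coordinates on the forms of degree m. The torus acting on the components by u -> t u and
  u -> u / t alternately gives the x_i with i even, y, and the x_i with i odd the weights 1, 0, -1.

  If g > 2m + 1, the one-parameter subgroup scaling y against the x_i destabilizes: monomials of even
  degree in y only have coefficients at even powers of u, so a nonzero minor contains at least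
  n(m - 1) monomials divisible by y.

  Conversely, row operations with bounded multipliers bring an arbitrary matrix to triangular form
  with respect to the order x_0, x_2, ..., y, x_1, x_3, ...; they only change the size of the vector of
  minors by a bounded factor. For triangular matrices the torus weights reduce minors to products of
  blocks, and suitable minors are, up to bounded factors, products of diagonal entries in which all
  x_i occur with the same exponent. There is such a minor of low degree in y, which is used if the
  diagonal entry at y has modulus at most 1, and one of high degree in y, used otherwise. The latter
  needs an adaptive choice of monomials, depending on the entry between the first and the last x_i of
  each parity.
\<close>

subsection \<open>Determinants\<close>

text \<open>For a triangular matrix let s be the modulus of the entry at y and G the product of the
  other diagonal moduli; only s * G is given. A minor of size G^A * s^Y is at least (s * G)^A if s
  \<le> 1 and Y \<le> A, or if s \<ge> 1 and A \<le> Y; hence the need for a common exponent A. With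
  Z = Y / n letters y per component, A = m (2m - 1) - Z. The least Z is m - 1, by parity, and then Y
  \<le> A amounts to k \<le> m: here the genus bound enters. In the other case rows are easy to
  separate if their words contain both nodes of their component. For exponents from 2 on this caps
  the letters y, leaving Z \<le> (m - 2)^2 + 1, and A \<le> Y then fails for (k, m) = (2,2), (2,3),
  (3,3), (2,4). Hence the words with y^2: one per node if m \<ge> 3, a single one if m = 2. The
  nodes of one parity form a cycle, but a triangular matrix orders them linearly. The passage from
  the last node back to the first is where diagonal entries alone do not control the minor; it
  causes the constants 1/4 and 1/16.\<close>

definition fdet :: "nat \<Rightarrow> (nat \<Rightarrow> nat \<Rightarrow> 'a) \<Rightarrow> 'a::comm_ring_1" where
  "fdet N F = det (mat N N (\<lambda>(r, c). F r c))"

lemma fdet_leibniz: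
  "fdet N F = (\<Sum>p | p permutes {..<N}. signof p * (\<Prod>r<N. F r (p r)))"
proof -
  have "(\<Prod>i = 0..<N. mat N N (\<lambda>(r, c). F r c) $$ (i, p i)) = (\<Prod>r<N. F r (p r))"
    if "p permutes {0..<N}" for p
    using permutes_in_image[OF that] by (auto simp: atLeast0LessThan intro!: prod.cong)
  then show ?thesis
    unfolding fdet_def by (subst det_def') (auto simp: atLeast0LessThan)
qed

lemma fdet_cong: "(\<And>r c. r < N \<Longrightarrow> c < N \<Longrightarrow> F r c = G r c) \<Longrightarrow> fdet N F = fdet N G"
  unfolding fdet_def by (intro arg_cong[where f = det] eq_matI) auto

text \<open>A permutation preserves the sum of \<open>key\<close>, so a termwise inequality cannot
  be strict anywhere.\<close>

lemma permutes_mono_imp_eq: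
  fixes key :: "nat \<Rightarrow> nat"
  assumes "p permutes {..<N}" and le: "\<And>r. r < N \<Longrightarrow> key r \<le> key (p r)" and "r < N"
  shows "key (p r) = key r"
proof (rule ccontr)
  assume "key (p r) \<noteq> key r"
  then have "(\<Sum>r<N. key r) < (\<Sum>r<N. key (p r))"
    using le \<open>r < N\<close> by (intro sum_strict_mono_ex1) (auto intro!: bexI[of _ r] order_neq_le_trans)
  moreover have "(\<Sum>r<N. key (p r)) = (\<Sum>r<N. key r)"
    using sum.permute[OF assms(1), of key] by (simp add: o_def)
  ultimately show False by simp
qed

lemma fdet_block_triangular:
  fixes lev :: "nat \<Rightarrow> nat" and F :: "nat \<Rightarrow> nat \<Rightarrow> 'a::idom"
  assumes "\<And>r c. r < N \<Longrightarrow> c < N \<Longrightarrow> F r c \<noteq> 0 \<Longrightarrow> lev r \<le> lev c"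
  shows "fdet N F = fdet N (\<lambda>r c. if lev r = lev c then F r c else 0)"
  unfolding fdet_leibniz
proof (intro sum.cong refl arg_cong2[where f = "(*)"])
  fix p assume "p \<in> {p. p permutes {..<N}}"
  then have p: "p permutes {..<N}" by simp
  then have pN: "p r < N" if "r < N" for r
    using that permutes_in_image by fastforce
  show "(\<Prod>r<N. F r (p r)) = (\<Prod>r<N. if lev r = lev (p r) then F r (p r) else 0)"
  proof (cases "\<forall>r<N. lev r \<le> lev (p r)")
    case True
    then show ?thesis
      using permutes_mono_imp_eq[OF p, of lev] by (intro prod.cong) auto
  next
    case False
    then obtain r where r: "r < N" "\<not> lev r \<le> lev (p r)" by blast
    then have "F r (p r) = 0" using assms pN by blast
    then have "(\<Prod>r<N. F r (p r)) = 0"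
      "(\<Prod>r<N. if lev r = lev (p r) then F r (p r) else 0) = 0"
      using r by (auto intro!: prod_zero bexI[of _ r])
    then show ?thesis by metis
  qed
qed

text \<open>A permutation with nonzero product raises \<open>key\<close> weakly, hence preserves it,
  and then the hypothesis leaves only fixed points. Since \<open>key\<close> need not be injective,
  any numerical function increasing along a partial order of the rows will do.\<close>

lemma fdet_triangular:
  fixes key :: "nat \<Rightarrow> nat" and F :: "nat \<Rightarrow> nat \<Rightarrow> 'a::idom"
  assumes "\<And>r c. r < N \<Longrightarrow> c < N \<Longrightarrow> F r c \<noteq> 0 \<Longrightarrow> r = c \<or> key r < key c"
  shows "fdet N F = (\<Prod>r<N. F r r)"
proof -
  have "(\<Prod>r<N. F r (p r)) = 0" if p: "p permutes {..<N}" and "p \<noteq> id" for p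
  proof (rule ccontr)
    assume nz: "(\<Prod>r<N. F r (p r)) \<noteq> 0"
    have pN: "p r < N" if "r < N" for r
      using that permutes_in_image[OF p] by fastforce
    have *: "r = p r \<or> key r < key (p r)" if "r < N" for r
      using nz that pN assms by auto
    then have "p r = r" if "r < N" for r
      using permutes_mono_imp_eq[OF p, of key r] that by fastforce
    then have "p = id"
      using p by (auto simp: fun_eq_iff permutes_def)
    with \<open>p \<noteq> id\<close> show False by simp
  qed
  then have "fdet N F = (\<Sum>p\<in>{id}. signof p * (\<Prod>r<N. F r (p r)))"
    unfolding fdet_leibniz
    by (intro sum.mono_neutral_right) (auto simp: finite_permutations permutes_id)
  then show ?thesis by simp
qed

lemma fdet_mult:
  "fdet N (\<lambda>r c. \<Sum>x<N. F r x * G x c) = fdet N F * fdet N G"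
proof -
  have "mat N N (\<lambda>(r, c). \<Sum>x<N. F r x * G x c)
      = mat N N (\<lambda>(r, c). F r c) * mat N N (\<lambda>(r, c). G r c)"
    by (intro eq_matI) (auto simp: scalar_prod_def atLeast0LessThan)
  then show ?thesis
    unfolding fdet_def by (simp add: det_mult[of _ N])
qed

text \<open>The matrix \<open>E\<close> of the operation is unipotent triangular once the modified
  columns are placed after the others; \<open>z (pc c) = 0\<close> says that a subtracted column is
  not itself modified.\<close>

lemma fdet_column_op:
  fixes F :: "nat \<Rightarrow> nat \<Rightarrow> 'a::idom"
  assumes "\<And>c. c < N \<Longrightarrow> z c \<noteq> 0 \<Longrightarrow> pc c < N \<and> z (pc c) = 0"
  shows "fdet N (\<lambda>r c. F r c - z c * F r (pc c)) = fdet N F"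
proof -
  define E where "E x c = (if x = c then 1 else 0) - (if x = pc c then z c else 0)" for x c
  have "fdet N E = (\<Prod>r<N. E r r)"
    using assms by (intro fdet_triangular[where key = "\<lambda>c. if z c = 0 then 0 else 1"])
      (auto simp: E_def split: if_splits)
  also have "\<dots> = 1"
    using assms by (intro prod.neutral) (force simp: E_def)
  finally have "fdet N E = 1" .
  moreover have "(\<Sum>x<N. F r x * E x c) = F r c - z c * F r (pc c)" if "c < N" for r c
  proof -
    have "(\<Sum>x<N. F r x * E x c)
        = (\<Sum>x<N. if x = c then F r x else 0) - (\<Sum>x<N. if x = pc c then F r x * z c else 0)"
      unfolding E_def sum_subtractf[symmetric] by (intro sum.cong) (auto simp: algebra_simps)
    also have "\<dots> = F r c - z c * F r (pc c)"
      using that assms[OF that] by (cases "z c = 0") (auto simp: sum.delta)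
    finally show ?thesis .
  qed
  ultimately show ?thesis
    using fdet_mult[of N F E] by (simp cong: fdet_cong)
qed

lemma fdet_row_replace:
  fixes F :: "nat \<Rightarrow> nat \<Rightarrow> 'a::idom"
  assumes "r0 < N"
  shows "fdet N (\<lambda>r c. if r = r0 then \<Sum>x<N. a x * F x c else F r c) = a r0 * fdet N F"
proof -
  define E where "E r x = (if r = r0 then a x else if r = x then 1 else 0)" for r x
  have "fdet N E = (\<Prod>r<N. E r r)"
    by (intro fdet_triangular[where key = "\<lambda>c. if c = r0 then 0 else 1"])
      (auto simp: E_def split: if_splits)
  also have "\<dots> = (\<Prod>r<N. if r = r0 then a r0 else 1)"
    by (intro prod.cong) (auto simp: E_def)
  finally have "fdet N E = a r0" using assms by (simp add: prod.delta)
  moreover have "(\<Sum>x<N. E r x * F x c) = (if r = r0 then \<Sum>x<N. a x * F x c else F r c)"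
    if "r < N" for r c
    using that by (auto simp: E_def sum.delta if_distrib[where f = "\<lambda>t. t * _"] cong: if_cong)
  ultimately show ?thesis
    using fdet_mult[of N E F] by (simp cong: fdet_cong)
qed

lemma fdet_sum_rows:
  fixes a :: "nat \<Rightarrow> 'b \<Rightarrow> 'a::comm_ring_1"
  assumes "finite S"
  shows "fdet N (\<lambda>r c. \<Sum>x\<in>S. a r x * v x c)
    = (\<Sum>\<rho>\<in>{..<N} \<rightarrow>\<^sub>E S. (\<Prod>r<N. a r (\<rho> r)) * fdet N (\<lambda>r c. v (\<rho> r) c))"
proof -
  have "fdet N (\<lambda>r c. \<Sum>x\<in>S. a r x * v x c)
    = (\<Sum>p | p permutes {..<N}. \<Sum>\<rho>\<in>{..<N} \<rightarrow>\<^sub>E S.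
        signof p * ((\<Prod>r<N. a r (\<rho> r)) * (\<Prod>r<N. v (\<rho> r) (p r))))"
    unfolding fdet_leibniz using assms
    by (intro sum.cong refl) (simp add: prod_sum_PiE prod.distrib sum_distrib_left)
  also have "\<dots> = (\<Sum>\<rho>\<in>{..<N} \<rightarrow>\<^sub>E S. \<Sum>p | p permutes {..<N}.
        signof p * ((\<Prod>r<N. a r (\<rho> r)) * (\<Prod>r<N. v (\<rho> r) (p r))))"
    by (rule sum.swap)
  finally show ?thesis
    unfolding fdet_leibniz by (simp add: sum_distrib_left mult_ac)
qed

subsection \<open>Row reduction with bounded multipliers\<close>

text \<open>Bounded multipliers stand in for the compact factor of an Iwasawa decomposition. Only
  the modulus of the determinant is fixed, because row swaps change its sign.\<close>

definition row_reducible :: "nat \<Rightarrow> real \<Rightarrow> complex mat \<Rightarrow> complex mat \<Rightarrow> bool" where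
  "row_reducible n B X Y \<longleftrightarrow> (\<exists>M\<in>carrier_mat n n.
     (\<forall>i<n. \<forall>j<n. cmod (M $$ (i, j)) \<le> B) \<and> cmod (det M) = 1 \<and> Y = M * X)"

lemma row_reducible_trans:
  assumes "row_reducible n B X Y" "row_reducible n B' Y Z" "X \<in> carrier_mat n n"
  shows "row_reducible n (real n * (B' * B)) X Z"
proof -
  obtain M where M: "M \<in> carrier_mat n n" "\<And>i j. i < n \<Longrightarrow> j < n \<Longrightarrow> cmod (M $$ (i, j)) \<le> B"
    "cmod (det M) = 1" "Y = M * X"
    using assms(1) unfolding row_reducible_def by blast
  obtain L where L: "L \<in> carrier_mat n n" "\<And>i j. i < n \<Longrightarrow> j < n \<Longrightarrow> cmod (L $$ (i, j)) \<le> B'"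
    "cmod (det L) = 1" "Z = L * Y"
    using assms(2) unfolding row_reducible_def by blast
  have "cmod ((L * M) $$ (i, j)) \<le> real n * (B' * B)" if "i < n" "j < n" for i j
  proof -
    have "(L * M) $$ (i, j) = (\<Sum>x<n. L $$ (i, x) * M $$ (x, j))"
      using L(1) M(1) that by (auto simp: scalar_prod_def atLeast0LessThan)
    also have "cmod \<dots> \<le> (\<Sum>x<n. B' * B)"
    proof (intro sum_norm_le)
      fix x assume "x \<in> {..<n}"
      moreover have "0 \<le> B'" using L(2)[OF that] norm_ge_zero order_trans by blast
      ultimately show "cmod (L $$ (i, x) * M $$ (x, j)) \<le> B' * B"
        using L(2)[of i x] M(2)[of x j] that by (simp add: norm_mult mult_mono)
    qed
    finally show ?thesis by simp
  qed
  moreover have "Z = L * M * X" using L M assms(3) by simp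
  moreover have "cmod (det (L * M)) = 1" using L M by (simp add: det_mult[of _ n] norm_mult)
  moreover have "L * M \<in> carrier_mat n n" using L M by simp
  ultimately show ?thesis unfolding row_reducible_def by blast
qed

text \<open>Partial pivoting: with an entry of largest modulus as pivot all multipliers have modulus
  at most 1. The bound \<open>real n\<close> comes from composing the swap with the elimination,
  each bounded by 1.\<close>

lemma row_reducible_clear_column:
  fixes X :: "complex mat"
  assumes X: "X \<in> carrier_mat n n" and c: "c < n"
    and zero: "\<And>i j. j < c \<Longrightarrow> j < i \<Longrightarrow> i < n \<Longrightarrow> X $$ (i, j) = 0"
  obtains Y where "row_reducible n (real n) X Y"
    "\<And>i j. j \<le> c \<Longrightarrow> j < i \<Longrightarrow> i < n \<Longrightarrow> Y $$ (i, j) = 0"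
proof -
  have "Max ((\<lambda>p. cmod (X $$ (p, c))) ` {c..<n}) \<in> (\<lambda>p. cmod (X $$ (p, c))) ` {c..<n}"
    using c by (intro Max_in) auto
  then obtain p where p: "c \<le> p" "p < n"
    and pmax: "Max ((\<lambda>p. cmod (X $$ (p, c))) ` {c..<n}) = cmod (X $$ (p, c))" by auto
  have max: "cmod (X $$ (i, c)) \<le> cmod (X $$ (p, c))" if "c \<le> i" "i < n" for i
    unfolding pmax[symmetric] using that by (intro Max_ge) auto
  define Z where "Z = (if p = c then X else swaprows c p X)"
  have Z: "Z \<in> carrier_mat n n" using X by (simp add: Z_def)
  have Zent: "Z $$ (i, j) = X $$ (if i = c then p else if i = p then c else i, j)"
    if "i < n" "j < n" for i j
    using X that p c by (auto simp: Z_def)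
  have one: "(1::real) \<le> real n" using c by simp
  have XZ: "row_reducible n 1 X Z"
  proof (cases "p = c")
    case True
    then show ?thesis
      unfolding row_reducible_def Z_def using X by (intro bexI[of _ "1\<^sub>m n"]) auto
  next
    case False
    then have "Z = swaprows_mat n c p * X"
      using swaprows_mat[OF X c p(2)] by (simp add: Z_def)
    then show ?thesis
      unfolding row_reducible_def using False p c
      by (intro bexI[of _ "swaprows_mat n c p"]) (auto simp: det_swaprows_mat)
  qed
  \<comment> \<open>If the pivot is 0, the entries below it are 0 as well, and division by zero
    yields the multiplier 0, which is the right one.\<close>
  define e where "e i j = (if i = j then 1 else if j = c \<and> c < i then - (Z $$ (i, c) / Z $$ (c, c)) else 0)" for i j
  define L where "L = mat n n (\<lambda>(i, j). e i j)"
  have L: "L \<in> carrier_mat n n" by (simp add: L_def)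
  have "det L = fdet n e" by (simp add: L_def fdet_def)
  also have "\<dots> = (\<Prod>r<n. e r r)"
    by (intro fdet_triangular[where key = "\<lambda>i. if i = c then 1 else 0"]) (auto simp: e_def split: if_splits)
  finally have detL: "det L = 1" by (simp add: e_def)
  have "cmod (e i j) \<le> 1" if "i < n" "j < n" for i j
    using max[of "if i = p then c else i"] that c p
    by (auto simp: e_def Zent norm_divide intro!: divide_le_eq_1[THEN iffD2])
  then have "row_reducible n 1 Z (L * Z)"
    unfolding row_reducible_def using L detL by (intro bexI[of _ L]) (auto simp: L_def)
  from row_reducible_trans[OF XZ this X] have "row_reducible n (real n) X (L * Z)" by simp
  moreover have "(L * Z) $$ (i, j) = 0" if "j \<le> c" "j < i" "i < n" for i j
  proof -
    have "(L * Z) $$ (i, j) = (\<Sum>x<n. e i x * Z $$ (x, j))"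
      using L Z that by (auto simp: L_def scalar_prod_def atLeast0LessThan)
    also have "\<dots> = (\<Sum>x<n. if x = i then Z $$ (i, j) else
        if x = c \<and> c < i then - (Z $$ (i, c) / Z $$ (c, c)) * Z $$ (c, j) else 0)"
      by (intro sum.cong) (auto simp: e_def)
    also have "\<dots> = Z $$ (i, j) + (if c < i then - (Z $$ (i, c) / Z $$ (c, c)) * Z $$ (c, j) else 0)"
    proof (cases "c < i")
      case True
      have "(\<Sum>x<n. if x = i then Z $$ (i, j) else
          if x = c \<and> c < i then - (Z $$ (i, c) / Z $$ (c, c)) * Z $$ (c, j) else 0)
        = (\<Sum>x<n. if x = i then Z $$ (i, j) else 0)
          + (\<Sum>x<n. if x = c then - (Z $$ (i, c) / Z $$ (c, c)) * Z $$ (c, j) else 0)"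
        unfolding sum.distrib[symmetric] using True by (intro sum.cong) auto
      then show ?thesis using True that c by simp
    next
      case False
      then show ?thesis using that by (simp cong: if_cong)
    qed
    also have "\<dots> = 0"
    proof (cases "j = c")
      case True
      have "Z $$ (i, c) = 0" if "Z $$ (c, c) = 0"
        using max[of "if i = p then c else i"] that \<open>j < i\<close> \<open>i < n\<close> c p True
        by (auto simp: Zent split: if_splits)
      then show ?thesis using True that by auto
    next
      case False
      then have "Z $$ (i, j) = 0" "c < i \<Longrightarrow> Z $$ (c, j) = 0"
        using that zero p c by (auto simp: Zent)
      then show ?thesis by auto
    qed
    finally show ?thesis .
  qed
  ultimately show ?thesis using that by blast
qed

lemma row_reducible_upper_triangular:
  "\<exists>B. \<forall>X\<in>carrier_mat n n. \<exists>Y. row_reducible n B X Y \<and> (\<forall>j<n. \<forall>i<n. j < i \<longrightarrow> Y $$ (i, j) = 0)"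
proof -
  have "\<exists>B. \<forall>X\<in>carrier_mat n n. \<exists>Y. row_reducible n B X Y \<and> (\<forall>j<c. \<forall>i<n. j < i \<longrightarrow> Y $$ (i, j) = 0)"
    if "c \<le> n" for c
    using that
  proof (induction c)
    case 0
    have "row_reducible n 1 X X" if "X \<in> carrier_mat n n" for X
      unfolding row_reducible_def using that by (intro bexI[of _ "1\<^sub>m n"]) auto
    then show ?case by auto
  next
    case (Suc c)
    then obtain B where B: "\<And>X. X \<in> carrier_mat n n \<Longrightarrow>
        \<exists>Y. row_reducible n B X Y \<and> (\<forall>j<c. \<forall>i<n. j < i \<longrightarrow> Y $$ (i, j) = 0)"
      by auto
    have "\<exists>Z. row_reducible n (real n * (real n * B)) X Z \<and> (\<forall>j<Suc c. \<forall>i<n. j < i \<longrightarrow> Z $$ (i, j) = 0)"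
      if X: "X \<in> carrier_mat n n" for X
    proof -
      obtain Y where Y: "row_reducible n B X Y" "\<forall>j<c. \<forall>i<n. j < i \<longrightarrow> Y $$ (i, j) = 0"
        using B[OF X] by blast
      have "Y \<in> carrier_mat n n" using Y(1) X unfolding row_reducible_def by auto
      then obtain Z where Z: "row_reducible n (real n) Y Z"
          "\<And>i j. j \<le> c \<Longrightarrow> j < i \<Longrightarrow> i < n \<Longrightarrow> Z $$ (i, j) = 0"
        using row_reducible_clear_column[of Y n c] Suc.prems Y(2) by auto
      show ?thesis
        using row_reducible_trans[OF Y(1) Z(1) X] Z(2) by (auto intro!: exI[of _ Z])
    qed
    then show ?case by blast
  qed
  from this[of n] show ?thesis by simp
qed

subsection \<open>Determinants of words\<close>

text \<open>
  Linear forms are coefficient vectors with respect to the ordered basis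
  x_0, x_2, ..., y, x_1, x_3, ...; x_i sits at position \<open>node_pos k i\<close> and y at position k.
\<close>

definition node_pos :: "nat \<Rightarrow> nat \<Rightarrow> nat" where
  "node_pos k i = (if even i then i div 2 else k + 1 + i div 2)"

text \<open>On the component P_i only x_i, y and x_(i+1) are nonzero, with values 1, u and
  u^2.\<close>

definition lin_form :: "nat \<Rightarrow> (nat \<Rightarrow> nat \<Rightarrow> complex) \<Rightarrow> nat \<Rightarrow> nat \<Rightarrow> complex poly" where
  "lin_form k X j i = [:X j (node_pos k i), X j k, X j (node_pos k (Suc i mod (2 * k))):]"

definition comp_of :: "nat \<Rightarrow> nat \<Rightarrow> nat" where "comp_of m r = r div (2 * m - 1)"
definition expo_of :: "nat \<Rightarrow> nat \<Rightarrow> nat" where "expo_of m r = r mod (2 * m - 1)"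

definition dim_sections :: "nat \<Rightarrow> nat \<Rightarrow> nat" where "dim_sections k m = 2 * k * (2 * m - 1)"

text \<open>
  A word is a list of m row indices of X and stands for the product of the corresponding linear
  forms; \<open>word_det\<close> is the minor of the restriction map on a family of words. Column c is the
  coefficient of u^e on the component P_i, where c = i (2m - 1) + e.
\<close>

definition word_det :: "nat \<Rightarrow> nat \<Rightarrow> (nat \<Rightarrow> nat \<Rightarrow> complex) \<Rightarrow> (nat \<Rightarrow> nat list) \<Rightarrow> complex" where
  "word_det k m X W = fdet (dim_sections k m)
     (\<lambda>r c. coeff (\<Prod>j\<leftarrow>W r. lin_form k X j (comp_of m c)) (expo_of m c))"

definition word_family :: "nat \<Rightarrow> nat \<Rightarrow> (nat \<Rightarrow> nat list) \<Rightarrow> bool" where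
  "word_family k m W \<longleftrightarrow>
     (\<forall>r<dim_sections k m. length (W r) = m \<and> set (W r) \<subseteq> {..<2 * k + 1})"

lemma prod_list_map_nth: "prod_list (map f L) = (\<Prod>s<length L. f (L ! s))"
  by (simp add: prod.list_conv_set_nth atLeast0LessThan)

lemma lin_form_mult:
  assumes "\<And>j l. X' j l = (\<Sum>t<n. M j t * X t l)"
  shows "lin_form k X' j i = (\<Sum>t<n. smult (M j t) (lin_form k X t i))"
proof -
  have "coeff (lin_form k X' j i) e = coeff (\<Sum>t<n. smult (M j t) (lin_form k X t i)) e" for e
    by (auto simp: lin_form_def assms coeff_sum coeff_pCons split: nat.split)
  then show ?thesis by (simp add: poly_eq_iff)
qed

lemma word_det_expand:
  assumes X': "\<And>j l. X' j l = (\<Sum>t<2*k+1. M j t * X t l)"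
    and W: "word_family k m W"
  defines "S \<equiv> {..<m} \<rightarrow>\<^sub>E {..<2*k+1}"
  shows "word_det k m X' W = (\<Sum>\<rho>\<in>{..<dim_sections k m} \<rightarrow>\<^sub>E S.
     (\<Prod>r<dim_sections k m. \<Prod>s<m. M (W r ! s) (\<rho> r s)) * word_det k m X (\<lambda>r. map (\<rho> r) [0..<m]))"
proof -
  have fin: "finite S" by (simp add: S_def finite_PiE)
  have "coeff (\<Prod>j\<leftarrow>W r. lin_form k X' j i) e = (\<Sum>\<tau>\<in>S. (\<Prod>s<m. M (W r ! s) (\<tau> s)) *
      coeff (\<Prod>j\<leftarrow>map \<tau> [0..<m]. lin_form k X j i) e)" if "r < dim_sections k m" for r i e
  proof -
    have len: "length (W r) = m" using W that by (simp add: word_family_def)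
    have "(\<Prod>j\<leftarrow>W r. lin_form k X' j i)
       = (\<Prod>s<m. \<Sum>t<2*k+1. smult (M (W r ! s) t) (lin_form k X t i))"
      by (simp add: prod_list_map_nth len lin_form_mult[OF X'])
    also have "\<dots> = (\<Sum>\<tau>\<in>S. \<Prod>s<m. smult (M (W r ! s) (\<tau> s)) (lin_form k X (\<tau> s) i))"
      unfolding S_def by (subst prod_sum_PiE) auto
    also have "\<dots> = (\<Sum>\<tau>\<in>S. smult (\<Prod>s<m. M (W r ! s) (\<tau> s)) (\<Prod>j\<leftarrow>map \<tau> [0..<m]. lin_form k X j i))"
      by (simp add: prod_list_map_nth prod_smult)
    finally show ?thesis by (simp add: coeff_sum)
  qed
  then have "word_det k m X' W = fdet (dim_sections k m)
     (\<lambda>r c. \<Sum>\<tau>\<in>S. (\<Prod>s<m. M (W r ! s) (\<tau> s)) *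
        coeff (\<Prod>j\<leftarrow>map \<tau> [0..<m]. lin_form k X j (comp_of m c)) (expo_of m c))"
    unfolding word_det_def by (intro fdet_cong) simp
  also have "\<dots> = (\<Sum>\<rho>\<in>{..<dim_sections k m} \<rightarrow>\<^sub>E S.
     (\<Prod>r<dim_sections k m. \<Prod>s<m. M (W r ! s) (\<rho> r s)) * word_det k m X (\<lambda>r. map (\<rho> r) [0..<m]))"
    unfolding word_det_def by (rule fdet_sum_rows[OF fin])
  finally show ?thesis .
qed

text \<open>\<open>K\<close> depends on \<open>k\<close>, \<open>m\<close> and \<open>B\<close>
  only. Used in contrapositive form for the row reduction: if some minor of the reduced matrix is
  bounded below, so is some minor of the original one.\<close>

lemma word_det_bound:
  fixes k m :: nat and B :: real
  obtains K where "K > 0" and "\<And>X X' M \<epsilon> W. (\<And>j l. X' j l = (\<Sum>t<2*k+1. M j t * X t l)) \<Longrightarrow>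
     (\<And>j t. j < 2*k+1 \<Longrightarrow> t < 2*k+1 \<Longrightarrow> cmod (M j t) \<le> B) \<Longrightarrow>
     (\<And>W'. word_family k m W' \<Longrightarrow> cmod (word_det k m X W') \<le> \<epsilon>) \<Longrightarrow>
     word_family k m W \<Longrightarrow> cmod (word_det k m X' W) \<le> K * \<epsilon>"
proof -
  define S where "S = {..<m} \<rightarrow>\<^sub>E {..<2*k+1}"
  define N where "N = dim_sections k m"
  define B1 where "B1 = max 1 B"
  define K where "K = real (card ({..<N} \<rightarrow>\<^sub>E S)) * (B1 ^ m) ^ N + 1"
  have "cmod (word_det k m X' W) \<le> K * \<epsilon>"
    if X': "\<And>j l. X' j l = (\<Sum>t<2*k+1. M j t * X t l)"
      and M: "\<And>j t. j < 2*k+1 \<Longrightarrow> t < 2*k+1 \<Longrightarrow> cmod (M j t) \<le> B"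
      and \<epsilon>: "\<And>W'. word_family k m W' \<Longrightarrow> cmod (word_det k m X W') \<le> \<epsilon>"
      and W: "word_family k m W" for X X' M \<epsilon> W
  proof -
    have \<epsilon>0: "0 \<le> \<epsilon>" using \<epsilon>[OF W] norm_ge_zero order_trans by blast
    have "cmod (word_det k m X' W) \<le> (\<Sum>\<rho>\<in>{..<N} \<rightarrow>\<^sub>E S. (B1 ^ m) ^ N * \<epsilon>)"
      unfolding word_det_expand[OF X' W] S_def[symmetric] N_def[symmetric]
    proof (intro sum_norm_le)
      fix \<rho> assume \<rho>: "\<rho> \<in> {..<N} \<rightarrow>\<^sub>E S"
      have "word_family k m (\<lambda>r. map (\<rho> r) [0..<m])"
        using \<rho> by (fastforce simp: word_family_def N_def S_def dest: PiE_mem)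
      then have "cmod (word_det k m X (\<lambda>r. map (\<rho> r) [0..<m])) \<le> \<epsilon>" by (rule \<epsilon>)
      moreover have "cmod (\<Prod>r<N. \<Prod>s<m. M (W r ! s) (\<rho> r s)) \<le> (\<Prod>r<N. \<Prod>s<m. B1)"
      proof (unfold prod_norm[symmetric], intro prod_mono conjI prod_nonneg ballI norm_ge_zero)
        fix r s assume rs: "r \<in> {..<N}" "s \<in> {..<m}"
        then have "W r ! s < 2*k+1" using W nth_mem[of s "W r"] by (force simp: word_family_def N_def)
        moreover have "\<rho> r s < 2*k+1" using \<rho> rs by (fastforce simp: S_def dest: PiE_mem)
        ultimately show "cmod (M (W r ! s) (\<rho> r s)) \<le> B1" using M B1_def by fastforce
      qed
      ultimately show "cmod ((\<Prod>r<N. \<Prod>s<m. M (W r ! s) (\<rho> r s)) *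
          word_det k m X (\<lambda>r. map (\<rho> r) [0..<m])) \<le> (B1 ^ m) ^ N * \<epsilon>"
        unfolding norm_mult by (intro mult_mono) (auto simp: B1_def)
    qed
    also have "\<dots> \<le> K * \<epsilon>" using \<epsilon>0 by (simp add: K_def algebra_simps)
    finally show ?thesis .
  qed
  moreover have "K > 0" unfolding K_def B1_def by (intro add_nonneg_pos) auto
  ultimately show ?thesis using that by blast
qed

section \<open>Coordinates and change of basis\<close>

lemma smult_sum_right: "smult c (\<Sum>i\<in>S. f i) = (\<Sum>i\<in>S. smult c (f i))"
  for f :: "'b \<Rightarrow> 'a::comm_semiring_0 poly"
  by (induction S rule: infinite_finite_induct) (auto simp: smult_add_right)

lemma lincomb_delta:
  "k < N \<Longrightarrow> lincomb N (\<lambda>x. if x = k then 1 else 0) b = b k"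
  by (auto simp: lincomb_def if_distrib[where f = "\<lambda>t. smult t _"] cong: if_cong)

lemma lincomb_lincomb:
  assumes "\<And>k. k < N \<Longrightarrow> b k = lincomb N' (P k) b'"
  shows "lincomb N a b = lincomb N' (\<lambda>c. \<Sum>k<N. a k * P k c) b'"
proof
  fix i
  have "lincomb N a b i = (\<Sum>k<N. \<Sum>c<N'. smult (a k * P k c) (b' c i))"
    unfolding lincomb_def[of N] using assms by (intro sum.cong) (auto simp: lincomb_def smult_sum_right)
  also have "\<dots> = lincomb N' (\<lambda>c. \<Sum>k<N. a k * P k c) b' i"
    by (subst sum.swap) (simp add: lincomb_def smult_sum)
  finally show "lincomb N a b i = lincomb N' (\<lambda>c. \<Sum>k<N. a k * P k c) b' i" .
qed

lemma coords_lincomb: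
  assumes "is_basis_of S N b" "s \<in> S"
  shows "s = lincomb N (coords N b s) b" "N \<le> k \<Longrightarrow> coords N b s k = 0"
proof -
  have "\<exists>!a. (\<forall>k. N \<le> k \<longrightarrow> a k = 0) \<and> s = lincomb N a b"
    using assms by (auto simp: is_basis_of_def)
  from theI'[OF this]
  show "s = lincomb N (coords N b s) b" "N \<le> k \<Longrightarrow> coords N b s k = 0"
    by (auto simp: coords_def)
qed

lemma coords_unique:
  assumes "is_basis_of S N b" "s \<in> S" "s = lincomb N a b" "k < N"
  shows "coords N b s k = a k"
proof -
  have ex1: "\<exists>!a. (\<forall>k. N \<le> k \<longrightarrow> a k = 0) \<and> s = lincomb N a b"
    using assms by (auto simp: is_basis_of_def)
  define a' where "a' k = (if k < N then a k else 0)" for k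
  have "s = lincomb N a' b" using assms(3) by (simp add: lincomb_def a'_def)
  then have "coords N b s = a'"
    unfolding coords_def using ex1 by (intro the1_equality) (auto simp: a'_def)
  then show ?thesis using assms(4) by (simp add: a'_def)
qed

lemma coords_change_basis:
  assumes "is_basis_of S N b" "is_basis_of S N' b'" "s \<in> S" "c < N'"
  shows "coords N' b' s c = (\<Sum>k<N. coords N b s k * coords N' b' (b k) c)"
proof (rule coords_unique[OF assms(2,3) _ assms(4)])
  have "b k = lincomb N' (coords N' b' (b k)) b'" if "k < N" for k
    using assms(1) that by (intro coords_lincomb(1)[OF assms(2)]) (auto simp: is_basis_of_def)
  then show "s = lincomb N' (\<lambda>c. \<Sum>k<N. coords N b s k * coords N' b' (b k) c) b'"
    by (rule trans[OF coords_lincomb(1)[OF assms(1,3)] lincomb_lincomb])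
qed

lemma coords_basis:
  assumes "is_basis_of S N b" "k < N" "c < N"
  shows "coords N b (b k) c = (if c = k then 1 else 0)"
  using assms(1,2)
  by (intro coords_unique[OF assms(1) _ lincomb_delta[OF assms(2), symmetric] assms(3)])
    (auto simp: is_basis_of_def)

lemma coords_inverse:
  assumes "is_basis_of S N b" "is_basis_of S N' b'" "r < N" "c < N"
  shows "(\<Sum>x<N'. coords N' b' (b r) x * coords N b (b' x) c) = (if c = r then 1 else 0)"
  using coords_change_basis[OF assms(2,1), of "b r" c] coords_basis[OF assms(1)] assms
  by (auto simp: is_basis_of_def)

text \<open>The transition matrices are inverse to each other, so the traces of their two products
  are \<open>N\<close> and \<open>N'\<close>; the traces agree, and the characteristic is 0.\<close>

lemma basis_size_unique:
  assumes "is_basis_of S N b" "is_basis_of S N' b'"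
  shows "N = N'"
proof -
  have "of_nat N = (\<Sum>r<N. \<Sum>x<N'. coords N' b' (b r) x * coords N b (b' x) r)"
    using coords_inverse[OF assms] by simp
  also have "\<dots> = (\<Sum>x<N'. \<Sum>r<N. coords N b (b' x) r * coords N' b' (b r) x)"
    by (subst sum.swap) (simp add: mult.commute)
  also have "\<dots> = of_nat N'"
    using coords_inverse[OF assms(2,1)] by simp
  finally have "complex_of_nat N = complex_of_nat N'" .
  then show ?thesis by (simp only: of_nat_eq_iff)
qed

lemma fdet_change_basis_nonzero:
  assumes "is_basis_of S N b" "is_basis_of S N b'"
  shows "fdet N (\<lambda>k c. coords N b' (b k) c) \<noteq> 0"
proof -
  have "fdet N (\<lambda>k c. coords N b' (b k) c) * fdet N (\<lambda>k c. coords N b (b' k) c)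
      = fdet N (\<lambda>r c. if c = r then 1 else 0 :: complex)"
    unfolding fdet_mult[symmetric] by (intro fdet_cong) (simp add: coords_inverse[OF assms])
  also have "\<dots> = 1"
    by (subst fdet_triangular[where key = "\<lambda>_. 0"]) (auto split: if_splits)
  finally show ?thesis by auto
qed

section \<open>Products of sections, monomials and words\<close>

lemma coeff_mult_top:
  fixes p q :: "'a::comm_semiring_1 poly"
  assumes "degree p \<le> d" "degree q \<le> e"
  shows "coeff (p * q) (d + e) = coeff p d * coeff q e"
proof -
  have "coeff (p * q) (d + e) = (\<Sum>i\<le>d+e. coeff p i * coeff q (d + e - i))" by (rule coeff_mult)
  also have "\<dots> = (\<Sum>i\<in>{d}. coeff p i * coeff q (d + e - i))"
  proof (rule sum.mono_neutral_right)
    show "\<forall>i\<in>{..d + e} - {d}. coeff p i * coeff q (d + e - i) = 0"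
    proof
      fix i assume "i \<in> {..d + e} - {d}"
      then have "d < i \<or> e < d + e - i" by auto
      then show "coeff p i * coeff q (d + e - i) = 0" using assms by (auto simp: coeff_eq_0)
    qed
  qed auto
  finally show ?thesis by simp
qed

lemma coeff_mult_subtop:
  fixes p q :: "'a::comm_semiring_1 poly"
  assumes "degree p \<le> Suc d" "degree q \<le> Suc e"
  shows "coeff (p * q) (Suc (d + e)) = coeff p (Suc d) * coeff q e + coeff p d * coeff q (Suc e)"
proof -
  have "coeff (p * q) (Suc (d + e)) = (\<Sum>i\<le>Suc (d+e). coeff p i * coeff q (Suc (d + e) - i))"
    by (rule coeff_mult)
  also have "\<dots> = (\<Sum>i\<in>{d, Suc d}. coeff p i * coeff q (Suc (d + e) - i))"
  proof (rule sum.mono_neutral_right)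
    show "\<forall>i\<in>{..Suc (d + e)} - {d, Suc d}. coeff p i * coeff q (Suc (d + e) - i) = 0"
    proof
      fix i assume "i \<in> {..Suc (d + e)} - {d, Suc d}"
      then have "Suc d < i \<or> Suc e < Suc (d + e) - i" by auto
      then show "coeff p i * coeff q (Suc (d + e) - i) = 0" using assms by (auto simp: coeff_eq_0)
    qed
  qed auto
  also have "\<dots> = coeff p (Suc d) * coeff q e + coeff p d * coeff q (Suc e)"
    by (simp add: Suc_diff_le add.commute)
  finally show ?thesis .
qed

text \<open>The tacnode condition equates a 1-jet at infinity with a 1-jet at 0, and jets multiply:
  the two top coefficients of a product arise from those of the factors exactly as the two bottom
  ones do.\<close>

lemma rosary_sections_mult:
  assumes "1 \<le> a" "1 \<le> b" "p \<in> rosary_sections g a" "q \<in> rosary_sections g b"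
  shows "(\<lambda>i. p i * q i) \<in> rosary_sections g (a + b)"
  unfolding rosary_sections_def
proof (intro CollectI allI conjI impI)
  fix i
  show "p i * q i = 0" if "g - 1 \<le> i"
    using assms that by (auto simp: rosary_sections_def)
  assume i: "i < g - 1"
  have p: "degree (p i) \<le> 2 * a" "coeff (p (Suc i mod (g - 1))) 0 = coeff (p i) (2 * a)"
    "coeff (p (Suc i mod (g - 1))) 1 = coeff (p i) (2 * a - 1)"
   and q: "degree (q i) \<le> 2 * b" "coeff (q (Suc i mod (g - 1))) 0 = coeff (q i) (2 * b)"
    "coeff (q (Suc i mod (g - 1))) 1 = coeff (q i) (2 * b - 1)"
    using assms i by (auto simp: rosary_sections_def)
  show "degree (p i * q i) \<le> 2 * (a + b)"
    using order.trans[OF degree_mult_le add_mono[OF p(1) q(1)]] by simp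
  show "coeff (p (Suc i mod (g - 1)) * q (Suc i mod (g - 1))) 0 = coeff (p i * q i) (2 * (a + b))"
    unfolding coeff_mult_0 p(2) q(2) distrib_left by (rule coeff_mult_top[OF p(1) q(1), symmetric])
  obtain a' b' where ab: "2 * a = Suc a'" "2 * b = Suc b'"
    using assms using that[of "2 * a - 1" "2 * b - 1"] by auto
  have sub: "2 * (a + b) - 1 = Suc (a' + b')" "2 * a - 1 = a'" "2 * b - 1 = b'"
    using ab by auto
  have top: "coeff (p i * q i) (Suc (a' + b'))
      = coeff (p i) (Suc a') * coeff (q i) b' + coeff (p i) a' * coeff (q i) (Suc b')"
    using p(1) q(1) unfolding ab by (rule coeff_mult_subtop)
  have bot: "coeff (P * Q) 1 = coeff P 0 * coeff Q 1 + coeff P 1 * coeff Q 0" for P Q :: "complex poly"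
    by (simp add: coeff_mult)
  show "coeff (p (Suc i mod (g - 1)) * q (Suc i mod (g - 1))) 1 = coeff (p i * q i) (2 * (a + b) - 1)"
    unfolding bot p(2,3) q(2,3) sub top unfolding ab by (rule refl)
qed

lemma rosary_sections_prod_list:
  assumes "L \<noteq> []" "\<And>j. j \<in> set L \<Longrightarrow> f j \<in> rosary_sections g 1"
  shows "(\<lambda>i. \<Prod>j\<leftarrow>L. f j i) \<in> rosary_sections g (length L)"
  using assms
proof (induction L rule: list_nonempty_induct)
  case (single x)
  then show ?case by simp
next
  case (cons x xs)
  then have "(\<lambda>i. f x i * (\<Prod>j\<leftarrow>xs. f j i)) \<in> rosary_sections g (1 + length xs)"
    by (intro rosary_sections_mult) (auto simp: Suc_le_eq)
  then show ?case by simp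
qed

lemma restrict_mon_count_list:
  assumes "set L \<subseteq> {..<g}"
  shows "restrict_mon g w (count_list L) i = (\<Prod>j\<leftarrow>L. w j i)"
  using assms
proof (induction L)
  case Nil
  then show ?case by (simp add: restrict_mon_def)
next
  case (Cons a L)
  have "restrict_mon g w (count_list (a # L)) i
      = (\<Prod>j<g. (if j = a then w j i else 1) * w j i ^ count_list L j)"
    unfolding restrict_mon_def by (intro prod.cong) auto
  also have "\<dots> = w a i * restrict_mon g w (count_list L) i"
    using Cons.prems by (simp add: prod.distrib restrict_mon_def prod.delta)
  also have "\<dots> = (\<Prod>j\<leftarrow>a # L. w j i)"
    using Cons by simp
  finally show ?case .
qed

lemma monomials_eq_count_list:
  assumes "\<alpha> \<in> monomials g m"
  shows "\<exists>L. length L = m \<and> set L \<subseteq> {..<g} \<and> count_list L = \<alpha>"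
proof -
  define L where "L = concat (map (\<lambda>j. replicate (\<alpha> j) j) [0..<g])"
  have sub: "set L \<subseteq> {..<g}" by (auto simp: L_def)
  have rep: "count_list (replicate n x) j = (if j = x then n else 0)" for n x and j :: nat
    by (induction n) auto
  have "count_list (concat (map (\<lambda>j. replicate (\<alpha> j) j) xs)) j = (if j \<in> set xs then \<alpha> j else 0)"
    if "distinct xs" for xs and j :: nat
    using that by (induction xs) (auto simp: count_list_append rep)
  then have "count_list L j = \<alpha> j" for j
    using assms by (auto simp: L_def monomials_def)
  then have "count_list L = \<alpha>" by auto
  moreover have "length L = (\<Sum>j<g. \<alpha> j)"
    by (simp add: L_def length_concat sum_list_distinct_conv_sum_set atLeast0LessThan o_def)
  ultimately show ?thesis
    using assms sub by (auto simp: monomials_def)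
qed

lemma count_list_in_monomials:
  "set L \<subseteq> {..<g} \<Longrightarrow> count_list L \<in> monomials g (length L)"
  by (auto simp: monomials_def count_list_0_iff sum_count_set)

subsection \<open>Coordinates on the rosary\<close>

definition index_of :: "nat \<Rightarrow> nat \<Rightarrow> nat \<Rightarrow> nat" where
  "index_of m i e = i * (2 * m - 1) + e"

lemma comp_expo_of:
  assumes "e < 2 * m - 1"
  shows "comp_of m (index_of m i e) = i" "expo_of m (index_of m i e) = e"
  using assms by (auto simp: comp_of_def expo_of_def index_of_def)

lemma index_of_lt:
  assumes "i < 2 * k" "e < 2 * m - 1"
  shows "index_of m i e < dim_sections k m"
proof -
  have "i * (2 * m - 1) + e < Suc i * (2 * m - 1)" using assms by simp
  also have "\<dots> \<le> 2 * k * (2 * m - 1)" using assms by (intro mult_le_mono1) auto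
  finally show ?thesis by (simp add: dim_sections_def index_of_def)
qed

lemma index_decompose:
  assumes "r < dim_sections k m"
  shows "comp_of m r < 2 * k" "expo_of m r < 2 * m - 1" "index_of m (comp_of m r) (expo_of m r) = r"
proof -
  have "0 < 2 * m - 1" using assms by (cases "2 * m - 1 = 0") (auto simp: dim_sections_def)
  then show "comp_of m r < 2 * k" "expo_of m r < 2 * m - 1"
    using assms by (auto simp: comp_of_def expo_of_def dim_sections_def less_mult_imp_div_less)
  show "index_of m (comp_of m r) (expo_of m r) = r"
    unfolding comp_of_def expo_of_def index_of_def by (rule div_mult_mod_eq)
qed

text \<open>Every coefficient in terms of the free ones: those of u^(2m-1) and u^(2m) on P_i are
  glued to those of u and 1 on the next component, which are free as soon as m \<ge> 2.\<close>

definition section_coeff :: "nat \<Rightarrow> nat \<Rightarrow> nat \<Rightarrow> nat \<Rightarrow> nat" where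
  "section_coeff k m i e =
     (if e < 2 * m - 1 then index_of m i e else index_of m (Suc i mod (2 * k)) (2 * m - e))"

definition section_of :: "nat \<Rightarrow> nat \<Rightarrow> (nat \<Rightarrow> complex) \<Rightarrow> nat \<Rightarrow> complex poly" where
  "section_of k m a i = (if i < 2 * k then \<Sum>e\<le>2*m. monom (a (section_coeff k m i e)) e else 0)"

lemma section_coeff_lt:
  assumes "2 \<le> m" "i < 2 * k" "e \<le> 2 * m"
  shows "section_coeff k m i e < dim_sections k m"
  using assms by (auto simp: section_coeff_def intro!: index_of_lt)

lemma coeff_section_of:
  assumes "i < 2 * k"
  shows "coeff (section_of k m a i) e = (if e \<le> 2 * m then a (section_coeff k m i e) else 0)"
  using assms by (auto simp: section_of_def coeff_sum)

lemma section_of_in_sections: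
  assumes "2 \<le> m"
  shows "section_of k m a \<in> rosary_sections (2 * k + 1) m"
  unfolding rosary_sections_def
proof (intro CollectI allI conjI impI)
  fix i
  show "section_of k m a i = 0" if "2 * k + 1 - 1 \<le> i" using that by (simp add: section_of_def)
  assume "i < 2 * k + 1 - 1"
  then have i: "i < 2 * k" "Suc i mod (2 * k) < 2 * k" by auto
  show "degree (section_of k m a i) \<le> 2 * m"
    using i by (intro degree_le) (auto simp: coeff_section_of)
  show "coeff (section_of k m a (Suc i mod (2 * k + 1 - 1))) 0 = coeff (section_of k m a i) (2 * m)"
    "coeff (section_of k m a (Suc i mod (2 * k + 1 - 1))) 1 = coeff (section_of k m a i) (2 * m - 1)"
    using i assms by (auto simp: coeff_section_of section_coeff_def)
qed

lemma section_of_eq: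
  assumes "2 \<le> m" "s \<in> rosary_sections (2 * k + 1) m"
  shows "s = section_of k m (\<lambda>r. coeff (s (comp_of m r)) (expo_of m r))"
proof
  fix i
  show "s i = section_of k m (\<lambda>r. coeff (s (comp_of m r)) (expo_of m r)) i"
  proof (cases "i < 2 * k")
    case True
    then have s: "degree (s i) \<le> 2 * m"
      "coeff (s (Suc i mod (2 * k))) 0 = coeff (s i) (2 * m)"
      "coeff (s (Suc i mod (2 * k))) 1 = coeff (s i) (2 * m - 1)"
      using assms(2) by (auto simp: rosary_sections_def)
    show ?thesis
    proof (rule poly_eqI)
      fix e
      consider "e < 2 * m - 1" | "e = 2 * m - 1" | "e = 2 * m" | "2 * m < e" by linarith
      then show "coeff (s i) e = coeff (section_of k m (\<lambda>r. coeff (s (comp_of m r)) (expo_of m r)) i) e"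
      proof cases
        case 1
        then show ?thesis using True by (simp add: coeff_section_of section_coeff_def comp_expo_of)
      next
        case 2
        then show ?thesis using True assms(1) s(3)
          by (simp add: coeff_section_of section_coeff_def comp_expo_of)
      next
        case 3
        then show ?thesis using True assms(1) s(2) comp_expo_of[of 0 m "Suc i mod (2 * k)"]
          by (auto simp: coeff_section_of section_coeff_def)
      next
        case 4
        then show ?thesis using True s(1) by (simp add: coeff_section_of coeff_eq_0)
      qed
    qed
  next
    case False
    then show ?thesis using assms(2) by (simp add: rosary_sections_def section_of_def)
  qed
qed

definition std_basis :: "nat \<Rightarrow> nat \<Rightarrow> nat \<Rightarrow> nat \<Rightarrow> complex poly" where
  "std_basis k m c = section_of k m (\<lambda>r. if r = c then 1 else 0)"

lemma lincomb_std_basis: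
  assumes "2 \<le> m"
  shows "lincomb (dim_sections k m) a (std_basis k m) = section_of k m a"
proof
  fix i
  show "lincomb (dim_sections k m) a (std_basis k m) i = section_of k m a i"
  proof (cases "i < 2 * k")
    case True
    show ?thesis
    proof (rule poly_eqI)
      fix e
      show "coeff (lincomb (dim_sections k m) a (std_basis k m) i) e = coeff (section_of k m a i) e"
        using section_coeff_lt[OF assms True, of e] True
        by (simp add: lincomb_def coeff_sum std_basis_def coeff_section_of
            if_distrib[where f = "\<lambda>t. _ * t"] cong: if_cong)
    qed
  qed (simp add: lincomb_def std_basis_def section_of_def)
qed

lemma coeff_section_of_index:
  assumes "r < dim_sections k m"
  shows "coeff (section_of k m a (comp_of m r)) (expo_of m r) = a r"
  using index_decompose[OF assms] by (simp add: coeff_section_of section_coeff_def)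

lemma std_basis_is_basis:
  assumes "2 \<le> m"
  shows "is_basis_of (rosary_sections (2 * k + 1) m) (dim_sections k m) (std_basis k m)"
  unfolding is_basis_of_def lincomb_std_basis[OF assms]
proof (intro conjI ballI allI impI)
  show "std_basis k m c \<in> rosary_sections (2 * k + 1) m" for c
    unfolding std_basis_def by (rule section_of_in_sections[OF assms])
  fix s assume s: "s \<in> rosary_sections (2 * k + 1) m"
  define a where "a r = (if r < dim_sections k m then coeff (s (comp_of m r)) (expo_of m r) else 0)" for r
  have "section_of k m (\<lambda>r. coeff (s (comp_of m r)) (expo_of m r)) = section_of k m a"
    using section_coeff_lt[OF assms] by (auto simp: section_of_def a_def fun_eq_iff intro!: sum.cong)
  with section_of_eq[OF assms s] have "s = section_of k m a" by (rule trans)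
  then show "\<exists>!a. (\<forall>r. dim_sections k m \<le> r \<longrightarrow> a r = 0) \<and> s = section_of k m a"
  proof (intro ex1I conjI)
    fix b assume b: "(\<forall>r. dim_sections k m \<le> r \<longrightarrow> b r = 0) \<and> s = section_of k m b"
    show "b = a"
    proof
      fix r
      show "b r = a r"
        using b coeff_section_of_index[of r k m b] by (cases "r < dim_sections k m") (auto simp: a_def)
    qed
  qed (auto simp: a_def)
qed

lemma coords_std_basis:
  assumes "2 \<le> m" "s \<in> rosary_sections (2 * k + 1) m" "c < dim_sections k m"
  shows "coords (dim_sections k m) (std_basis k m) s c = coeff (s (comp_of m c)) (expo_of m c)"
  using section_of_eq[OF assms(1,2)] assms
  by (intro coords_unique[OF std_basis_is_basis]) (simp_all add: lincomb_std_basis)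

definition std_forms :: "nat \<Rightarrow> nat \<Rightarrow> nat \<Rightarrow> complex poly" where
  "std_forms k l i = (if i < 2 * k then lin_form k (\<lambda>j l. if j = l then 1 else 0) l i else 0)"

lemma node_pos_lt: "i < 2 * k \<Longrightarrow> node_pos k i < 2 * k + 1"
  by (auto simp: node_pos_def)

lemma lincomb_std_forms:
  "lincomb (2 * k + 1) a (std_forms k) i = (if i < 2 * k then lin_form k (\<lambda>_. a) j i else 0)"
proof (cases "i < 2 * k")
  case True
  then have i: "Suc i mod (2 * k) < 2 * k" by simp
  have delta: "(\<Sum>l<n. a l * (if l = p then 1 else 0)) = a p" if "p < n" for n p
    using that by (subst sum.remove[of _ p]) auto
  have "coeff (lincomb (2 * k + 1) a (std_forms k) i) e = coeff (lin_form k (\<lambda>_. a) j i) e" for e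
  proof -
    consider "e = 0" | "e = 1" | "e = 2" | e' where "e = Suc (Suc (Suc e'))"
      by (metis One_nat_def numeral_2_eq_2 old.nat.exhaust)
    then show ?thesis
      unfolding lincomb_def std_forms_def lin_form_def coeff_sum coeff_smult
      using True node_pos_lt[OF True] node_pos_lt[OF i]
      by cases (simp_all add: delta numeral_2_eq_2 del: sum.lessThan_Suc)
  qed
  then show ?thesis using True by (simp add: poly_eq_iff)
qed (simp add: lincomb_def std_forms_def)

lemma node_pos_surj:
  assumes "l < 2 * k + 1" "l \<noteq> k"
  obtains i where "i < 2 * k" "node_pos k i = l"
proof (cases "l < k")
  case True
  then show ?thesis using that[of "2 * l"] by (simp add: node_pos_def)
next
  case False
  then show ?thesis using that[of "2 * (l - k - 1) + 1"] assms by (simp add: node_pos_def)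
qed

lemma node_pos_inj: "i < 2 * k \<Longrightarrow> j < 2 * k \<Longrightarrow> node_pos k i = node_pos k j \<Longrightarrow> i = j"
  by (auto simp: node_pos_def split: if_splits elim!: evenE oddE)

lemma node_pos_neq: "i < 2 * k \<Longrightarrow> node_pos k i \<noteq> k"
  by (auto simp: node_pos_def)

lemma lin_form_in_sections:
  "(\<lambda>i. if i < 2 * k then lin_form k (\<lambda>_. a) j i else 0) \<in> rosary_sections (2 * k + 1) 1"
  by (auto simp: rosary_sections_def lin_form_def coeff_pCons split: nat.split)

text \<open>Degree one is separate because there the coefficient of u is glued to the coefficient of
  u: it is one constant around the whole cycle, namely the coordinate of y. The dimension is
  therefore 2k + 1 and not 2k (2m - 1) with m = 1.\<close>

lemma std_forms_is_basis:
  assumes "0 < k"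
  shows "is_basis_of (rosary_sections (2 * k + 1) 1) (2 * k + 1) (std_forms k)"
  unfolding is_basis_of_def
proof (intro conjI ballI allI impI)
  show "std_forms k l \<in> rosary_sections (2 * k + 1) 1" if "l < 2 * k + 1" for l
    using lin_form_in_sections[of k "\<lambda>i. if l = i then 1 else 0"]
    unfolding std_forms_def lin_form_def .
  fix s assume s: "s \<in> rosary_sections (2 * k + 1) 1"
  have s1: "degree (s i) \<le> 2" "coeff (s (Suc i mod (2 * k))) 0 = coeff (s i) 2"
      "coeff (s (Suc i mod (2 * k))) 1 = coeff (s i) 1" if "i < 2 * k" for i
    using s that by (auto simp: rosary_sections_def)
  have s0: "s i = 0" if "2 * k \<le> i" for i using s that by (simp add: rosary_sections_def)
  have y: "coeff (s i) 1 = coeff (s 0) 1" if "i < 2 * k" for i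
    using that
  proof (induction i)
    case (Suc i)
    then show ?case using s1(3)[of i] by simp
  qed simp
  define idx where "idx l = (if l < k then 2 * l else 2 * (l - k - 1) + 1)" for l
  have idx: "idx (node_pos k i) = i" if "i < 2 * k" for i
    using that by (auto simp: idx_def node_pos_def elim!: evenE oddE)
  define a where "a l = (if l = k then coeff (s 0) 1 else if l < 2 * k + 1 then coeff (s (idx l)) 0 else 0)" for l
  have a: "a (node_pos k i) = coeff (s i) 0" if "i < 2 * k" for i
    using that node_pos_neq[OF that] node_pos_lt[OF that] by (simp add: a_def idx)
  show "\<exists>!a. (\<forall>l. 2 * k + 1 \<le> l \<longrightarrow> a l = 0) \<and> s = lincomb (2 * k + 1) a (std_forms k)"
  proof (intro ex1I[of _ a] conjI)
    show "\<forall>l. 2 * k + 1 \<le> l \<longrightarrow> a l = 0" by (auto simp: a_def)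
    show "s = lincomb (2 * k + 1) a (std_forms k)"
    proof
      fix i
      show "s i = lincomb (2 * k + 1) a (std_forms k) i"
      proof (cases "i < 2 * k")
        case True
        then have i: "Suc i mod (2 * k) < 2 * k" by simp
        show ?thesis unfolding lincomb_std_forms[where j = 0]
        proof (rule poly_eqI)
          fix e :: nat
          consider "e = 0" | "e = 1" | "e = 2" | "2 < e" by linarith
          then show "coeff (s i) e = coeff (if i < 2 * k then lin_form k (\<lambda>_. a) 0 i else 0) e"
            using True s1[OF True] y[OF True] a[OF True] a[OF i]
            by cases (auto simp: lin_form_def a_def[of k] coeff_pCons coeff_eq_0 numeral_2_eq_2 split: nat.split)
        qed
      qed (unfold lincomb_std_forms[where j = 0], simp add: s0)
    qed
    fix b assume b: "(\<forall>l. 2 * k + 1 \<le> l \<longrightarrow> b l = 0) \<and> s = lincomb (2 * k + 1) b (std_forms k)"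
    then have si: "s i = lin_form k (\<lambda>_. b) 0 i" if "i < 2 * k" for i
      using that lincomb_std_forms[where j = 0] by metis
    show "b = a"
    proof
      fix l
      consider "2 * k + 1 \<le> l" | "l = k" | "l < 2 * k + 1" "l \<noteq> k" by linarith
      then show "b l = a l"
      proof cases
        case 1
        then show ?thesis using b by (auto simp: a_def)
      next
        case 2
        then show ?thesis using si[of 0] assms by (simp add: a_def lin_form_def)
      next
        case 3
        then obtain i where i: "i < 2 * k" "node_pos k i = l" by (rule node_pos_surj)
        then show ?thesis using si[of i] a[of i] by (simp add: lin_form_def)
      qed
    qed
  qed
qed

lemma word_det_cong:
  assumes "word_family k m W"
    and "\<And>j l. j < 2 * k + 1 \<Longrightarrow> l < 2 * k + 1 \<Longrightarrow> X j l = X' j l"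
  shows "word_det k m X W = word_det k m X' W"
  unfolding word_det_def
proof (intro fdet_cong arg_cong2[where f = coeff] arg_cong[where f = prod_list] map_cong refl)
  fix r c j assume r: "r < dim_sections k m" and c: "c < dim_sections k m" and "j \<in> set (W r)"
  then have "j < 2 * k + 1" using assms(1) by (auto simp: word_family_def)
  moreover have "comp_of m c < 2 * k" using index_decompose(1)[OF c] .
  moreover from this have "Suc (comp_of m c) mod (2 * k) < 2 * k" by simp
  ultimately show "lin_form k X j (comp_of m c) = lin_form k X' j (comp_of m c)"
    using assms(2) node_pos_lt[of _ k] by (simp add: lin_form_def)
qed

lemma act_basis_eq_lin_form:
  assumes k: "0 < k" and w: "is_basis_of (rosary_sections (2 * k + 1) 1) (2 * k + 1) w"
  shows "act_basis (2 * k + 1) A w j i = (if i < 2 * k then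
     lin_form k (\<lambda>j l. \<Sum>t<2*k+1. A $$ (j, t) * coords (2 * k + 1) (std_forms k) (w t) l) j i else 0)"
proof -
  define Cf where "Cf t = coords (2 * k + 1) (std_forms k) (w t)" for t
  have w': "w t i = (if i < 2 * k then lin_form k Cf t i else 0)" if "t < 2 * k + 1" for t
  proof -
    have "w t \<in> rosary_sections (2 * k + 1) 1" using w that by (simp add: is_basis_of_def)
    from coords_lincomb(1)[OF std_forms_is_basis[OF k] this]
    have "w t i = lincomb (2 * k + 1) (Cf t) (std_forms k) i"
      unfolding Cf_def by (rule fun_cong)
    then show ?thesis
      unfolding lincomb_std_forms[where j = t] by (simp add: lin_form_def)
  qed
  have "act_basis (2 * k + 1) A w j i
      = (\<Sum>t<2*k+1. smult (A $$ (j, t)) (if i < 2 * k then lin_form k Cf t i else 0))"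
    unfolding act_basis_def using w' by (intro sum.cong) auto
  then show ?thesis
    using lin_form_mult[where X' = "\<lambda>j l. \<Sum>t<2*k+1. A $$ (j, t) * Cf t l" and n = "2 * k + 1"
        and M = "\<lambda>j t. A $$ (j, t)" and X = Cf and k = k and j = j and i = i]
    by (simp add: Cf_def)
qed

text \<open>Passing from \<open>b\<close> to the basis dual to the coefficients multiplies all
  coordinates of the Hilbert point by one determinant, which depends neither on \<open>A\<close> nor
  on \<open>W\<close>.\<close>

lemma hilbert_point_eq_word_det:
  assumes k: "0 < k" and m: "2 \<le> m"
    and w: "is_basis_of (rosary_sections (2 * k + 1) 1) (2 * k + 1) w"
    and b: "is_basis_of (rosary_sections (2 * k + 1) m) N b"
    and W: "word_family k m W"
  shows "hilbert_point (2 * k + 1) m (act_basis (2 * k + 1) A w) b N (\<lambda>r. count_list (W r))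
      * fdet N (\<lambda>r c. coords N (std_basis k m) (b r) c)
    = word_det k m (\<lambda>j l. \<Sum>t<2*k+1. A $$ (j, t) * coords (2 * k + 1) (std_forms k) (w t) l) W"
    (is "?h * _ = word_det k m ?X W")
proof -
  have N: "N = dim_sections k m" using basis_size_unique[OF b std_basis_is_basis[OF m]] .
  define f where "f = act_basis (2 * k + 1) A w"
  define s where "s r = restrict_mon (2 * k + 1) f (count_list (W r))" for r
  have f: "f j i = (if i < 2 * k then lin_form k ?X j i else 0)" for j i
    unfolding f_def by (rule act_basis_eq_lin_form[OF k w])
  have fS: "f j \<in> rosary_sections (2 * k + 1) 1" for j
  proof -
    have "f j = (\<lambda>i. if i < 2 * k then lin_form k (\<lambda>_. ?X j) j i else 0)"
      by (simp add: fun_eq_iff f lin_form_def)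
    then show ?thesis using lin_form_in_sections by simp
  qed
  have Wr: "length (W r) = m" "set (W r) \<subseteq> {..<2 * k + 1}" if "r < N" for r
    using W that by (auto simp: word_family_def N)
  have s: "s r i = (\<Prod>j\<leftarrow>W r. f j i)" if "r < N" for r i
    unfolding s_def by (rule restrict_mon_count_list[OF Wr(2)[OF that]])
  have sS: "s r \<in> rosary_sections (2 * k + 1) m" if "r < N" for r
  proof -
    have ne: "W r \<noteq> []" using Wr(1)[OF that] m by auto
    have "s r = (\<lambda>i. \<Prod>j\<leftarrow>W r. f j i)" using s[OF that] by (rule ext)
    with rosary_sections_prod_list[OF ne, of f "2 * k + 1", OF fS] show ?thesis
      using Wr(1)[OF that] by simp
  qed
  have "?h * fdet N (\<lambda>r c. coords N (std_basis k m) (b r) c)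
    = fdet N (\<lambda>r c. \<Sum>x<N. coords N b (s r) x * coords N (std_basis k m) (b x) c)"
    unfolding fdet_mult hilbert_point_def s_def f_def fdet_def ..
  also have "\<dots> = fdet N (\<lambda>r c. coords N (std_basis k m) (s r) c)"
    using coords_change_basis[OF b, of N "std_basis k m"] std_basis_is_basis[OF m, of k] sS
    by (intro fdet_cong) (simp add: N)
  also have "\<dots> = word_det k m ?X W"
    unfolding word_det_def N
  proof (rule fdet_cong)
    fix r c assume r: "r < dim_sections k m" and c: "c < dim_sections k m"
    show "coords (dim_sections k m) (std_basis k m) (s r) c
        = coeff (\<Prod>j\<leftarrow>W r. lin_form k ?X j (comp_of m c)) (expo_of m c)"
      using coords_std_basis[OF m sS c] r s[of r] index_decompose(1)[OF c]
      by (simp add: N f)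
  qed
  finally show ?thesis .
qed

text \<open>\<open>C\<close> expresses \<open>w\<close> in the forms x_i, y. As A runs through SL, A
  * C runs through all matrices of determinant \<open>det C\<close>, so the orbit can be described
  without reference to \<open>w\<close> and \<open>b\<close>.\<close>

lemma hilbert_semistable_iff_word_det:
  assumes k: "0 < k" and m: "2 \<le> m"
    and w: "is_basis_of (rosary_sections (2 * k + 1) 1) (2 * k + 1) w"
    and b: "is_basis_of (rosary_sections (2 * k + 1) m) N b"
  obtains C where "C \<in> carrier_mat (2 * k + 1) (2 * k + 1)" "det C \<noteq> 0"
    "hilbert_semistable (2 * k + 1) m w b N \<longleftrightarrow>
      \<not> (\<exists>X. (\<forall>n::nat. X n \<in> carrier_mat (2 * k + 1) (2 * k + 1) \<and> det (X n) = det C) \<and>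
        (\<forall>W. word_family k m W \<longrightarrow> (\<lambda>n. word_det k m (\<lambda>j l. X n $$ (j, l)) W) \<longlonglongrightarrow> 0))"
proof -
  define g where "g = 2 * k + 1"
  define Cf where "Cf t = coords g (std_forms k) (w t)" for t
  define C where "C = mat g g (\<lambda>(j, l). Cf j l)"
  define P where "P = fdet N (\<lambda>r c. coords N (std_basis k m) (b r) c)"
  have N: "N = dim_sections k m" using basis_size_unique[OF b std_basis_is_basis[OF m]] .
  have P: "P \<noteq> 0"
    unfolding P_def using fdet_change_basis_nonzero[OF b] std_basis_is_basis[OF m, of k] by (simp add: N)
  have C: "C \<in> carrier_mat g g" by (simp add: C_def)
  have detC: "det C \<noteq> 0"
    using fdet_change_basis_nonzero[OF w std_forms_is_basis[OF k]]
    by (simp add: C_def Cf_def g_def fdet_def)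
  have hp: "hilbert_point g m (act_basis g A w) b N (\<lambda>r. count_list (W r)) * P
      = word_det k m (\<lambda>j l. (A * C) $$ (j, l)) W"
    if "word_family k m W" "A \<in> carrier_mat g g" for A W
    unfolding g_def P_def hilbert_point_eq_word_det[OF k m w b that(1)]
    using that(2)
    by (intro word_det_cong[OF that(1)])
      (auto simp: C_def Cf_def g_def scalar_prod_def atLeast0LessThan)
  have conv: "(\<forall>\<sigma>. (\<forall>r<N. \<sigma> r \<in> monomials g m) \<longrightarrow>
        (\<lambda>n. hilbert_point g m (act_basis g (A n) w) b N \<sigma>) \<longlonglongrightarrow> 0) \<longleftrightarrow>
      (\<forall>W. word_family k m W \<longrightarrow> (\<lambda>n. word_det k m (\<lambda>j l. (A n * C) $$ (j, l)) W) \<longlonglongrightarrow> 0)"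
    if A: "\<And>n::nat. A n \<in> carrier_mat g g" for A
  proof (intro iffI allI impI)
    fix W assume *: "\<forall>\<sigma>. (\<forall>r<N. \<sigma> r \<in> monomials g m) \<longrightarrow>
        (\<lambda>n. hilbert_point g m (act_basis g (A n) w) b N \<sigma>) \<longlonglongrightarrow> 0" and W: "word_family k m W"
    have "\<forall>r<N. count_list (W r) \<in> monomials g m"
      using W count_list_in_monomials by (fastforce simp: word_family_def N g_def)
    with * have "(\<lambda>n. hilbert_point g m (act_basis g (A n) w) b N (\<lambda>r. count_list (W r)) * P) \<longlonglongrightarrow> 0 * P"
      by (intro tendsto_mult_right) auto
    then show "(\<lambda>n. word_det k m (\<lambda>j l. (A n * C) $$ (j, l)) W) \<longlonglongrightarrow> 0"
      using hp[OF W A] by simp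
  next
    fix \<sigma> assume *: "\<forall>W. word_family k m W \<longrightarrow> (\<lambda>n. word_det k m (\<lambda>j l. (A n * C) $$ (j, l)) W) \<longlonglongrightarrow> 0"
      and \<sigma>: "\<forall>r<N. \<sigma> r \<in> monomials g m"
    have "\<forall>r. \<exists>L. r < N \<longrightarrow> length L = m \<and> set L \<subseteq> {..<g} \<and> count_list L = \<sigma> r"
      using \<sigma> monomials_eq_count_list by metis
    then obtain W where W: "\<And>r. r < N \<Longrightarrow> length (W r) = m \<and> set (W r) \<subseteq> {..<g} \<and> count_list (W r) = \<sigma> r"
      by metis
    then have wf: "word_family k m W" by (simp add: word_family_def N g_def)
    have "hilbert_point g m (act_basis g (A n) w) b N \<sigma>
        = hilbert_point g m (act_basis g (A n) w) b N (\<lambda>r. count_list (W r))" for n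
      unfolding hilbert_point_def using W by (intro arg_cong[where f = det] eq_matI) auto
    then have "hilbert_point g m (act_basis g (A n) w) b N \<sigma>
        = word_det k m (\<lambda>j l. (A n * C) $$ (j, l)) W / P" for n
      using hp[OF wf A, of n] P by (simp add: field_simps)
    moreover have "(\<lambda>n. word_det k m (\<lambda>j l. (A n * C) $$ (j, l)) W / P) \<longlonglongrightarrow> 0 / P"
      using * wf P by (intro tendsto_divide tendsto_const) auto
    ultimately show "(\<lambda>n. hilbert_point g m (act_basis g (A n) w) b N \<sigma>) \<longlonglongrightarrow> 0" by simp
  qed
  have "\<exists>C'. C' \<in> carrier_mat g g \<and> C' * C = 1\<^sub>m g"
    using det_non_zero_imp_unit[OF C detC] C
    by (auto simp: Units_def ring_mat_def)
  then obtain C' where C': "C' \<in> carrier_mat g g" "C' * C = 1\<^sub>m g" by blast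
  then have detC': "det C' * det C = 1" using C det_mult[OF C'(1) C] by simp
  have "hilbert_semistable g m w b N \<longleftrightarrow>
      \<not> (\<exists>X. (\<forall>n::nat. X n \<in> carrier_mat g g \<and> det (X n) = det C) \<and>
        (\<forall>W. word_family k m W \<longrightarrow> (\<lambda>n. word_det k m (\<lambda>j l. X n $$ (j, l)) W) \<longlonglongrightarrow> 0))"
    unfolding hilbert_semistable_def
  proof (intro arg_cong[where f = Not] iffI; elim exE conjE)
    fix A assume A: "\<forall>n::nat. A n \<in> carrier_mat g g \<and> det (A n) = 1"
      and lim: "\<forall>\<sigma>. (\<forall>r<N. \<sigma> r \<in> monomials g m) \<longrightarrow>
        (\<lambda>n. hilbert_point g m (act_basis g (A n) w) b N \<sigma>) \<longlonglongrightarrow> 0"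
    show "\<exists>X. (\<forall>n::nat. X n \<in> carrier_mat g g \<and> det (X n) = det C) \<and>
        (\<forall>W. word_family k m W \<longrightarrow> (\<lambda>n. word_det k m (\<lambda>j l. X n $$ (j, l)) W) \<longlonglongrightarrow> 0)"
      using A C lim conv[of A] by (intro exI[of _ "\<lambda>n. A n * C"]) (auto simp: det_mult[of _ g] intro!: mult_carrier_mat[of _ g g])
  next
    fix X assume X: "\<forall>n::nat. X n \<in> carrier_mat g g \<and> det (X n) = det C"
      and lim: "\<forall>W. word_family k m W \<longrightarrow> (\<lambda>n. word_det k m (\<lambda>j l. X n $$ (j, l)) W) \<longlonglongrightarrow> 0"
    have "X n * C' * C = X n" for n
      using X C' C by (metis assoc_mult_mat right_mult_one_mat)
    moreover have "det (X n * C') = 1" for n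
      using X C' detC' by (simp add: det_mult[of _ g] mult.commute)
    moreover have "X n * C' \<in> carrier_mat g g" for n using X C' by (intro mult_carrier_mat[of _ g g]) auto
    ultimately show "\<exists>A. (\<forall>n::nat. A n \<in> carrier_mat g g \<and> det (A n) = 1) \<and>
        (\<forall>\<sigma>. (\<forall>r<N. \<sigma> r \<in> monomials g m) \<longrightarrow>
        (\<lambda>n. hilbert_point g m (act_basis g (A n) w) b N \<sigma>) \<longlonglongrightarrow> 0)"
      using lim conv[of "\<lambda>n. X n * C'"] by (intro exI[of _ "\<lambda>n. X n * C'"]) auto
  qed
  then show ?thesis using that[OF C[unfolded g_def] detC] by (simp add: g_def)
qed

subsection \<open>Destabilization\<close>

lemma prod_over_indices:
  "(\<Prod>r<dim_sections k m. F (comp_of m r) (expo_of m r)) = (\<Prod>i<2*k. \<Prod>e<2*m-1. F i e)"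
proof -
  have "(\<Prod>r<dim_sections k m. F (comp_of m r) (expo_of m r))
      = (\<Prod>i<2*k. \<Prod>r\<in>{i * (2*m-1)..<i * (2*m-1) + (2*m-1)}. F (comp_of m r) (expo_of m r))"
    unfolding dim_sections_def by (rule prod.nat_group[symmetric])
  also have "\<dots> = (\<Prod>i<2*k. \<Prod>e<2*m-1. F i e)"
  proof (rule prod.cong[OF refl])
    fix i
    have "(\<Prod>r\<in>{i * (2*m-1)..<i * (2*m-1) + (2*m-1)}. F (comp_of m r) (expo_of m r))
        = (\<Prod>e<2*m-1. F (comp_of m (index_of m i e)) (expo_of m (index_of m i e)))"
      by (intro prod.reindex_bij_witness[of _ "\<lambda>e. index_of m i e" "\<lambda>r. r - i * (2*m-1)"])
        (auto simp: index_of_def)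
    then show "(\<Prod>r\<in>{i * (2*m-1)..<i * (2*m-1) + (2*m-1)}. F (comp_of m r) (expo_of m r)) = (\<Prod>e<2*m-1. F i e)"
      by (simp add: comp_expo_of del: One_nat_def)
  qed
  finally show ?thesis .
qed

lemma sum_parity:
  fixes m :: nat
  assumes "1 \<le> m"
  shows "(\<Sum>e<2 * m - 1. e mod 2) = m - 1"
proof -
  obtain a where "m = Suc a" using assms by (cases m) auto
  moreover have "(\<Sum>e<Suc (2 * a). e mod 2) = a"
  proof (induction a)
    case (Suc a)
    have "2 * Suc a = Suc (Suc (2 * a))" by simp
    then have "(\<Sum>e<Suc (2 * Suc a). e mod 2) = (\<Sum>e<Suc (2 * a). e mod 2) + Suc (2 * a) mod 2 + Suc (Suc (2 * a)) mod 2"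
      by (simp only: sum.lessThan_Suc)
    then show ?case using Suc by presburger
  qed simp
  ultimately show ?thesis by simp
qed

text \<open>Here x is the weight of y relative to the x_i: an odd power of u requires an odd number
  of letters y, hence at least one factor x.\<close>

definition parity_bounded :: "(real \<Rightarrow> complex poly) \<Rightarrow> bool" where
  "parity_bounded F \<longleftrightarrow>
     (\<forall>e. \<exists>B\<ge>0. \<forall>x. 0 < x \<longrightarrow> x \<le> 1 \<longrightarrow> cmod (coeff (F x) e) \<le> B * x ^ (e mod 2))"

lemma parity_bounded_quadratic: "parity_bounded (\<lambda>x. [:a, of_real x * b, c:])"
  unfolding parity_bounded_def
proof
  fix e :: nat
  consider "e = 0" | "e = 1" | "e = 2" | e' where "e = Suc (Suc (Suc e'))"
    by (metis One_nat_def numeral_2_eq_2 old.nat.exhaust)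
  then show "\<exists>B\<ge>0. \<forall>x. 0 < x \<longrightarrow> x \<le> 1 \<longrightarrow>
      cmod (coeff [:a, of_real x * b, c:] e) \<le> B * x ^ (e mod 2)"
  proof cases
    case 1
    then show ?thesis by (intro exI[of _ "cmod a"]) auto
  next
    case 2
    then show ?thesis by (intro exI[of _ "cmod b"]) (auto simp: norm_mult)
  next
    case 3
    then show ?thesis by (intro exI[of _ "cmod c"]) (auto simp: numeral_2_eq_2)
  next
    case 4
    then show ?thesis by (intro exI[of _ 0]) auto
  qed
qed

text \<open>An odd exponent in a product forces an odd exponent in one of the factors.\<close>

lemma parity_bounded_mult:
  assumes "parity_bounded F" "parity_bounded G"
  shows "parity_bounded (\<lambda>x. F x * G x)"
proof -
  obtain A where A: "\<And>e. 0 \<le> A e" "\<And>e x. 0 < x \<Longrightarrow> x \<le> 1 \<Longrightarrow> cmod (coeff (F x) e) \<le> A e * x ^ (e mod 2)"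
    using assms(1) unfolding parity_bounded_def by metis
  obtain B where B: "\<And>e. 0 \<le> B e" "\<And>e x. 0 < x \<Longrightarrow> x \<le> 1 \<Longrightarrow> cmod (coeff (G x) e) \<le> B e * x ^ (e mod 2)"
    using assms(2) unfolding parity_bounded_def by metis
  have "0 \<le> (\<Sum>i\<le>e. A i * B (e - i))" for e
    using A B by (intro sum_nonneg) auto
  moreover have "cmod (coeff (F x * G x) e) \<le> (\<Sum>i\<le>e. A i * B (e - i)) * x ^ (e mod 2)"
    if x: "0 < x" "x \<le> (1::real)" for e x
  proof -
    have "cmod (coeff (F x * G x) e) \<le> (\<Sum>i\<le>e. A i * B (e - i) * x ^ (e mod 2))"
      unfolding coeff_mult
    proof (rule sum_norm_le)
      fix i assume i: "i \<in> {..e}"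
      have "cmod (coeff (F x) i * coeff (G x) (e - i))
          \<le> (A i * x ^ (i mod 2)) * (B (e - i) * x ^ ((e - i) mod 2))"
        unfolding norm_mult using A B x by (intro mult_mono) (auto intro!: mult_nonneg_nonneg)
      also have "\<dots> = A i * B (e - i) * x ^ (i mod 2 + (e - i) mod 2)"
        by (simp add: power_add)
      also have "\<dots> \<le> A i * B (e - i) * x ^ (e mod 2)"
      proof (intro mult_left_mono power_decreasing)
        have "(i mod 2 + (e - i) mod 2) mod 2 = e mod 2"
          using i by (simp add: mod_add_eq)
        then show "e mod 2 \<le> i mod 2 + (e - i) mod 2"
          by (metis mod_less_eq_dividend)
      qed (use A B x in auto)
      finally show "cmod (coeff (F x) i * coeff (G x) (e - i)) \<le> A i * B (e - i) * x ^ (e mod 2)" .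
    qed
    then show ?thesis by (simp add: sum_distrib_right)
  qed
  ultimately show ?thesis unfolding parity_bounded_def by blast
qed

lemma parity_bounded_prod_list:
  "(\<And>j. j \<in> set L \<Longrightarrow> parity_bounded (f j)) \<Longrightarrow> parity_bounded (\<lambda>x. \<Prod>j\<leftarrow>L. f j x)"
proof (induction L)
  case Nil
  show ?case using parity_bounded_quadratic[of 1 0 0] by (simp add: one_pCons)
next
  case (Cons a L)
  then show ?case by (simp add: parity_bounded_mult)
qed

lemma prod_list_smult:
  "(\<Prod>j\<leftarrow>L. smult c (f j)) = smult (c ^ length L) (\<Prod>j\<leftarrow>L. f j)" for c :: "'a::comm_semiring_1"
  by (induction L) (auto simp: mult.commute)

text \<open>Each form is 1 / t times a form in which only the coefficient of u carries x = t^(2k+1).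
  Every column of odd exponent contributes a factor x, whichever row a permutation assigns to it,
  and each component has m - 1 such columns.\<close>

lemma word_det_scaled_bound:
  assumes "1 \<le> m" and W: "word_family k m W"
  shows "\<exists>K. \<forall>t. 0 < t \<longrightarrow> t \<le> 1 \<longrightarrow>
    cmod (word_det k m (\<lambda>j l. Y j l * of_real (if l = k then t ^ (2*k) else 1 / t)) W)
      \<le> K * (t ^ ((2*k+1) * (2*k*(m-1))) / t ^ (m * dim_sections k m))"
proof -
  define N where "N = dim_sections k m"
  define Q where "Q r i x = (\<Prod>j\<leftarrow>W r. [:Y j (node_pos k i), of_real x * Y j k, Y j (node_pos k (Suc i mod (2*k))):])"
    for r i x
  have "parity_bounded (Q r i)" for r i
    unfolding Q_def by (intro parity_bounded_prod_list parity_bounded_quadratic)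
  then obtain B where B: "\<And>r i e. 0 \<le> B r i e"
      "\<And>r i e x. 0 < x \<Longrightarrow> x \<le> 1 \<Longrightarrow> cmod (coeff (Q r i x) e) \<le> B r i e * x ^ (e mod 2)"
    unfolding parity_bounded_def by metis
  define K where "K = (\<Sum>p | p permutes {..<N}. \<Prod>r<N. B r (comp_of m (p r)) (expo_of m (p r)))"
  have "cmod (word_det k m (\<lambda>j l. Y j l * of_real (if l = k then t ^ (2*k) else 1 / t)) W)
      \<le> K * (t ^ ((2*k+1) * (2*k*(m-1))) / t ^ (m * N))"
    if t: "0 < t" "t \<le> 1" for t
  proof -
    define x where "x = t ^ (2*k+1)"
    have x: "0 < x" using t unfolding x_def by (intro zero_less_power)
    have x1: "x \<le> 1" using t unfolding x_def by (intro power_le_one) auto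
    let ?X = "\<lambda>j l. Y j l * of_real (if l = k then t ^ (2*k) else 1 / t)"
    have lin: "lin_form k ?X j i = smult (of_real (1 / t))
        [:Y j (node_pos k i), of_real x * Y j k, Y j (node_pos k (Suc i mod (2*k))):]"
      if "i < 2 * k" for i j
      using that t node_pos_neq[of i k] node_pos_neq[of "Suc i mod (2*k)" k]
      by (simp add: lin_form_def x_def)
    have entry: "cmod (coeff (\<Prod>j\<leftarrow>W r. lin_form k ?X j i) e)
        \<le> (1 / t ^ m) * (B r i e * x ^ (e mod 2))"
      if "r < N" "i < 2 * k" for r i e
    proof -
      have len: "length (W r) = m" using W that by (simp add: word_family_def N_def)
      have "(\<Prod>j\<leftarrow>W r. lin_form k ?X j i) = smult (of_real (1 / t) ^ m) (Q r i x)"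
        unfolding lin[OF that(2)] prod_list_smult len Q_def ..
      then have "cmod (coeff (\<Prod>j\<leftarrow>W r. lin_form k ?X j i) e) = (1 / t ^ m) * cmod (coeff (Q r i x) e)"
        using t by (simp add: norm_mult norm_power norm_divide power_divide)
      then show ?thesis using B(2)[OF x x1, of r i e] t by (simp add: divide_right_mono)
    qed
    have "cmod (word_det k m ?X W) \<le> (\<Sum>p | p permutes {..<N}.
        (\<Prod>r<N. B r (comp_of m (p r)) (expo_of m (p r))) * (x ^ (2*k*(m-1)) / t ^ (m * N)))"
      unfolding word_det_def fdet_leibniz N_def[symmetric]
    proof (rule sum_norm_le)
      fix p assume "p \<in> {p. p permutes {..<N}}"
      then have p: "p permutes {..<N}" by simp
      then have pN: "p r < N" if "r < N" for r using that permutes_in_image by fastforce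
      have "(\<Sum>r<N. expo_of m (p r) mod 2) = (\<Sum>r<N. expo_of m r mod 2)"
        using sum.permute[OF p, of "\<lambda>r. expo_of m r mod 2"] by (simp add: o_def)
      also have "\<dots> = 2 * k * (m - 1)"
      proof -
        \<comment> \<open>The sum is evaluated through the product formula
          \<open>prod_over_indices\<close> by exponentiating with base 2.\<close>
        have "(2::nat) ^ (\<Sum>r<N. expo_of m r mod 2) = 2 ^ (2 * k * (m - 1))"
          unfolding power_sum N_def prod_over_indices[where F = "\<lambda>_ e. 2 ^ (e mod 2)"]
          by (simp only: power_sum[symmetric] sum_parity[OF assms(1)] sum_constant card_lessThan of_nat_id)
        then show ?thesis by simp
      qed
      finally have parity: "(\<Prod>r<N. x ^ (expo_of m (p r) mod 2)) = x ^ (2 * k * (m - 1))"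
        by (simp add: power_sum[symmetric])
      have "cmod (signof p * (\<Prod>r<N. coeff (\<Prod>j\<leftarrow>W r. lin_form k ?X j (comp_of m (p r))) (expo_of m (p r))))
         = (\<Prod>r<N. cmod (coeff (\<Prod>j\<leftarrow>W r. lin_form k ?X j (comp_of m (p r))) (expo_of m (p r))))"
        by (simp add: norm_mult prod_norm sign_def)
      also have "\<dots> \<le> (\<Prod>r<N. (1 / t ^ m) * (B r (comp_of m (p r)) (expo_of m (p r)) * x ^ (expo_of m (p r) mod 2)))"
        using entry pN index_decompose(1) by (intro prod_mono) (auto simp: N_def)
      also have "\<dots> = (\<Prod>r<N. B r (comp_of m (p r)) (expo_of m (p r))) * (x ^ (2*k*(m-1)) / t ^ (m * N))"
        by (simp only: prod.distrib parity) (simp add: power_mult power_divide)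
      finally show "cmod (signof p * (\<Prod>r<N. coeff (\<Prod>j\<leftarrow>W r. lin_form k ?X j (comp_of m (p r))) (expo_of m (p r))))
        \<le> (\<Prod>r<N. B r (comp_of m (p r)) (expo_of m (p r))) * (x ^ (2*k*(m-1)) / t ^ (m * N))" .
    qed
    then show ?thesis unfolding K_def x_def sum_distrib_right power_mult[of t "2*k+1"] .
  qed
  then show ?thesis unfolding N_def by blast
qed

lemma destabilizing_sequence:
  assumes m: "2 \<le> m" and k: "m < k" and C: "C \<in> carrier_mat (2*k+1) (2*k+1)"
  shows "\<exists>X. (\<forall>n::nat. X n \<in> carrier_mat (2*k+1) (2*k+1) \<and> det (X n) = det C) \<and>
    (\<forall>W. word_family k m W \<longrightarrow> (\<lambda>n. word_det k m (\<lambda>j l. X n $$ (j, l)) W) \<longlonglongrightarrow> 0)"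
proof -
  define g where "g = 2 * k + 1"
  define t where "t n = inverse (real (Suc n))" for n
  have t: "0 < t n" "t n \<le> 1" for n by (auto simp: t_def field_simps)
  define d where "d n l = complex_of_real (if l = k then t n ^ (2*k) else 1 / t n)" for n l
  define Dm where "Dm n = mat g g (\<lambda>(j, l). if j = l then d n l else 0)" for n
  define X where "X n = C * Dm n" for n
  have Xent: "X n $$ (j, l) = C $$ (j, l) * d n l" if "j < g" "l < g" for n j l
  proof -
    have "X n $$ (j, l) = (\<Sum>i<g. C $$ (j, i) * (if i = l then d n l else 0))"
      using that C by (auto simp: X_def Dm_def scalar_prod_def atLeast0LessThan g_def intro!: sum.cong)
    also have "\<dots> = C $$ (j, l) * d n l" using that by (subst sum.remove[of _ l]) auto
    finally show ?thesis .
  qed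
  have "det (Dm n) = fdet g (\<lambda>j l. if j = l then d n l else 0)" for n
    by (simp add: Dm_def fdet_def)
  also have "\<dots> n = (\<Prod>l<g. d n l)" for n
    by (subst fdet_triangular[where key = "\<lambda>_. 0"]) (auto split: if_splits)
  also have "\<dots> n = d n k * (\<Prod>l\<in>{..<g} - {k}. d n l)" for n
    by (intro prod.remove) (auto simp: g_def)
  also have "\<dots> n = d n k * (\<Prod>l\<in>{..<g} - {k}. of_real (1 / t n))" for n
    by (intro arg_cong2[where f = "(*)"] prod.cong) (auto simp: d_def)
  also have "\<dots> n = 1" for n
    using t[of n] by (simp add: d_def g_def power_divide)
  finally have "det (X n) = det C" for n
    using C by (simp add: X_def Dm_def g_def det_mult[of _ "2*k+1"])
  moreover have "X n \<in> carrier_mat g g" for n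
    unfolding X_def g_def by (rule mult_carrier_mat[OF C]) (simp only: Dm_def g_def mat_carrier)
  moreover have "(\<lambda>n. word_det k m (\<lambda>j l. X n $$ (j, l)) W) \<longlonglongrightarrow> 0" if W: "word_family k m W" for W
  proof -
    have m1: "1 \<le> m" using m by simp
    obtain K where K: "\<And>t. 0 < t \<Longrightarrow> t \<le> 1 \<Longrightarrow>
      cmod (word_det k m (\<lambda>j l. C $$ (j, l) * of_real (if l = k then t ^ (2*k) else 1 / t)) W)
        \<le> K * (t ^ ((2*k+1) * (2*k*(m-1))) / t ^ (m * dim_sections k m))"
      using word_det_scaled_bound[OF m1 W, where Y = "\<lambda>j l. C $$ (j, l)"] by blast
    \<comment> \<open>After division by 2k this asks for m (2m - 1) < (2k + 1) (m - 1). For k = m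
      the right-hand side is smaller than the left-hand side by exactly 1; for k \<ge> m + 1 it is
      larger by at least 2m - 3.\<close>
    have exp: "Suc (m * dim_sections k m) \<le> (2*k+1) * (2*k*(m-1))"
    proof -
      obtain a where a: "m = a + 2" using m by (metis add.commute le_Suc_ex)
      obtain c where c: "k = Suc m + c" using k by (metis Suc_leI le_Suc_ex)
      have "m * (2 * m - 1) + 1 \<le> (2 * k + 1) * (m - 1)"
        unfolding c a by (simp add: algebra_simps)
      then have le: "2 * k * (m * (2 * m - 1) + 1) \<le> 2 * k * ((2 * k + 1) * (m - 1))"
        by (rule mult_le_mono2)
      have "Suc (m * dim_sections k m) \<le> m * dim_sections k m + 2 * k" using k by simp
      also have "\<dots> = 2 * k * (m * (2 * m - 1) + 1)"
        unfolding dim_sections_def by (simp only: distrib_left mult_1_right mult.left_commute)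
      also note le
      also have "2 * k * ((2 * k + 1) * (m - 1)) = (2*k+1) * (2*k*(m-1))"
        by (rule mult.left_commute)
      finally show ?thesis .
    qed
    have bound: "cmod (word_det k m (\<lambda>j l. X n $$ (j, l)) W) \<le> \<bar>K\<bar> * t n" for n
    proof -
      have "word_det k m (\<lambda>j l. X n $$ (j, l)) W
         = word_det k m (\<lambda>j l. C $$ (j, l) * of_real (if l = k then t n ^ (2*k) else 1 / t n)) W"
        using Xent by (intro word_det_cong[OF W]) (auto simp: g_def d_def)
      then have "cmod (word_det k m (\<lambda>j l. X n $$ (j, l)) W)
          \<le> K * (t n ^ ((2*k+1) * (2*k*(m-1))) / t n ^ (m * dim_sections k m))"
        using K[OF t] by simp
      also have "\<dots> \<le> \<bar>K\<bar> * (t n ^ Suc (m * dim_sections k m) / t n ^ (m * dim_sections k m))"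
        using t[of n] exp by (intro mult_mono divide_right_mono power_decreasing) auto
      also have "\<dots> = \<bar>K\<bar> * t n" using t[of n] by simp
      finally show ?thesis .
    qed
    have "(\<lambda>n. \<bar>K\<bar> * t n) \<longlonglongrightarrow> \<bar>K\<bar> * 0"
      unfolding t_def by (intro tendsto_mult tendsto_const LIMSEQ_inverse_real_of_nat)
    then have "(\<lambda>n. \<bar>K\<bar> * t n) \<longlonglongrightarrow> 0" by simp
    then show ?thesis
      by (rule tendsto_0_le[where K = 1]) (use bound t in \<open>auto intro!: always_eventually simp: abs_mult less_imp_le\<close>)
  qed
  ultimately show ?thesis unfolding g_def by blast
qed

subsection \<open>Triangular bases\<close>

lemma coeff_mult_bottom:
  fixes p q :: "'a::comm_semiring_1 poly"
  assumes "\<And>x. x < d \<Longrightarrow> coeff p x = 0" "\<And>x. x < e \<Longrightarrow> coeff q x = 0"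
  shows "x < d + e \<Longrightarrow> coeff (p * q) x = 0" "coeff (p * q) (d + e) = coeff p d * coeff q e"
proof -
  show "coeff (p * q) x = 0" if "x < d + e"
    unfolding coeff_mult
  proof (rule sum.neutral, rule ballI)
    fix i assume "i \<in> {..x}"
    then have "i < d \<or> x - i < e" using that by auto
    then show "coeff p i * coeff q (x - i) = 0" using assms by auto
  qed
  have "coeff (p * q) (d + e) = (\<Sum>i\<in>{d}. coeff p i * coeff q (d + e - i))"
    unfolding coeff_mult
  proof (rule sum.mono_neutral_right)
    show "\<forall>i\<in>{..d + e} - {d}. coeff p i * coeff q (d + e - i) = 0"
    proof
      fix i assume "i \<in> {..d + e} - {d}"
      then have "i < d \<or> d + e - i < e" by auto
      then show "coeff p i * coeff q (d + e - i) = 0" using assms by auto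
    qed
  qed auto
  then show "coeff (p * q) (d + e) = coeff p d * coeff q e" by simp
qed

lemma coeff_prod_list_bottom:
  fixes f :: "'b \<Rightarrow> 'a::comm_semiring_1 poly"
  assumes "\<And>j x. j \<in> set L \<Longrightarrow> x < h j \<Longrightarrow> coeff (f j) x = 0"
  shows "x < (\<Sum>j\<leftarrow>L. h j) \<Longrightarrow> coeff (\<Prod>j\<leftarrow>L. f j) x = 0"
    "coeff (\<Prod>j\<leftarrow>L. f j) (\<Sum>j\<leftarrow>L. h j) = (\<Prod>j\<leftarrow>L. coeff (f j) (h j))"
  using assms
proof (induction L arbitrary: x)
  case (Cons a L)
  {
    case 1
    then show ?case using coeff_mult_bottom(1)[of "h a" "f a" "\<Sum>j\<leftarrow>L. h j" "\<Prod>j\<leftarrow>L. f j" x] Cons.IH(1) by auto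
  next
    case 2
    then show ?case using coeff_mult_bottom(2)[of "h a" "f a" "\<Sum>j\<leftarrow>L. h j" "\<Prod>j\<leftarrow>L. f j"] Cons.IH by auto
  }
qed auto

lemma coeff_prod_list_top:
  fixes f :: "'b \<Rightarrow> 'a::comm_semiring_1 poly"
  assumes "\<And>j. j \<in> set L \<Longrightarrow> degree (f j) \<le> h j"
  shows "degree (\<Prod>j\<leftarrow>L. f j) \<le> (\<Sum>j\<leftarrow>L. h j)"
    "coeff (\<Prod>j\<leftarrow>L. f j) (\<Sum>j\<leftarrow>L. h j) = (\<Prod>j\<leftarrow>L. coeff (f j) (h j))"
  using assms
proof (induction L)
  case (Cons a L)
  {
    case 1
    then show ?case
      using order.trans[OF degree_mult_le add_mono, of "f a" "h a" "\<Prod>j\<leftarrow>L. f j" "\<Sum>j\<leftarrow>L. h j"] Cons.IH(1) by auto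
  next
    case 2
    then show ?case using coeff_mult_top[of "f a" "h a" "\<Prod>j\<leftarrow>L. f j" "\<Sum>j\<leftarrow>L. h j"] Cons.IH by auto
  }
qed auto

text \<open>Positions of the two nodes x_i, x_(i+1) of the component P_i, sorted by parity instead
  of by orientation. The reduction mod \<open>k\<close> closes the cycle: the last component ends at
  x_0.\<close>

definition even_pos :: "nat \<Rightarrow> nat \<Rightarrow> nat" where "even_pos k i = (Suc i div 2) mod k"
definition odd_pos :: "nat \<Rightarrow> nat \<Rightarrow> nat" where "odd_pos k i = k + 1 + i div 2"

text \<open>
  Height and level are the torus weights, shifted to be nonnegative: for a triangular matrix a word
  of height h has no coefficient of level below h.
\<close>

definition height :: "nat \<Rightarrow> nat \<Rightarrow> nat" where
  "height k j = (if j < k then 0 else if j = k then 1 else 2)"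

text \<open>On each component exactly one basis form of each height is nonzero; this is the
  coefficient of row j at the one whose height is that of j.\<close>

definition lead :: "nat \<Rightarrow> (nat \<Rightarrow> nat \<Rightarrow> complex) \<Rightarrow> nat \<Rightarrow> nat \<Rightarrow> complex" where
  "lead k T i j = (if j < k then T j (even_pos k i) else if j = k then T k k else T j (odd_pos k i))"

definition level :: "nat \<Rightarrow> nat \<Rightarrow> nat" where
  "level m r = (if even (comp_of m r) then expo_of m r else 2 * m - expo_of m r)"

lemma node_pos_even: "even i \<Longrightarrow> i < 2 * k \<Longrightarrow> node_pos k i = even_pos k i"
  by (auto simp: node_pos_def even_pos_def elim!: evenE)

lemma node_pos_odd: "odd i \<Longrightarrow> node_pos k i = odd_pos k i"
  by (simp add: node_pos_def odd_pos_def)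

lemma even_pos_lt: "0 < k \<Longrightarrow> even_pos k i < k"
  by (simp add: even_pos_def)

lemma odd_pos_gt: "k < odd_pos k i"
  by (simp add: odd_pos_def)

lemma even_succ_mod: "i < 2 * k \<Longrightarrow> even (Suc i mod (2 * k)) \<longleftrightarrow> odd i"
  by (cases "Suc i = 2 * k") (auto, presburger?)

lemma succ_mod_if: "i < n \<Longrightarrow> Suc i mod n = (if Suc i = n then 0 else Suc i)"
  by auto

lemma node_pos_succ:
  assumes "i < 2 * k"
  shows "node_pos k (Suc i mod (2 * k)) = (if even i then odd_pos k i else even_pos k i)"
proof (cases "Suc i = 2 * k")
  case True
  then have "odd i" by presburger
  moreover have "Suc i div 2 = k" using True by simp
  ultimately show ?thesis using True by (simp add: node_pos_def even_pos_def)
next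
  case False
  then have "Suc i mod (2 * k) = Suc i" using assms by simp
  then show ?thesis
    using assms False by (auto simp: node_pos_def even_pos_def odd_pos_def elim!: evenE oddE)
qed

lemma lin_form_alt:
  assumes "i < 2 * k"
  shows "lin_form k X j i = (if even i then [:X j (even_pos k i), X j k, X j (odd_pos k i):]
    else [:X j (odd_pos k i), X j k, X j (even_pos k i):])"
  using assms by (auto simp: lin_form_def node_pos_succ node_pos_even node_pos_odd)

definition triangular :: "nat \<Rightarrow> (nat \<Rightarrow> nat \<Rightarrow> complex) \<Rightarrow> bool" where
  "triangular k T \<longleftrightarrow> (\<forall>j<2*k+1. \<forall>l<j. T j l = 0) \<and> (\<forall>j<2*k+1. T j j \<noteq> 0)"

text \<open>The torus acts with opposite signs on neighbouring components, so the part of lowest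
  weight is the lowest coefficient in u on even components and the highest one on odd
  components.\<close>

lemma coeff_word:
  assumes T: "triangular k T" and k: "0 < k" and L: "length L = m" "set L \<subseteq> {..<2*k+1}"
    and c: "c < dim_sections k m"
  shows "level m c < (\<Sum>j\<leftarrow>L. height k j) \<Longrightarrow>
      coeff (\<Prod>j\<leftarrow>L. lin_form k T j (comp_of m c)) (expo_of m c) = 0" (is "_ \<Longrightarrow> ?A")
    and "level m c = (\<Sum>j\<leftarrow>L. height k j) \<Longrightarrow>
      coeff (\<Prod>j\<leftarrow>L. lin_form k T j (comp_of m c)) (expo_of m c) = (\<Prod>j\<leftarrow>L. lead k T (comp_of m c) j)"
      (is "_ \<Longrightarrow> ?B")
proof -
  define i where "i = comp_of m c"
  define e where "e = expo_of m c"
  have i: "i < 2 * k" and e: "e < 2 * m - 1" using index_decompose[OF c] by (auto simp: i_def e_def)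
  have ev: "even_pos k i < k" and od: "k < odd_pos k i" using k odd_pos_gt even_pos_lt by auto
  have T0: "T j l = 0" if "j \<in> set L" "l < j" for j l
    using T L(2) that by (auto simp: triangular_def)
  have "(level m c < (\<Sum>j\<leftarrow>L. height k j) \<longrightarrow> ?A) \<and> (level m c = (\<Sum>j\<leftarrow>L. height k j) \<longrightarrow> ?B)"
  proof (cases "even i")
    case True
    have "coeff (lin_form k T j i) x = 0" if "j \<in> set L" "x < height k j" for j x
      using T0[OF that(1)] that(2) ev True
      by (auto simp: lin_form_alt[OF i] height_def coeff_pCons split: nat.split if_splits)
    note * = coeff_prod_list_bottom[of L "height k" "\<lambda>j. lin_form k T j i", OF this]
    moreover have "coeff (lin_form k T j i) (height k j) = lead k T i j" for j
      using True by (auto simp: lin_form_alt[OF i] height_def lead_def numeral_2_eq_2)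
    moreover have "level m c = e" using True by (simp add: level_def i_def e_def)
    ultimately show ?thesis unfolding i_def[symmetric] e_def[symmetric] by simp
  next
    case False
    have deg: "degree (lin_form k T j i) \<le> 2 - height k j" if "j \<in> set L" for j
      using T0[OF that] ev False
      by (intro degree_le) (auto simp: lin_form_alt[OF i] height_def coeff_pCons split: nat.split if_splits)
    note * = coeff_prod_list_top[of L "\<lambda>j. lin_form k T j i" "\<lambda>j. 2 - height k j", OF deg]
    have "coeff (lin_form k T j i) (2 - height k j) = lead k T i j" for j
      using False by (auto simp: lin_form_alt[OF i] height_def lead_def numeral_2_eq_2)
    with *(2) have top: "coeff (\<Prod>j\<leftarrow>L. lin_form k T j i) (\<Sum>j\<leftarrow>L. 2 - height k j) = (\<Prod>j\<leftarrow>L. lead k T i j)"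
      by simp
    have "(\<Sum>j\<leftarrow>L. 2 - height k j) + (\<Sum>j\<leftarrow>L. height k j) = 2 * length L"
      by (induction L) (auto simp: height_def)
    moreover have "level m c = 2 * m - e" using False by (simp add: level_def i_def e_def)
    ultimately have "level m c < (\<Sum>j\<leftarrow>L. height k j) \<longleftrightarrow> (\<Sum>j\<leftarrow>L. 2 - height k j) < e"
      "level m c = (\<Sum>j\<leftarrow>L. height k j) \<longleftrightarrow> e = (\<Sum>j\<leftarrow>L. 2 - height k j)"
      using L(1) e by auto
    then show ?thesis
      using *(1) top unfolding i_def[symmetric] e_def[symmetric] by (auto intro: coeff_eq_0)
  qed
  then show "level m c < (\<Sum>j\<leftarrow>L. height k j) \<Longrightarrow> ?A" "level m c = (\<Sum>j\<leftarrow>L. height k j) \<Longrightarrow> ?B"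
    by auto
qed

section \<open>Minors whose rows are sorted by level\<close>

definition levelled :: "nat \<Rightarrow> nat \<Rightarrow> (nat \<Rightarrow> nat list) \<Rightarrow> bool" where
  "levelled k m W \<longleftrightarrow> word_family k m W \<and>
     (\<forall>r<dim_sections k m. (\<Sum>j\<leftarrow>W r. height k j) = level m r)"

text \<open>The block diagonal part of the matrix with respect to level, that is, its limit under
  the torus: every form is replaced by its leading part.\<close>

definition levi :: "nat \<Rightarrow> nat \<Rightarrow> (nat \<Rightarrow> nat \<Rightarrow> complex) \<Rightarrow> (nat \<Rightarrow> nat list) \<Rightarrow> nat \<Rightarrow> nat \<Rightarrow> complex" where
  "levi k m T W r c = (if level m r = level m c then \<Prod>j\<leftarrow>W r. lead k T (comp_of m c) j else 0)"

lemma word_det_levi: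
  assumes T: "triangular k T" and k: "0 < k" and W: "levelled k m W"
  shows "word_det k m T W = fdet (dim_sections k m) (levi k m T W)"
proof -
  let ?F = "\<lambda>r c. coeff (\<Prod>j\<leftarrow>W r. lin_form k T j (comp_of m c)) (expo_of m c)"
  have W': "length (W r) = m" "set (W r) \<subseteq> {..<2*k+1}" "(\<Sum>j\<leftarrow>W r. height k j) = level m r"
    if "r < dim_sections k m" for r
    using W that by (auto simp: levelled_def word_family_def)
  have "level m r \<le> level m c" if "r < dim_sections k m" "c < dim_sections k m" "?F r c \<noteq> 0" for r c
    using coeff_word(1)[OF T k W'(1,2)[OF that(1)] that(2)] W'(3)[OF that(1)] that(3)
    by (metis not_le)
  then have "word_det k m T W = fdet (dim_sections k m) (\<lambda>r c. if level m r = level m c then ?F r c else 0)"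
    unfolding word_det_def by (rule fdet_block_triangular)
  also have "\<dots> = fdet (dim_sections k m) (levi k m T W)"
  proof (rule fdet_cong)
    fix r c assume r: "r < dim_sections k m" and c: "c < dim_sections k m"
    show "(if level m r = level m c then ?F r c else 0) = levi k m T W r c"
      using coeff_word(2)[OF T k W'(1,2)[OF r] c] W'(3)[OF r] by (simp add: levi_def)
  qed
  finally show ?thesis .
qed

text \<open>Row j of a triangular matrix has no entry at nodes before j. Hence a nonzero entry
  bounds the nodes of the column's component from below by the letters of the row, which is what
  makes the keys below increase.\<close>

lemma levi_nonzero:
  assumes T: "triangular k T" and W: "word_family k m W" and r: "r < dim_sections k m"
    and nz: "levi k m T W r c \<noteq> 0" and j: "j \<in> set (W r)"
  shows "j < k \<Longrightarrow> j \<le> even_pos k (comp_of m c)" "k < j \<Longrightarrow> j \<le> odd_pos k (comp_of m c)"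
    "level m r = level m c"
proof -
  have nz': "lead k T (comp_of m c) j \<noteq> 0"
    using nz j by (auto simp: levi_def split: if_splits)
  have "j < 2 * k + 1" using W r j by (auto simp: word_family_def)
  then have zero: "T j l = 0" if "l < j" for l
    using T that by (simp add: triangular_def)
  show "j \<le> even_pos k (comp_of m c)" if "j < k"
  proof (rule ccontr)
    assume "\<not> ?thesis"
    then show False using nz' zero[of "even_pos k (comp_of m c)"] that by (simp add: lead_def)
  qed
  show "j \<le> odd_pos k (comp_of m c)" if "k < j"
  proof (rule ccontr)
    assume "\<not> ?thesis"
    then show False using nz' zero[of "odd_pos k (comp_of m c)"] that by (simp add: lead_def)
  qed
  show "level m r = level m c" using nz by (auto simp: levi_def split: if_splits)
qed

lemma height_node_pos:
  "i < 2 * k \<Longrightarrow> height k (node_pos k i) = (if even i then 0 else 2)"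
  by (auto simp: height_def node_pos_def)

lemma height_node_pos_succ:
  "i < 2 * k \<Longrightarrow> height k (node_pos k (Suc i mod (2 * k))) = (if even i then 2 else 0)"
  using height_node_pos[of "Suc i mod (2*k)" k] even_succ_mod[of i k] by auto

lemma lead_node_pos:
  "i < 2 * k \<Longrightarrow> lead k T i (node_pos k i) = T (node_pos k i) (node_pos k i)"
  using even_pos_lt[of k i] odd_pos_gt[of k i]
  by (cases "even i") (auto simp: lead_def node_pos_even node_pos_odd)

lemma lead_node_pos_succ:
  "i < 2 * k \<Longrightarrow> lead k T i (node_pos k (Suc i mod (2 * k)))
     = T (node_pos k (Suc i mod (2 * k))) (node_pos k (Suc i mod (2 * k)))"
  using even_pos_lt[of k i] odd_pos_gt[of k i]
  by (cases "even i") (auto simp: lead_def node_pos_succ)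

lemma lead_middle: "lead k T i k = T k k"
  by (simp add: lead_def)

text \<open>The word x_i^a x_(i+1)^b y^c has length m and contains u^e on P_i. Positivity makes both
  nodes of P_i occur from e = 2 on, so that the word remembers its component; for e \<le> 1 the
  letter x_i is enough, since the levels of these rows occur on components of one parity
  only.\<close>

definition exponents_ok :: "nat \<Rightarrow> (nat \<Rightarrow> nat) \<Rightarrow> (nat \<Rightarrow> nat) \<Rightarrow> (nat \<Rightarrow> nat) \<Rightarrow> nat \<Rightarrow> bool" where
  "exponents_ok m a b c e \<longleftrightarrow>
     a e + b e + c e = m \<and> 2 * b e + c e = e \<and> 0 < a e \<and> (2 \<le> e \<longrightarrow> 0 < b e)"

text \<open>
  In the word of x_i^m one factor may be replaced: if x_i is the last node of its parity, by the
  first one.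
\<close>

definition admissible :: "nat \<Rightarrow> (nat \<Rightarrow> nat) \<Rightarrow> bool" where
  "admissible k q \<longleftrightarrow> (\<forall>i<2*k. q i = node_pos k i \<or>
     i = 2 * k - 2 \<and> q i = 0 \<or> i = 2 * k - 1 \<and> q i = k + 1)"

definition std_row :: "nat \<Rightarrow> nat \<Rightarrow> (nat \<Rightarrow> nat) \<Rightarrow> (nat \<Rightarrow> nat) \<Rightarrow> (nat \<Rightarrow> nat) \<Rightarrow> (nat \<Rightarrow> nat) \<Rightarrow> nat \<Rightarrow> nat \<Rightarrow> nat list" where
  "std_row k m a b c q i e =
    (if e = 0 then q i # replicate (m - 1) (node_pos k i)
     else replicate (a e) (node_pos k i) @ replicate (b e) (node_pos k (Suc i mod (2 * k))) @ replicate (c e) k)"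

lemma admissible_class:
  assumes "admissible k q" "i < 2 * k" "0 < k"
  shows "q i < 2 * k + 1" "height k (q i) = (if even i then 0 else 2)"
    "lead k T i (q i) = T (q i) (node_pos k i)"
proof -
  have "1 \<le> k" "even (2 * k - 2)" "odd (2 * k - 1)" using assms(3) by auto
  then have *: "if even i then q i < k else k < q i \<and> q i < 2 * k + 1"
    using assms node_pos_lt[OF assms(2)] by (auto simp: admissible_def node_pos_def)
  then show "q i < 2 * k + 1" "height k (q i) = (if even i then 0 else 2)"
    by (auto simp: height_def split: if_splits)
  show "lead k T i (q i) = T (q i) (node_pos k i)"
    using * assms(2) by (auto simp: lead_def node_pos_even node_pos_odd split: if_splits)
qed

lemma std_row_word:
  assumes "exponents_ok m a b c e" "admissible k q" "i < 2 * k" "2 \<le> m"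
  shows "length (std_row k m a b c q i e) = m" "set (std_row k m a b c q i e) \<subseteq> {..<2*k+1}"
    "e < 2 * m - 1 \<Longrightarrow> (\<Sum>j\<leftarrow>std_row k m a b c q i e. height k j) = (if even i then e else 2 * m - e)"
    "node_pos k i \<in> set (std_row k m a b c q i e)"
    "2 \<le> e \<Longrightarrow> node_pos k (Suc i mod (2 * k)) \<in> set (std_row k m a b c q i e)"
proof -
  have k: "0 < k" "Suc i mod (2 * k) < 2 * k" using assms(3) by auto
  note q = admissible_class[OF assms(2,3) k(1)]
  show "length (std_row k m a b c q i e) = m"
    using assms by (auto simp: std_row_def exponents_ok_def)
  show "set (std_row k m a b c q i e) \<subseteq> {..<2*k+1}"
    using q(1) node_pos_lt[OF assms(3)] node_pos_lt[OF k(2)] by (auto simp: std_row_def)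
  have hk: "height k k = 1" by (simp add: height_def)
  show "(\<Sum>j\<leftarrow>std_row k m a b c q i e. height k j) = (if even i then e else 2 * m - e)" if "e < 2 * m - 1"
    using assms(1,4) that
    by (auto simp: std_row_def exponents_ok_def sum_list_replicate q(2) hk
        height_node_pos[OF assms(3)] height_node_pos_succ[OF assms(3)])
  show "node_pos k i \<in> set (std_row k m a b c q i e)"
    using assms by (auto simp: std_row_def exponents_ok_def)
  show "node_pos k (Suc i mod (2 * k)) \<in> set (std_row k m a b c q i e)" if "2 \<le> e"
    using assms that by (auto simp: std_row_def exponents_ok_def)
qed

lemma std_row_diag:
  assumes "exponents_ok m a b c e" "admissible k q" "i < 2 * k"
  defines "p \<equiv> node_pos k i" and "p' \<equiv> node_pos k (Suc i mod (2 * k))"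
  shows "(\<Prod>j\<leftarrow>std_row k m a b c q i e. lead k T i j) =
    (if e = 0 then T (q i) p * T p p ^ (m - 1) else T p p ^ a e * T p' p' ^ b e * T k k ^ c e)"
proof -
  have k: "0 < k" using assms(3) by auto
  show ?thesis
    using admissible_class(3)[OF assms(2,3) k, of T]
    by (simp add: std_row_def prod_list_replicate lead_node_pos[OF assms(3)]
        lead_node_pos_succ[OF assms(3)] lead_middle p_def p'_def mult.assoc)
qed

text \<open>Levels 0 and 1 occur on even components only, 2m - 1 and 2m on odd ones only. The levels
  in between occur on both, with exponents e and 2m - e.\<close>

lemma level_low_iff:
  assumes "r < dim_sections k m" "c < dim_sections k m" "level m r = level m c" "2 \<le> m"
  shows "expo_of m r \<le> 1 \<longleftrightarrow> expo_of m c \<le> 1"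
    "expo_of m r \<le> 1 \<Longrightarrow> expo_of m r = expo_of m c \<and> (even (comp_of m r) \<longleftrightarrow> even (comp_of m c))"
  using index_decompose(2)[OF assms(1)] index_decompose(2)[OF assms(2)] assms(3,4)
  by (auto simp: level_def split: if_splits)

text \<open>The components are the edges of a cycle on 2k nodes, and an edge is determined by its
  ends unless k = 1, when there is a double edge.\<close>

lemma pos_pair_inj:
  assumes "2 \<le> k" "i < 2 * k" "i' < 2 * k" "even_pos k i = even_pos k i'" "odd_pos k i = odd_pos k i'"
  shows "i = i'"
proof -
  have *: "i = i'" if "i < 2 * k" "i' < 2 * k" "even_pos k i = even_pos k i'" "odd_pos k i = odd_pos k i'"
    and evi: "even i" for i i'
  proof (rule ccontr)
    note pos = that(1,3)
    assume "i \<noteq> i'"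
    moreover have "i div 2 = i' div 2" using that(4) by (simp add: odd_pos_def)
    ultimately have i': "i' = Suc i" using evi by presburger
    obtain a where a: "i = 2 * a" using evi by (elim evenE)
    then have "a = Suc a mod k" "a < k" using pos by (auto simp: even_pos_def i')
    then show False using assms(1) by (cases "Suc a = k") auto
  qed
  show ?thesis
  proof (cases "even i")
    case True
    then show ?thesis using *[of i i'] assms by blast
  next
    case False
    show ?thesis
    proof (cases "even i'")
      case True
      then show ?thesis using *[of i' i] assms by auto
    next
      case False
      then show ?thesis using \<open>odd i\<close> assms(5) unfolding odd_pos_def by presburger
    qed
  qed
qed

text \<open>For e \<ge> 2 the rows of one level are partially ordered by the pair of their nodes,
  and the sum of the two positions is strictly increasing for this product order. For e \<le> 1
  there is one component per node, and its index suffices.\<close>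

definition std_key :: "nat \<Rightarrow> nat \<Rightarrow> nat \<Rightarrow> nat" where
  "std_key k m r = (if expo_of m r \<le> 1 then comp_of m r
     else even_pos k (comp_of m r) + odd_pos k (comp_of m r))"

lemma index_eqI:
  assumes "r < dim_sections k m" "c < dim_sections k m" "comp_of m r = comp_of m c" "expo_of m r = expo_of m c"
  shows "r = c"
  using index_decompose(3)[OF assms(1)] index_decompose(3)[OF assms(2)] assms(3,4) by metis

lemma level_comp_imp_eq:
  assumes "r < dim_sections k m" "c < dim_sections k m" "comp_of m r = comp_of m c" "level m r = level m c"
  shows "r = c"
  using index_decompose(2)[OF assms(1)] index_decompose(2)[OF assms(2)] assms(3,4)
  by (intro index_eqI[OF assms(1-3)]) (auto simp: level_def split: if_splits)

lemma std_key_less: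
  assumes T: "triangular k T" and k: "2 \<le> k" and m: "2 \<le> m" and W: "word_family k m W"
    and r: "r < dim_sections k m" and c: "c < dim_sections k m"
    and nz: "levi k m T W r c \<noteq> 0"
    and p: "node_pos k (comp_of m r) \<in> set (W r)"
    and p': "2 \<le> expo_of m r \<Longrightarrow> node_pos k (Suc (comp_of m r) mod (2 * k)) \<in> set (W r)"
  shows "r = c \<or> std_key k m r < std_key k m c"
proof -
  define i where "i = comp_of m r"
  define i' where "i' = comp_of m c"
  have i: "i < 2 * k" "i' < 2 * k" using index_decompose(1) r c by (auto simp: i_def i'_def)
  note N = levi_nonzero[OF T W r nz]
  have lev: "level m r = level m c" by (rule N(3)[OF p])
  note low = level_low_iff[OF r c lev m]
  have kk: "0 < k" using k by simp
  have ev: "even_pos k x < k" "k < odd_pos k x" for x using even_pos_lt[OF kk] odd_pos_gt by auto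
  have np: "node_pos k i = (if even i then even_pos k i else odd_pos k i)"
    using i by (auto simp: node_pos_even node_pos_odd)
  show ?thesis
  proof (cases "expo_of m r \<le> 1")
    case True
    then have e: "expo_of m r = expo_of m c" "even i \<longleftrightarrow> even i'"
      using low by (auto simp: i_def i'_def)
    have "i \<le> i'"
    proof (cases "even i")
      case True
      then have "even_pos k i \<le> even_pos k i'" using N(1)[OF p] np ev by (simp add: i_def i'_def)
      then have "i div 2 \<le> i' div 2"
        using True e(2) i node_pos_even[of i k] node_pos_even[of i' k] by (simp add: node_pos_def)
      then show ?thesis using True e(2) by presburger
    next
      case False
      then have "odd_pos k i \<le> odd_pos k i'" using N(2)[OF p] np ev by (simp add: i_def i'_def)
      then show ?thesis using False e(2) unfolding odd_pos_def by presburger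
    qed
    moreover have "r = c" if "i = i'" using index_eqI[OF r c] e(1) that by (simp add: i_def i'_def)
    ultimately show ?thesis using True low(1) by (auto simp: std_key_def i_def i'_def)
  next
    case False
    then have p2: "node_pos k (Suc i mod (2 * k)) \<in> set (W r)" using p' by (simp add: i_def)
    have le: "even_pos k i \<le> even_pos k i'" "odd_pos k i \<le> odd_pos k i'"
      using N(1,2)[OF p] N(1,2)[OF p2] np node_pos_succ[OF i(1)] ev by (auto simp: i_def i'_def split: if_splits)
    have "r = c" if "even_pos k i + odd_pos k i = even_pos k i' + odd_pos k i'"
    proof -
      have "i = i'" using le that by (intro pos_pair_inj[OF k i]) auto
      then show ?thesis using level_comp_imp_eq[OF r c _ lev] by (simp add: i_def i'_def)
    qed
    then show ?thesis using le False low(1) by (auto simp: std_key_def i_def i'_def)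
  qed
qed

definition std_words :: "nat \<Rightarrow> nat \<Rightarrow> (nat \<Rightarrow> nat) \<Rightarrow> (nat \<Rightarrow> nat) \<Rightarrow> (nat \<Rightarrow> nat) \<Rightarrow> (nat \<Rightarrow> nat) \<Rightarrow> nat \<Rightarrow> nat list" where
  "std_words k m a b c q r = std_row k m a b c q (comp_of m r) (expo_of m r)"

lemma std_words_levelled:
  assumes "\<And>e. e < 2 * m - 1 \<Longrightarrow> exponents_ok m a b c e" "admissible k q" "2 \<le> m"
  shows "levelled k m (std_words k m a b c q)"
  unfolding levelled_def word_family_def
proof (intro conjI allI impI)
  fix r assume r: "r < dim_sections k m"
  note I = index_decompose[OF r]
  note S = std_row_word[OF assms(1)[OF I(2)] assms(2) I(1) assms(3)]
  show "length (std_words k m a b c q r) = m" "set (std_words k m a b c q r) \<subseteq> {..<2 * k + 1}"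
    "(\<Sum>j\<leftarrow>std_words k m a b c q r. height k j) = level m r"
    using S(1-2) S(3)[OF I(2)] by (auto simp: std_words_def level_def)
qed

lemma std_words_fdet:
  assumes T: "triangular k T" and k: "2 \<le> k" and m: "2 \<le> m"
    and ok: "\<And>e. e < 2 * m - 1 \<Longrightarrow> exponents_ok m a b c e" and q: "admissible k q"
  defines "p \<equiv> node_pos k" and "p' \<equiv> \<lambda>i. node_pos k (Suc i mod (2 * k))"
  shows "fdet (dim_sections k m) (levi k m T (std_words k m a b c q)) = (\<Prod>i<2*k. \<Prod>e<2*m-1.
    if e = 0 then T (q i) (p i) * T (p i) (p i) ^ (m - 1)
    else T (p i) (p i) ^ a e * T (p' i) (p' i) ^ b e * T k k ^ c e)"
proof -
  define F where "F i e = (if e = 0 then T (q i) (p i) * T (p i) (p i) ^ (m - 1)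
    else T (p i) (p i) ^ a e * T (p' i) (p' i) ^ b e * T k k ^ c e)" for i e
  let ?W = "std_words k m a b c q"
  have W: "word_family k m ?W" using std_words_levelled[OF ok q m] by (simp add: levelled_def)
  have "fdet (dim_sections k m) (levi k m T ?W) = (\<Prod>r<dim_sections k m. levi k m T ?W r r)"
  proof (rule fdet_triangular[where key = "std_key k m"])
    fix r c assume rc: "r < dim_sections k m" "c < dim_sections k m" "levi k m T ?W r c \<noteq> 0"
    note I = index_decompose[OF rc(1)]
    note S = std_row_word[OF ok[OF I(2)] q I(1) m]
    show "r = c \<or> std_key k m r < std_key k m c"
      using S(4,5) by (intro std_key_less[OF T k m W rc]) (auto simp: std_words_def)
  qed
  also have "\<dots> = (\<Prod>r<dim_sections k m. F (comp_of m r) (expo_of m r))"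
  proof (rule prod.cong[OF refl])
    fix r assume "r \<in> {..<dim_sections k m}"
    then have r: "r < dim_sections k m" by simp
    note I = index_decompose[OF r]
    show "levi k m T ?W r r = F (comp_of m r) (expo_of m r)"
      using std_row_diag[OF ok[OF I(2)] q I(1), of T] by (simp add: levi_def std_words_def p_def p'_def F_def)
  qed
  also have "\<dots> = (\<Prod>i<2*k. \<Prod>e<2*m-1. F i e)" by (rule prod_over_indices)
  finally show ?thesis unfolding F_def .
qed

subsection \<open>Monomials of high degree in y\<close>

definition nxt :: "nat \<Rightarrow> nat \<Rightarrow> nat" where "nxt k i = Suc i mod (2 * k)"

lemma nxt_lt: "i < 2 * k \<Longrightarrow> nxt k i < 2 * k"
  by (simp add: nxt_def)

lemma even_nxt: "i < 2 * k \<Longrightarrow> even (nxt k i) \<longleftrightarrow> odd i"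
  by (simp add: nxt_def even_succ_mod)

lemma nxt_inj: "i < 2 * k \<Longrightarrow> i' < 2 * k \<Longrightarrow> nxt k i = nxt k i' \<Longrightarrow> i = i'"
  by (auto simp: nxt_def succ_mod_if split: if_splits)

lemma node_pos_nxt: "i < 2 * k \<Longrightarrow> node_pos k (nxt k i) = (if even i then odd_pos k i else even_pos k i)"
  by (simp add: nxt_def node_pos_succ)

lemma lead_nxt_eq:
  assumes "i < 2 * k" "if even i then k < x else x < k"
  shows "lead k T i x = T x (node_pos k (nxt k i))" "lead k T (nxt k i) x = T x (node_pos k (nxt k i))"
  using assms node_pos_nxt[OF assms(1)] even_nxt[OF assms(1)] nxt_lt[OF assms(1)]
    node_pos_even[of "nxt k i" k] node_pos_odd[of "nxt k i" k]
  by (auto simp: lead_def split: if_splits)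

lemma lead_same_class:
  assumes "i < 2 * k" "if even i then x < k else k < x"
  shows "lead k T i x = T x (node_pos k i)"
  using assms by (auto simp: lead_def node_pos_even node_pos_odd split: if_splits)

definition tail_ok :: "nat \<Rightarrow> (nat \<Rightarrow> nat) \<Rightarrow> bool" where
  "tail_ok k t \<longleftrightarrow> (\<forall>i<2*k. t i < 2 * k + 1 \<and> (if even i then t i < k else k < t i))"

text \<open>Exponent 2 on P_i and exponent 2m - 2 on P_(i-1) have the same level and meet at the
  node x_i. The two rows attached to this node become x_i^(m-2) y^2 and x_i^(m-1) times a node of
  the other parity; the latter, \<open>t (i - 1)\<close>, will be one of the two neighbours of x_i
  on the cycle.\<close>

definition rich_row :: "nat \<Rightarrow> nat \<Rightarrow> (nat \<Rightarrow> nat) \<Rightarrow> (nat \<Rightarrow> nat) \<Rightarrow> (nat \<Rightarrow> nat) \<Rightarrow> (nat \<Rightarrow> nat) \<Rightarrow> (nat \<Rightarrow> nat) \<Rightarrow> nat \<Rightarrow> nat \<Rightarrow> nat list" where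
  "rich_row k m a b c q t i e =
    (if e = 2 then k # k # replicate (m - 2) (node_pos k i)
     else if e = 2 * m - 2 then t i # replicate (m - 1) (node_pos k (nxt k i))
     else std_row k m a b c q i e)"

definition rich_words :: "nat \<Rightarrow> nat \<Rightarrow> (nat \<Rightarrow> nat) \<Rightarrow> (nat \<Rightarrow> nat) \<Rightarrow> (nat \<Rightarrow> nat) \<Rightarrow> (nat \<Rightarrow> nat) \<Rightarrow> (nat \<Rightarrow> nat) \<Rightarrow> nat \<Rightarrow> nat list" where
  "rich_words k m a b c q t r = rich_row k m a b c q t (comp_of m r) (expo_of m r)"

lemma rich_words_levelled:
  assumes ok: "\<And>e. e < 2 * m - 1 \<Longrightarrow> e \<noteq> 2 \<Longrightarrow> e \<noteq> 2 * m - 2 \<Longrightarrow> exponents_ok m a b c e"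
    and q: "admissible k q" and t: "tail_ok k t" and m: "3 \<le> m"
  shows "levelled k m (rich_words k m a b c q t)"
  unfolding levelled_def word_family_def
proof (intro conjI allI impI)
  fix r assume r: "r < dim_sections k m"
  note I = index_decompose[OF r]
  define i where "i = comp_of m r"
  define e where "e = expo_of m r"
  have i: "i < 2 * k" and e: "e < 2 * m - 1" using I by (auto simp: i_def e_def)
  have m2: "2 \<le> m" using m by simp
  have hk: "height k k = 1" by (simp add: height_def)
  have ti: "t i < 2 * k + 1" "if even i then t i < k else k < t i" using t i by (auto simp: tail_ok_def)
  then have ht: "height k (t i) = (if even i then 0 else 2)" by (cases "even i") (auto simp: height_def)
  have "length (rich_row k m a b c q t i e) = m \<and> set (rich_row k m a b c q t i e) \<subseteq> {..<2 * k + 1} \<and>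
    (\<Sum>j\<leftarrow>rich_row k m a b c q t i e. height k j) = (if even i then e else 2 * m - e)"
  proof -
    consider "e = 2" | "e = 2 * m - 2" "e \<noteq> 2" | "e \<noteq> 2" "e \<noteq> 2 * m - 2" by blast
    then show ?thesis
    proof cases
      case 1
      then show ?thesis
        using m i node_pos_lt[OF i] by (auto simp: rich_row_def sum_list_replicate hk height_node_pos[OF i])
    next
      case 2
      then show ?thesis
        using m i node_pos_lt[OF nxt_lt[OF i]] ti ht
        by (auto simp: rich_row_def sum_list_replicate height_node_pos[OF nxt_lt[OF i]] even_nxt[OF i])
    next
      case 3
      then show ?thesis
        using std_row_word(1-3)[OF ok q i m2, of e] e by (simp add: rich_row_def)
    qed
  qed
  then show "length (rich_words k m a b c q t r) = m" "set (rich_words k m a b c q t r) \<subseteq> {..<2 * k + 1}"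
    "(\<Sum>j\<leftarrow>rich_words k m a b c q t r. height k j) = level m r"
    by (auto simp: rich_words_def level_def i_def e_def)
qed

text \<open>The two rows at node x_j get the keys 2j and 2j + 1. The row with y^2 comes second,
  because it vanishes in the reduced column of exponent 2m - 2 but the other row need not vanish in
  the column of exponent 2.\<close>

definition rich_key :: "nat \<Rightarrow> nat \<Rightarrow> nat \<Rightarrow> nat" where
  "rich_key k m r = (if expo_of m r = 2 then 2 * comp_of m r + 1
     else if expo_of m r = 2 * m - 2 then 2 * nxt k (comp_of m r) else std_key k m r)"

lemma node_pos_mono_class:
  assumes "i < 2 * k" "i' < 2 * k" "even i \<longleftrightarrow> even i'" "node_pos k i \<le> node_pos k i'"
  shows "i \<le> i'"
proof -
  have "i div 2 \<le> i' div 2" using assms by (auto simp: node_pos_def split: if_splits)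
  then show ?thesis using assms(3) by presburger
qed

lemma level_mid_iff:
  assumes "r < dim_sections k m" "c < dim_sections k m" "level m r = level m c" "3 \<le> m"
  shows "expo_of m r = 2 \<or> expo_of m r = 2 * m - 2 \<longleftrightarrow> expo_of m c = 2 \<or> expo_of m c = 2 * m - 2"
    "expo_of m r = 2 \<Longrightarrow> expo_of m c = 2 \<Longrightarrow> even (comp_of m r) \<longleftrightarrow> even (comp_of m c)"
    "expo_of m r = 2 * m - 2 \<Longrightarrow> expo_of m c = 2 * m - 2 \<Longrightarrow> even (comp_of m r) \<longleftrightarrow> even (comp_of m c)"
    "expo_of m r = 2 \<Longrightarrow> expo_of m c = 2 * m - 2 \<Longrightarrow> even (comp_of m r) \<longleftrightarrow> odd (comp_of m c)"
    "expo_of m r = 2 * m - 2 \<Longrightarrow> expo_of m c = 2 \<Longrightarrow> even (comp_of m r) \<longleftrightarrow> odd (comp_of m c)"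
  using index_decompose(2)[OF assms(1)] index_decompose(2)[OF assms(2)] assms(3,4)
  by (auto simp: level_def split: if_splits)

text \<open>The component P_i of the column has one node of the parity of j, namely x_i or x_(i+1),
  and triangularity allows j only up to that node.\<close>

lemma levi_nonzero_le:
  assumes T: "triangular k T" and k: "0 < k" and W: "word_family k m W" and r: "r < dim_sections k m"
    and c: "c < dim_sections k m" and nz: "levi k m T W r c \<noteq> 0"
    and j: "node_pos k j \<in> set (W r)" "j < 2 * k"
  shows "even j \<longleftrightarrow> even (comp_of m c) \<Longrightarrow> j \<le> comp_of m c"
    "even j \<longleftrightarrow> odd (comp_of m c) \<Longrightarrow> j \<le> nxt k (comp_of m c)"
proof -
  define i where "i = comp_of m c"
  have i: "i < 2 * k" using index_decompose(1)[OF c] by (simp add: i_def)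
  have "even j \<Longrightarrow> node_pos k j \<le> even_pos k i" "odd j \<Longrightarrow> node_pos k j \<le> odd_pos k i"
    using levi_nonzero(1,2)[OF T W r nz j(1)] node_pos_even[OF _ j(2)] node_pos_odd[of j k]
      even_pos_lt[OF k, of j] odd_pos_gt[of k j] by (auto simp: i_def)
  then have *: "node_pos k j \<le> (if even j then even_pos k i else odd_pos k i)" by simp
  show "j \<le> comp_of m c" if "even j \<longleftrightarrow> even (comp_of m c)"
    using * that i j(2) unfolding i_def[symmetric]
    by (intro node_pos_mono_class[OF j(2) i]) (auto simp: node_pos_even node_pos_odd)
  show "j \<le> nxt k (comp_of m c)" if "even j \<longleftrightarrow> odd (comp_of m c)"
    using * that i j(2) even_nxt[OF i] node_pos_nxt[OF i] unfolding i_def[symmetric]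
    by (intro node_pos_mono_class[OF j(2) nxt_lt[OF i]]) auto
qed

text \<open>
  At the lowest order, the row of x_i^(m-2) y^2 takes the same value at the two coordinates of its
  level on the two components through a node. Subtracting one of these columns from the other
  therefore makes the matrix triangular.
\<close>

lemma rich_words_fdet:
  assumes T: "triangular k T" and k: "2 \<le> k" and m: "3 \<le> m"
    and ok: "\<And>e. e < 2 * m - 1 \<Longrightarrow> e \<noteq> 2 \<Longrightarrow> e \<noteq> 2 * m - 2 \<Longrightarrow> exponents_ok m a b c e"
    and q: "admissible k q" and t: "tail_ok k t"
  defines "p \<equiv> node_pos k" and "p' \<equiv> \<lambda>i. node_pos k (nxt k i)" and "p'' \<equiv> \<lambda>i. node_pos k (nxt k (nxt k i))"
  shows "fdet (dim_sections k m) (levi k m T (rich_words k m a b c q t)) = (\<Prod>i<2*k. \<Prod>e<2*m-1.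
    if e = 2 then T k k ^ 2 * T (p i) (p i) ^ (m - 2)
    else if e = 2 * m - 2 then (T (t i) (p i) - T (t i) (p'' i)) * T (p' i) (p' i) ^ (m - 1)
    else if e = 0 then T (q i) (p i) * T (p i) (p i) ^ (m - 1)
    else T (p i) (p i) ^ a e * T (p' i) (p' i) ^ b e * T k k ^ c e)"
proof -
  let ?W = "rich_words k m a b c q t" and ?N = "dim_sections k m"
  define F where "F i e = (if e = 2 then T k k ^ 2 * T (p i) (p i) ^ (m - 2)
    else if e = 2 * m - 2 then (T (t i) (p i) - T (t i) (p'' i)) * T (p' i) (p' i) ^ (m - 1)
    else if e = 0 then T (q i) (p i) * T (p i) (p i) ^ (m - 1)
    else T (p i) (p i) ^ a e * T (p' i) (p' i) ^ b e * T k k ^ c e)" for i e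
  define z where "z c = (if expo_of m c = 2 * m - 2 then 1 else 0 :: complex)" for c
  define pc where "pc c = index_of m (nxt k (comp_of m c)) 2" for c
  have W: "word_family k m ?W" using rich_words_levelled[OF ok q t m] by (simp add: levelled_def)
  have m2: "2 \<le> m" "2 < 2 * m - 1" "2 * m - 2 \<noteq> 2" using m by auto
  have k0: "0 < k" using k by simp
  have pc: "pc c < ?N" "comp_of m (pc c) = nxt k (comp_of m c)" "expo_of m (pc c) = 2" if "c < ?N" for c
    using index_decompose(1)[OF that] m2(2) comp_expo_of[OF m2(2)] nxt_lt index_of_lt[OF _ m2(2)]
    by (auto simp: pc_def)
  have lev_pc: "level m (pc c) = level m c" if "c < ?N" "expo_of m c = 2 * m - 2" for c
    using that pc[OF that(1)] even_nxt[OF index_decompose(1)[OF that(1)]] m by (auto simp: level_def)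
  define G where "G r c = levi k m T ?W r c - z c * levi k m T ?W r (pc c)" for r c
  have "fdet ?N (levi k m T ?W) = fdet ?N G"
    unfolding G_def
    by (rule fdet_column_op[symmetric]) (use pc m2(3) in \<open>auto simp: z_def split: if_splits\<close>)
  also have "\<dots> = (\<Prod>r<?N. G r r)"
  proof (rule fdet_triangular[where key = "rich_key k m"])
    fix r d assume r: "r < ?N" and d: "d < ?N" and nz: "G r d \<noteq> 0"
    define i where "i = comp_of m r"
    define i' where "i' = comp_of m d"
    have i: "i < 2 * k" and i': "i' < 2 * k" using index_decompose(1) r d by (auto simp: i_def i'_def)
    have std: "?W r = std_row k m a b c q i (expo_of m r)" if "expo_of m r \<noteq> 2" "expo_of m r \<noteq> 2 * m - 2"
      using that by (simp add: rich_words_def rich_row_def i_def)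
    have in2: "node_pos k i \<in> set (?W r)" if "expo_of m r = 2"
      using that m by (auto simp: rich_words_def rich_row_def i_def)
    have inm: "node_pos k (nxt k i) \<in> set (?W r)" if "expo_of m r = 2 * m - 2"
      using that m m2(3) by (auto simp: rich_words_def rich_row_def i_def)
    have nonempty: "\<exists>j. j \<in> set (?W r)"
      using W r m by (cases "?W r") (auto simp: word_family_def)
    show "r = d \<or> rich_key k m r < rich_key k m d"
    proof (cases "expo_of m d = 2 * m - 2")
      case False
      then have nz': "levi k m T ?W r d \<noteq> 0" using nz by (simp add: G_def z_def)
      have lev: "level m r = level m d" using levi_nonzero(3)[OF T W r nz'] nonempty by blast
      note mid = level_mid_iff[OF r d lev m]
      note le = levi_nonzero_le[OF T k0 W r d nz']
      consider "expo_of m r = 2" "expo_of m d = 2" | "expo_of m r = 2 * m - 2" "expo_of m d = 2"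
        | "expo_of m r \<noteq> 2" "expo_of m r \<noteq> 2 * m - 2" "expo_of m d \<noteq> 2"
        using mid(1) False by blast
      then show ?thesis
      proof cases
        case 1
        then have "i \<le> i'" using le(1)[OF in2 i] mid(2) by (simp add: i_def i'_def)
        moreover have "r = d" if "i = i'" using index_eqI[OF r d] 1 that by (simp add: i_def i'_def)
        ultimately show ?thesis using 1 by (auto simp: rich_key_def i_def i'_def)
      next
        case 2
        then have "nxt k i \<le> i'"
          using le(1)[OF inm nxt_lt[OF i]] mid(5) even_nxt[OF i] by (simp add: i_def i'_def)
        then show ?thesis using 2 m2(3) by (auto simp: rich_key_def i_def i'_def)
      next
        case 3
        note S = std_row_word(4,5)[OF ok[OF index_decompose(2)[OF r] 3(1,2)] q i m2(1)]
        have "r = d \<or> std_key k m r < std_key k m d"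
          using S std[OF 3(1,2)] by (intro std_key_less[OF T k m2(1) W r d nz']) (simp_all add: i_def)
        then show ?thesis using 3 False by (simp add: rich_key_def)
      qed
    next
      case True
      then have G: "G r d = levi k m T ?W r d - levi k m T ?W r (pc d)" by (simp add: G_def z_def)
      with nz consider "levi k m T ?W r d \<noteq> 0" | "levi k m T ?W r (pc d) \<noteq> 0" by fastforce
      then have lev: "level m r = level m d"
        using levi_nonzero(3)[OF T W r] nonempty lev_pc[OF d True] by cases metis+
      note mid = level_mid_iff[OF r d lev m]
      consider "expo_of m r = 2" | "expo_of m r = 2 * m - 2" using mid(1) True by blast
      then show ?thesis
      proof cases
        case 1
        then have par: "even i \<longleftrightarrow> odd i'" using mid(4) True by (simp add: i_def i'_def)
        have cls: "if even i' then k < node_pos k i else node_pos k i < k"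
          using par i by (auto simp: node_pos_def)
        \<comment> \<open>The components of the two columns share the node following P_i', which has
          the parity of i; so the letters x_i, like the letters y, have equal leading values on
          both.\<close>
        have "levi k m T ?W r d = levi k m T ?W r (pc d)"
          using lev lev_pc[OF d True] pc(2)[OF d] 1 lead_nxt_eq[OF i' cls, of T]
          by (simp add: levi_def rich_words_def rich_row_def i_def[symmetric] i'_def[symmetric] lead_middle)
        then show ?thesis using nz G by simp
      next
        case 2
        have par: "even i \<longleftrightarrow> even i'" using mid(3) 2 True by (simp add: i_def i'_def)
        have "nxt k i \<le> nxt k i'" if "levi k m T ?W r d \<noteq> 0"
          using levi_nonzero_le(2)[OF T k0 W r d that inm[OF 2] nxt_lt[OF i]] par even_nxt[OF i]
          by (simp add: i'_def)
        moreover have "nxt k i \<le> nxt k i'" if "levi k m T ?W r (pc d) \<noteq> 0"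
          using levi_nonzero_le(1)[OF T k0 W r pc(1)[OF d] that inm[OF 2] nxt_lt[OF i]] par
            even_nxt[OF i] even_nxt[OF i'] pc(2)[OF d]
          by (simp add: i'_def)
        ultimately have le: "nxt k i \<le> nxt k i'" using nz G by fastforce
        have "r = d" if "nxt k i = nxt k i'"
          using nxt_inj[OF i i' that] index_eqI[OF r d] 2 True by (simp add: i_def i'_def)
        then show ?thesis using le 2 True m2(3) by (auto simp: rich_key_def i_def i'_def)
      qed
    qed
  qed
  also have "\<dots> = (\<Prod>r<?N. F (comp_of m r) (expo_of m r))"
  proof (rule prod.cong[OF refl])
    fix r assume "r \<in> {..<?N}"
    then have r: "r < ?N" by simp
    define i where "i = comp_of m r"
    define e where "e = expo_of m r"
    have i: "i < 2 * k" and e: "e < 2 * m - 1" using index_decompose[OF r] by (auto simp: i_def e_def)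
    consider "e = 2" | "e = 2 * m - 2" "e \<noteq> 2" | "e \<noteq> 2" "e \<noteq> 2 * m - 2" by blast
    then show "G r r = F (comp_of m r) (expo_of m r)"
    proof cases
      case 1
      then show ?thesis
        using m2(3) lead_node_pos[OF i, of T]
        by (simp add: G_def z_def levi_def rich_words_def rich_row_def F_def i_def[symmetric] e_def[symmetric]
            lead_middle p_def power2_eq_square)
    next
      case 2
      have ti: "if even i then t i < k else k < t i" using t i by (auto simp: tail_ok_def)
      have ti': "if even (nxt k i) then k < t i else t i < k" using ti even_nxt[OF i] by auto
      have "levi k m T ?W r r = T (t i) (p i) * T (p' i) (p' i) ^ (m - 1)"
        using 2 lead_same_class[OF i ti, of T] lead_node_pos_succ[OF i, of T]
        by (simp add: levi_def rich_words_def rich_row_def i_def[symmetric] e_def[symmetric] p_def p'_def nxt_def)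
      moreover have "levi k m T ?W r (pc r) = T (t i) (p'' i) * T (p' i) (p' i) ^ (m - 1)"
        using 2 lev_pc[OF r] pc(2)[OF r] lead_nxt_eq(1)[OF nxt_lt[OF i] ti', of T] lead_node_pos[OF nxt_lt[OF i], of T]
        by (simp add: levi_def rich_words_def rich_row_def i_def[symmetric] e_def[symmetric] p'_def p''_def)
      ultimately show ?thesis
        using 2 by (simp add: G_def z_def F_def i_def[symmetric] e_def[symmetric] algebra_simps)
    next
      case 3
      then show ?thesis
        using std_row_diag[OF ok[OF e] q i, of T]
        by (simp add: G_def z_def levi_def rich_words_def rich_row_def F_def i_def[symmetric] e_def[symmetric]
            p_def p'_def nxt_def)
    qed
  qed
  also have "\<dots> = (\<Prod>i<2*k. \<Prod>e<2*m-1. F i e)" by (rule prod_over_indices)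
  finally show ?thesis unfolding F_def .
qed

section \<open>Lower bounds for minors of triangular matrices\<close>

lemma prod_nxt: "(\<Prod>i<2*k. f (nxt k i)) = (\<Prod>i<2*k. f i)" for f :: "nat \<Rightarrow> 'a::comm_monoid_mult"
proof -
  have "bij_betw (nxt k) {..<2*k} {..<2*k}"
    using nxt_inj[of _ k] nxt_lt[of _ k]
    by (intro bij_betw_imageI endo_inj_surj) (auto intro!: inj_onI)
  then show ?thesis by (rule prod.reindex_bij_betw)
qed

text \<open>Each node is the first node of one component and the second node of the preceding one.
  After rotating the second factor all \<open>d i\<close> have the same exponent, however a + b is
  split.\<close>

lemma prod_uniform:
  fixes d :: "nat \<Rightarrow> real"
  shows "(\<Prod>i<2*k. \<Prod>e<n. d i ^ a e * d (nxt k i) ^ b e * s ^ c e)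
    = (\<Prod>i<2*k. d i) ^ (\<Sum>e<n. a e + b e) * s ^ (2 * k * (\<Sum>e<n. c e))"
proof -
  have "(\<Prod>i<2*k. \<Prod>e<n. d i ^ a e * d (nxt k i) ^ b e * s ^ c e)
      = (\<Prod>e<n. (\<Prod>i<2*k. d i) ^ a e * (\<Prod>i<2*k. d (nxt k i)) ^ b e * (s ^ c e) ^ (2 * k))"
    by (subst prod.swap) (simp add: prod.distrib prod_power_distrib)
  also have "\<dots> = (\<Prod>e<n. (\<Prod>i<2*k. d i) ^ (a e + b e) * s ^ (c e * (2 * k)))"
    by (simp add: prod_nxt power_add power_mult)
  also have "\<dots> = (\<Prod>i<2*k. d i) ^ (\<Sum>e<n. a e + b e) * s ^ (\<Sum>e<n. c e * (2 * k))"
    by (simp add: prod.distrib power_sum)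
  finally show ?thesis by (simp add: sum_distrib_right[symmetric] mult.commute)
qed

lemma diag_prod:
  fixes f :: "nat \<Rightarrow> 'a::comm_monoid_mult"
  assumes "0 < k"
  shows "(\<Prod>j<2*k+1. f j) = f k * (\<Prod>i<2*k. f (node_pos k i))"
proof -
  have "node_pos k ` {..<2*k} = {..<2*k+1} - {k}"
  proof (intro equalityI subsetI)
    fix l assume "l \<in> {..<2*k+1} - {k}"
    then obtain i where "i < 2 * k" "node_pos k i = l" using node_pos_surj[of l k] by blast
    then show "l \<in> node_pos k ` {..<2*k}" by blast
  next
    fix l assume "l \<in> node_pos k ` {..<2*k}"
    then obtain i where "i < 2 * k" "l = node_pos k i" by auto
    then show "l \<in> {..<2*k+1} - {k}" using node_pos_lt[of i k] node_pos_neq[of i k] by auto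
  qed
  moreover have "inj_on (node_pos k) {..<2*k}"
    using node_pos_inj by (intro inj_onI) blast
  ultimately have "bij_betw (node_pos k) {..<2*k} ({..<2*k+1} - {k})"
    by (simp add: bij_betw_def)
  then have "(\<Prod>i<2*k. f (node_pos k i)) = (\<Prod>j\<in>{..<2*k+1} - {k}. f j)"
    by (rule prod.reindex_bij_betw)
  moreover have "(\<Prod>j<2*k+1. f j) = f k * (\<Prod>j\<in>{..<2*k+1} - {k}. f j)"
    by (rule prod.remove) auto
  ultimately show ?thesis by simp
qed

text \<open>As few letters y as parity permits: one for each odd exponent. Since the entry at y has
  modulus at most 1, it remains to see that the degree 2k (m - 1) in y does not exceed the exponent
  of each x_i.\<close>

lemma poor_words_bound:
  assumes T: "triangular k T" and k: "2 \<le> k" "k \<le> m" and m: "2 \<le> m"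
    and s: "cmod (T k k) \<le> 1"
  shows "\<exists>W. word_family k m W \<and>
    cmod (\<Prod>j<2*k+1. T j j) ^ (m * (2 * m - 1) - (m - 1)) \<le> cmod (word_det k m T W)"
proof -
  define a where "a e = m - e div 2 - e mod 2" for e
  define b where "b e = e div 2" for e :: nat
  define c where "c e = e mod 2" for e :: nat
  define d where "d i = cmod (T (node_pos k i) (node_pos k i))" for i
  define G where "G = (\<Prod>i<2*k. d i)"
  define A where "A = m * (2 * m - 1) - (m - 1)"
  have k0: "0 < k" using k by simp
  have ok: "exponents_ok m a b c e" if "e < 2 * m - 1" for e
  proof -
    have "e div 2 + e mod 2 < m" "e div 2 * 2 + e mod 2 = e" using that by presburger+
    then show ?thesis by (auto simp: exponents_ok_def a_def b_def c_def)
  qed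
  have q: "admissible k (node_pos k)" by (simp add: admissible_def)
  let ?W = "std_words k m a b c (node_pos k)"
  have W: "levelled k m ?W" by (rule std_words_levelled[OF ok q m])
  have "word_det k m T ?W = (\<Prod>i<2*k. \<Prod>e<2*m-1.
      T (node_pos k i) (node_pos k i) ^ a e * T (node_pos k (nxt k i)) (node_pos k (nxt k i)) ^ b e * T k k ^ c e)"
    unfolding word_det_levi[OF T k0 W] nxt_def
    by (rule trans[OF std_words_fdet[OF T k(1) m ok q]])
      (use m in \<open>auto simp: a_def b_def c_def power_eq_if intro!: prod.cong\<close>)
  then have "cmod (word_det k m T ?W) = (\<Prod>i<2*k. \<Prod>e<2*m-1. d i ^ a e * d (nxt k i) ^ b e * cmod (T k k) ^ c e)"
    by (simp add: prod_norm[symmetric] norm_mult norm_power d_def)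
  also have "\<dots> = G ^ (\<Sum>e<2*m-1. a e + b e) * cmod (T k k) ^ (2 * k * (\<Sum>e<2*m-1. c e))"
    unfolding G_def by (rule prod_uniform)
  also have "(\<Sum>e<2*m-1. c e) = m - 1" using sum_parity[of m] m by (simp add: c_def)
  also have "(\<Sum>e<2*m-1. a e + b e) = A"
  proof -
    have "(\<Sum>e<2*m-1. a e + b e) + (\<Sum>e<2*m-1. c e) = (\<Sum>e<2*m-1. m)"
      unfolding sum.distrib[symmetric] using ok by (intro sum.cong) (auto simp: exponents_ok_def)
    then show ?thesis
      using \<open>(\<Sum>e<2*m-1. c e) = m - 1\<close> by (simp add: A_def mult.commute)
  qed
  finally have val: "cmod (word_det k m T ?W) = G ^ A * cmod (T k k) ^ (2 * k * (m - 1))" .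
  \<comment> \<open>Here k \<le> m enters: \<open>A\<close> equals 2m (m - 1) + 1.\<close>
  have "2 * k * (m - 1) \<le> A"
  proof -
    obtain n where n: "m = n + 2" using m by (metis add.commute le_Suc_ex)
    have "2 * k * (m - 1) \<le> 2 * m * (m - 1)" using k by (intro mult_le_mono1) auto
    then show ?thesis by (simp add: A_def n algebra_simps)
  qed
  then have "cmod (T k k) ^ A \<le> cmod (T k k) ^ (2 * k * (m - 1))"
    using s by (intro power_decreasing) auto
  then have "(cmod (T k k) * G) ^ A \<le> cmod (word_det k m T ?W)"
    unfolding val power_mult_distrib mult.commute[of "cmod (T k k) ^ A"]
    by (intro mult_left_mono zero_le_power) (auto simp: G_def d_def prod_nonneg)
  moreover have "cmod (\<Prod>j<2*k+1. T j j) = cmod (T k k) * G"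
    unfolding diag_prod[OF k0] by (simp add: norm_mult G_def d_def prod_norm)
  ultimately show ?thesis
    using W unfolding A_def levelled_def by (intro exI[of _ ?W]) auto
qed

lemma sum_lessThan_add: "(\<Sum>e<x+y. f e) = (\<Sum>e<x. f e) + (\<Sum>e<y. f (x + e))"
  for f :: "nat \<Rightarrow> 'a::comm_monoid_add"
  by (induction y) (auto simp: add.assoc)

text \<open>
  The delicate case is that of the last node p of its parity, p'' being the first one: if the entry
  at (p'', p) is small, then its difference with the one at (p'', p'') is not.
\<close>

lemma pivot_choice:
  assumes T: "triangular k T" and k: "2 \<le> k" and i: "i < 2 * k"
  defines "p \<equiv> node_pos k i" and "p'' \<equiv> node_pos k (nxt k (nxt k i))"
  shows "\<exists>q t. (q = p \<or> 2 * k - 2 \<le> i \<and> q = p'') \<and> (t = p \<or> t = p'') \<and>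
    cmod (T p p) * cmod (T p'' p'') * (if i < 2 * k - 2 then 1 else 1 / 2)
      \<le> cmod (T q p) * cmod (T t p - T t p'')"
proof -
  have lt: "p < 2 * k + 1" "p'' < 2 * k + 1"
    using node_pos_lt[OF i] node_pos_lt[OF nxt_lt[OF nxt_lt[OF i]]] by (auto simp: p_def p''_def)
  show ?thesis
  proof (cases "i < 2 * k - 2")
    case True
    then have "p'' = node_pos k (i + 2)" by (simp add: p''_def nxt_def)
    then have "p < p''" using True by (auto simp: p_def node_pos_def)
    then have "T p'' p = 0" using T lt by (auto simp: triangular_def)
    then show ?thesis using True by (intro exI[of _ p] exI[of _ p'']) auto
  next
    case False
    obtain n where n: "k = Suc n" "0 < n" using k by (cases k) auto
    have "i = 2 * n \<or> i = Suc (2 * n)" using False i n by auto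
    then have "p'' < p"
      using n by (auto simp: p_def p''_def nxt_def node_pos_def)
    then have z: "T p p'' = 0" using T lt by (auto simp: triangular_def)
    show ?thesis
    proof (cases "cmod (T p'' p'') / 2 \<le> cmod (T p'' p)")
      \<comment> \<open>A large entry at (p'', p) is itself used in the row of exponent 0, where it
        replaces the diagonal entry at p; that one is recovered from \<open>t = p\<close>, since T p
        p'' = 0.\<close>
      case True
      then have "cmod (T p p) * (cmod (T p'' p'') / 2) \<le> cmod (T p p) * cmod (T p'' p)"
        by (intro mult_left_mono) auto
      then show ?thesis using False z by (intro exI[of _ p''] exI[of _ p]) (auto simp: mult.commute)
    next
      case *: False
      have "cmod (T p'' p'') / 2 \<le> cmod (T p'' p - T p'' p'')"
        using norm_triangle_ineq2[of "T p'' p''" "T p'' p"] * by (simp add: norm_minus_commute)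
      then have "cmod (T p p) * (cmod (T p'' p'') / 2) \<le> cmod (T p p) * cmod (T p'' p - T p'' p'')"
        by (intro mult_left_mono) auto
      then show ?thesis using False by (intro exI[of _ p] exI[of _ p'']) auto
    qed
  qed
qed

text \<open>For 2 < e < 2m - 2 this is the largest exponent of y that \<open>exponents_ok\<close>
  admits, the minimum of e - 2 and 2m - 2 - e. At e = 2 it counts the word x_i^(m-2) y^2.\<close>

definition rich_c :: "nat \<Rightarrow> nat \<Rightarrow> nat" where
  "rich_c m e = (if e \<le> 2 then e else if e \<le> m then e - 2 else 2 * m - 2 - e)"

text \<open>At e = 2m - 2 this pretends that the word is x_(i+1)^m, although one letter is
  \<open>t i\<close>. The fiction keeps the exponents uniform and is corrected by the factors \<rho>
  in \<open>rich_words_bound\<close>.\<close>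

definition rich_b :: "nat \<Rightarrow> nat \<Rightarrow> nat" where
  "rich_b m e = (if e \<le> 2 then 0 else if e \<le> m then 1 else if e = 2 * m - 2 then m else e - m + 1)"

definition rich_a :: "nat \<Rightarrow> nat \<Rightarrow> nat" where
  "rich_a m e = m - rich_b m e - rich_c m e"

lemma rich_sum:
  assumes "3 \<le> m" "e < 2 * m - 1"
  shows "rich_a m e + rich_b m e + rich_c m e = m"
  using assms by (auto simp: rich_a_def rich_b_def rich_c_def)

lemma rich_exponents_ok:
  assumes "3 \<le> m" "e < 2 * m - 1" "e \<noteq> 2" "e \<noteq> 2 * m - 2"
  shows "exponents_ok m (rich_a m) (rich_b m) (rich_c m) e"
  using assms by (auto simp: exponents_ok_def rich_a_def rich_b_def rich_c_def)

lemma sum_rich_c: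
  assumes "m = n + 2" "1 \<le> n"
  shows "(\<Sum>e<2*m-1. rich_c m e) = n\<^sup>2 + 3"
proof -
  have "2 * m - 1 = 3 + n + n" using assms by simp
  then have "(\<Sum>e<2*m-1. rich_c m e) = (\<Sum>e<3. rich_c m e) + (\<Sum>e<n. rich_c m (3 + e)) + (\<Sum>e<n. rich_c m (3 + n + e))"
    by (simp only: sum_lessThan_add)
  also have "(\<Sum>e<3. rich_c m e) = 3" by (simp add: rich_c_def eval_nat_numeral)
  also have "(\<Sum>e<n. rich_c m (3 + e)) = (\<Sum>e<n. e + 1)"
    using assms by (intro sum.cong) (auto simp: rich_c_def)
  also have "(\<Sum>e<n. rich_c m (3 + n + e)) = (\<Sum>e<n. n - 1 - e)"
    using assms by (intro sum.cong) (auto simp: rich_c_def)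
  also have "3 + (\<Sum>e<n. e + 1) + (\<Sum>e<n. n - 1 - e) = 3 + (\<Sum>e<n. (e + 1) + (n - 1 - e))"
    by (simp only: sum.distrib add.assoc)
  also have "(\<Sum>e<n. (e + 1) + (n - 1 - e)) = (\<Sum>e<n. n)"
    by (intro sum.cong) auto
  finally show ?thesis by (simp add: power2_eq_square)
qed

lemma rich_words_bound:
  assumes T: "triangular k T" and k: "2 \<le> k" and m: "3 \<le> m"
    and s: "1 \<le> cmod (T k k)"
  defines "A \<equiv> m * (2 * m - 1) - ((m - 2)\<^sup>2 + 3)"
  shows "\<exists>W. word_family k m W \<and> cmod (\<Prod>j<2*k+1. T j j) ^ A / 4 \<le> cmod (word_det k m T W)"
proof -
  define p where "p = node_pos k"
  define p' where "p' i = p (nxt k i)" for i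
  define p'' where "p'' i = p (nxt k (nxt k i))" for i
  define d where "d i = cmod (T (p i) (p i))" for i
  define s' where "s' = cmod (T k k)"
  define G where "G = (\<Prod>i<2*k. d i)"
  define w where "w i = (if i < 2 * k - 2 then 1 else 1 / 2 :: real)" for i
  define a where "a = rich_a m"
  define b where "b = rich_b m"
  define c where "c = rich_c m"
  have k0: "0 < k" using k by simp
  have dpos: "0 < d i" if "i < 2 * k" for i
    using T node_pos_lt[OF that] by (auto simp: d_def p_def triangular_def)
  have "\<forall>i. \<exists>q t. i < 2 * k \<longrightarrow> (q = p i \<or> 2 * k - 2 \<le> i \<and> q = p'' i) \<and> (t = p i \<or> t = p'' i) \<and>
    d i * d (nxt k (nxt k i)) * w i \<le> cmod (T q (p i)) * cmod (T t (p i) - T t (p'' i))"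
    using pivot_choice[OF T k] unfolding d_def w_def p''_def p_def by blast
  then obtain q t where qt: "\<And>i. i < 2 * k \<Longrightarrow> q i = p i \<or> 2 * k - 2 \<le> i \<and> q i = p'' i"
    "\<And>i. i < 2 * k \<Longrightarrow> t i = p i \<or> t i = p'' i"
    "\<And>i. i < 2 * k \<Longrightarrow> d i * d (nxt k (nxt k i)) * w i \<le> cmod (T (q i) (p i)) * cmod (T (t i) (p i) - T (t i) (p'' i))"
    by metis
  have ok: "exponents_ok m a b c e" if "e < 2 * m - 1" "e \<noteq> 2" "e \<noteq> 2 * m - 2" for e
    unfolding a_def b_def c_def by (rule rich_exponents_ok[OF m that])
  have q: "admissible k q"
    unfolding admissible_def
  proof (intro allI impI)
    fix i assume i: "i < 2 * k"
    obtain n where n: "k = Suc n" "0 < n" using k by (cases k) auto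
    show "q i = node_pos k i \<or> i = 2 * k - 2 \<and> q i = 0 \<or> i = 2 * k - 1 \<and> q i = k + 1"
    proof (cases "q i = p i")
      case False
      then have "2 * k - 2 \<le> i" "q i = p'' i" using qt(1)[OF i] by auto
      moreover from this have "i = 2 * n \<or> i = Suc (2 * n)" using i n by auto
      ultimately show ?thesis using n by (auto simp: p''_def p_def nxt_def node_pos_def)
    qed (simp add: p_def)
  qed
  have t: "tail_ok k t"
    unfolding tail_ok_def
  proof (intro allI impI)
    fix i assume i: "i < 2 * k"
    note i1 = nxt_lt[OF i]
    note i2 = nxt_lt[OF i1]
    have "even (nxt k (nxt k i)) \<longleftrightarrow> even i" using even_nxt[OF i] even_nxt[OF i1] by simp
    then have "p i < 2 * k + 1 \<and> (if even i then p i < k else k < p i)"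
      "p'' i < 2 * k + 1 \<and> (if even i then p'' i < k else k < p'' i)"
      using i i2 node_pos_lt[OF i] node_pos_lt[OF i2] by (auto simp: p_def p''_def node_pos_def)
    then show "t i < 2 * k + 1 \<and> (if even i then t i < k else k < t i)"
      using qt(2)[OF i] by (elim disjE) simp_all
  qed
  let ?W = "rich_words k m a b c q t"
  have W: "levelled k m ?W" by (rule rich_words_levelled[OF ok q t m])
  \<comment> \<open>Ratio of the actual factor to the one counted by a, b, c: one of the m diagonal
    factors is replaced, at e = 0 by the entry chosen through \<open>q\<close>, at e = 2m - 2 by the
    difference chosen through \<open>t\<close>.\<close>
  define \<rho> where "\<rho> i e = (if e = 0 then cmod (T (q i) (p i)) / d i
    else if e = 2 * m - 2 then cmod (T (t i) (p i) - T (t i) (p'' i)) / d (nxt k i) else 1)" for i e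
  have "cmod (word_det k m T ?W) = cmod (\<Prod>i<2*k. \<Prod>e<2*m-1.
      if e = 2 then T k k ^ 2 * T (p i) (p i) ^ (m - 2)
      else if e = 2 * m - 2 then (T (t i) (p i) - T (t i) (p'' i)) * T (p' i) (p' i) ^ (m - 1)
      else if e = 0 then T (q i) (p i) * T (p i) (p i) ^ (m - 1)
      else T (p i) (p i) ^ a e * T (p' i) (p' i) ^ b e * T k k ^ c e)"
    unfolding word_det_levi[OF T k0 W] p_def p'_def p''_def
    by (rule arg_cong[where f = cmod], rule rich_words_fdet[OF T k m ok q t])
  also have "\<dots> = (\<Prod>i<2*k. \<Prod>e<2*m-1. (d i ^ a e * d (nxt k i) ^ b e * s' ^ c e) * \<rho> i e)"
    unfolding prod_norm[symmetric]
  proof (intro prod.cong refl)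
    fix i e assume "i \<in> {..<2*k}" "e \<in> {..<2*m-1}"
    then have i: "i < 2 * k" and e: "e < 2 * m - 1" by auto
    have dn: "d (nxt k i) = cmod (T (p' i) (p' i))" by (simp add: d_def p'_def)
    have pos: "0 < d i" "0 < d (nxt k i)" using dpos i nxt_lt by auto
    have pw: "x ^ m = x ^ (m - 1) * x" for x :: real
      using m by (cases m) auto
    consider "e = 2" | "e = 2 * m - 2" "e \<noteq> 2" | "e = 0" | "e \<noteq> 2" "e \<noteq> 2 * m - 2" "e \<noteq> 0" by blast
    then show "cmod (if e = 2 then T k k ^ 2 * T (p i) (p i) ^ (m - 2)
      else if e = 2 * m - 2 then (T (t i) (p i) - T (t i) (p'' i)) * T (p' i) (p' i) ^ (m - 1)
      else if e = 0 then T (q i) (p i) * T (p i) (p i) ^ (m - 1)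
      else T (p i) (p i) ^ a e * T (p' i) (p' i) ^ b e * T k k ^ c e)
      = (d i ^ a e * d (nxt k i) ^ b e * s' ^ c e) * \<rho> i e"
    proof cases
      case 1
      moreover have "2 * m - 2 \<noteq> 2" using m by simp
      ultimately show ?thesis
        using m by (simp add: a_def b_def c_def rich_a_def rich_b_def rich_c_def norm_mult norm_power
            d_def s'_def \<rho>_def mult.commute)
    next
      case 2
      have abc: "a (2 * m - 2) = 0" "b (2 * m - 2) = m" "c (2 * m - 2) = 0"
        using 2 m by (auto simp: a_def b_def c_def rich_a_def rich_b_def rich_c_def)
      show ?thesis
        using m 2 pos by (simp add: abc norm_mult norm_power dn[symmetric] \<rho>_def pw)
    next
      case 3
      have abc: "a 0 = m" "b 0 = 0" "c 0 = 0"
        using m by (auto simp: a_def b_def c_def rich_a_def rich_b_def rich_c_def)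
      show ?thesis
        using m 3 pos by (simp add: abc norm_mult norm_power d_def[symmetric] \<rho>_def pw)
    next
      case 4
      then show ?thesis
        by (simp add: norm_mult norm_power d_def[symmetric] dn s'_def \<rho>_def)
    qed
  qed
  also have "\<dots> = (\<Prod>i<2*k. \<Prod>e<2*m-1. d i ^ a e * d (nxt k i) ^ b e * s' ^ c e) * (\<Prod>i<2*k. \<Prod>e<2*m-1. \<rho> i e)"
    by (simp only: prod.distrib)
  also have "(\<Prod>i<2*k. \<Prod>e<2*m-1. d i ^ a e * d (nxt k i) ^ b e * s' ^ c e)
      = G ^ (\<Sum>e<2*m-1. a e + b e) * s' ^ (2 * k * (\<Sum>e<2*m-1. c e))"
    unfolding G_def by (rule prod_uniform)
  finally have val: "cmod (word_det k m T ?W)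
      = G ^ (\<Sum>e<2*m-1. a e + b e) * s' ^ (2 * k * (\<Sum>e<2*m-1. c e)) * (\<Prod>i<2*k. \<Prod>e<2*m-1. \<rho> i e)" .
  obtain n where n: "m = n + 2" "1 \<le> n" using m by (metis add.commute le_Suc_ex numeral_3_eq_3 numeral_2_eq_2 Suc_eq_plus1 add_Suc_right le_add1 one_add_one add.assoc)
  have Y: "(\<Sum>e<2*m-1. c e) = n\<^sup>2 + 3" unfolding c_def by (rule sum_rich_c[OF n])
  have A: "(\<Sum>e<2*m-1. a e + b e) = A"
  proof -
    have "(\<Sum>e<2*m-1. a e + b e) + (\<Sum>e<2*m-1. c e) = (\<Sum>e<2*m-1. m)"
      unfolding sum.distrib[symmetric] a_def b_def c_def using rich_sum[OF m] by (intro sum.cong) auto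
    then show ?thesis using Y n by (simp add: A_def mult.commute)
  qed
  have le: "A \<le> 2 * k * (n\<^sup>2 + 3)"
  proof -
    have "m * (2 * m - 1) \<le> 5 * (n\<^sup>2 + 3)"
    proof -
      \<comment> \<open>From 12 (3 n^2 - 7 n + 9) = (6 n - 7)^2 + 59.\<close>
      have "7 * int n \<le> 3 * (int n)\<^sup>2 + 9"
        using zero_le_power2[of "6 * int n - 7"] by (simp add: power2_eq_square algebra_simps)
      then have "7 * n \<le> 3 * n\<^sup>2 + 9" by (simp flip: of_nat_le_iff[where ?'a = int])
      then show ?thesis unfolding n(1) by (simp add: power2_eq_square algebra_simps)
    qed
    then have "A \<le> 4 * (n\<^sup>2 + 3)" unfolding A_def n(1) by simp
    also have "\<dots> \<le> 2 * k * (n\<^sup>2 + 3)" using k by (intro mult_le_mono1) auto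
    finally show ?thesis .
  qed
  \<comment> \<open>The estimates of \<open>pivot_choice\<close> have d i * d (i+2) where \<rho> has
    d i * d (i+1); over the whole cycle these products agree. The weights \<open>w\<close> differ
    from 1 only at the last component of each parity, where they are 1/2.\<close>
  have rho: "1 / 4 \<le> (\<Prod>i<2*k. \<Prod>e<2*m-1. \<rho> i e)"
  proof -
    have e: "(\<Prod>e<2*m-1. \<rho> i e) = \<rho> i 0 * \<rho> i (2 * m - 2)" for i
    proof -
      have "(\<Prod>e<2*m-1. \<rho> i e) = (\<Prod>e\<in>{0, 2 * m - 2}. \<rho> i e)"
        using m by (intro prod.mono_neutral_right) (auto simp: \<rho>_def)
      then show ?thesis using m by simp
    qed
    have "(\<Prod>i<2*k. w i) = (\<Prod>i\<in>{2*k-2, 2*k-1}. w i)"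
      using k by (intro prod.mono_neutral_right) (auto simp: w_def)
    also have "\<dots> = 1 / 4" using k by (subst prod.insert) (auto simp: w_def)
    finally have "1 / 4 = (\<Prod>i<2*k. w i)" by simp
    also have "\<dots> = (\<Prod>i<2*k. d i * d (nxt k (nxt k i)) * w i / (d i * d (nxt k (nxt k i))))"
      using dpos nxt_lt by (intro prod.cong) (auto simp: less_imp_neq[symmetric])
    also have "\<dots> \<le> (\<Prod>i<2*k. (cmod (T (q i) (p i)) * cmod (T (t i) (p i) - T (t i) (p'' i))) / (d i * d (nxt k (nxt k i))))"
      using qt(3) dpos nxt_lt
      by (intro prod_mono conjI divide_right_mono divide_nonneg_nonneg mult_nonneg_nonneg)
        (auto simp: w_def d_def)
    also have "\<dots> = (\<Prod>i<2*k. cmod (T (q i) (p i))) * (\<Prod>i<2*k. cmod (T (t i) (p i) - T (t i) (p'' i)))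
        / ((\<Prod>i<2*k. d i) * (\<Prod>i<2*k. d (nxt k (nxt k i))))"
      by (simp add: prod.distrib prod_dividef)
    also have "(\<Prod>i<2*k. d (nxt k (nxt k i))) = (\<Prod>i<2*k. d (nxt k i))"
      by (rule prod_nxt[where f = "\<lambda>i. d (nxt k i)"])
    also have "(\<Prod>i<2*k. cmod (T (q i) (p i))) * (\<Prod>i<2*k. cmod (T (t i) (p i) - T (t i) (p'' i)))
        / ((\<Prod>i<2*k. d i) * (\<Prod>i<2*k. d (nxt k i))) = (\<Prod>i<2*k. \<rho> i 0 * \<rho> i (2 * m - 2))"
      using m by (simp add: \<rho>_def prod.distrib prod_dividef)
    finally show ?thesis by (simp only: e)
  qed
  have G0: "0 \<le> G" "1 \<le> s'" using s by (auto simp: G_def d_def s'_def prod_nonneg)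
  have "(s' * G) ^ A * (1 / 4) \<le> (G ^ A * s' ^ (2 * k * (n\<^sup>2 + 3))) * (\<Prod>i<2*k. \<Prod>e<2*m-1. \<rho> i e)"
  proof (rule mult_mono[OF _ rho])
    have "s' ^ A \<le> s' ^ (2 * k * (n\<^sup>2 + 3))" using le G0 by (intro power_increasing)
    then show "(s' * G) ^ A \<le> G ^ A * s' ^ (2 * k * (n\<^sup>2 + 3))"
      using G0 by (simp add: power_mult_distrib mult.commute mult_left_mono)
  qed (use G0 in auto)
  moreover have "cmod (\<Prod>j<2*k+1. T j j) = s' * G"
    unfolding diag_prod[OF k0] by (simp add: norm_mult G_def d_def s'_def p_def prod_norm)
  ultimately show ?thesis
    using W val unfolding A Y levelled_def by (intro exI[of _ ?W]) auto
qed

text \<open>Here p, r, q are the entries at (first, first), (first, last), (last, last) for the two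
  nodes of one parity when k = 2. With l = p x_first + r x_last and l' = q x_last, the two values of
  \<kappa> are the coefficients of x_first + x_last in l and l', and u is the entry used in the row
  of exponent 0 at the last node. The square of u \<kappa> should make up for the ratio q / p: if q
  is not larger than p, either r is comparable to p and serves as u, or r is small and the
  coefficient at l' is large.\<close>

lemma corner_choice:
  fixes p q r :: complex
  assumes "p \<noteq> 0" "q \<noteq> 0"
  shows "\<exists>u \<kappa>. (u = q \<or> u = r) \<and> (\<kappa> = 1 / p \<or> \<kappa> = (1 - r / p) / q) \<and>
    cmod q \<le> 4 * (cmod (u * \<kappa>))\<^sup>2 * cmod p"
proof -
  have pos: "0 < cmod p" "0 < cmod q" using assms by auto
  consider "cmod p \<le> cmod q" | "cmod q < cmod p" "cmod p / 2 \<le> cmod r" | "cmod q < cmod p" "cmod r < cmod p / 2"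
    by linarith
  then show ?thesis
  proof cases
    case 1
    then have "cmod q * cmod p \<le> cmod q * cmod q" using pos by (intro mult_left_mono) auto
    moreover have "0 \<le> cmod q * cmod q" by simp
    ultimately have "cmod q * cmod p \<le> 4 * (cmod q * cmod q)" by linarith
    then have "cmod q \<le> 4 * (cmod (q * (1 / p)))\<^sup>2 * cmod p"
      using pos by (simp add: norm_mult norm_divide power2_eq_square field_simps)
    then show ?thesis by blast
  next
    case 2
    then have "(cmod p / 2)\<^sup>2 \<le> (cmod r)\<^sup>2" using pos by (intro power_mono) auto
    moreover have "cmod q * cmod p \<le> cmod p * cmod p" using 2 pos by (intro mult_right_mono) auto
    ultimately have "cmod q * cmod p \<le> 4 * (cmod r)\<^sup>2" by (simp add: power2_eq_square)
    then have "cmod q \<le> 4 * (cmod (r * (1 / p)))\<^sup>2 * cmod p"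
      using pos by (simp add: norm_mult norm_divide power2_eq_square field_simps)
    then show ?thesis by blast
  next
    case 3
    have "1 / 2 \<le> 1 - cmod (r / p)" using 3 pos by (simp add: norm_divide field_simps)
    also have "\<dots> \<le> cmod (1 - r / p)" using norm_triangle_ineq2[of 1 "r / p"] by simp
    finally have "(1 / 2)\<^sup>2 \<le> (cmod (1 - r / p))\<^sup>2" by (intro power_mono) auto
    then have "1 \<le> 4 * (cmod (1 - r / p))\<^sup>2" by (simp add: power2_eq_square)
    then have "cmod p \<le> 4 * (cmod (1 - r / p))\<^sup>2 * cmod p" using pos by simp
    with 3 have "cmod q \<le> 4 * (cmod (1 - r / p))\<^sup>2 * cmod p" by linarith
    moreover have "q * ((1 - r / p) / q) = 1 - r / p" using assms by simp
    ultimately have "cmod q \<le> 4 * (cmod (q * ((1 - r / p) / q)))\<^sup>2 * cmod p" by (simp only:)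
    then show ?thesis by blast
  qed
qed

text \<open>
  For m = 2 the gain comes from y^2, the sum of all x_i x_(i+1). For k = 2 this is
  (x_0 + x_2) (x_1 + x_3), and K lists the coefficients of the two factors in the triangular basis.
\<close>

lemma conic_words_bound:
  assumes T: "triangular 2 T" and s: "1 \<le> cmod (T 2 2)"
  shows "\<exists>W. word_family 2 2 W \<and>
    cmod (\<Prod>j<2*2+1. T j j) ^ 9 / 16 \<le> (cmod (word_det 2 2 T W))\<^sup>2"
proof -
  have nz: "T j j \<noteq> 0" if "j < 5" for j using T that by (auto simp: triangular_def)
  have z: "T j l = 0" if "j < 5" "l < j" for j l using T that by (auto simp: triangular_def)
  obtain u \<kappa> where u: "u = T 1 1 \<or> u = T 0 1" "\<kappa> = 1 / T 0 0 \<or> \<kappa> = (1 - T 0 1 / T 0 0) / T 1 1"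
    "cmod (T 1 1) \<le> 4 * (cmod (u * \<kappa>))\<^sup>2 * cmod (T 0 0)"
    using corner_choice[of "T 0 0" "T 1 1" "T 0 1"] nz by auto
  obtain u' \<kappa>' where u': "u' = T 4 4 \<or> u' = T 3 4" "\<kappa>' = 1 / T 3 3 \<or> \<kappa>' = (1 - T 3 4 / T 3 3) / T 4 4"
    "cmod (T 4 4) \<le> 4 * (cmod (u' * \<kappa>'))\<^sup>2 * cmod (T 3 3)"
    using corner_choice[of "T 3 3" "T 4 4" "T 3 4"] nz by auto
  define K where "K j = (if j = 0 then 1 / T 0 0 else if j = 1 then (1 - T 0 1 / T 0 0) / T 1 1
    else if j = 3 then 1 / T 3 3 else (1 - T 3 4 / T 3 3) / T 4 4)" for j :: nat
  obtain j0 where j0: "j0 = 0 \<or> j0 = 1" "\<kappa> = K j0"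
    using u(2) by (elim disjE) (auto simp: K_def intro: that[of 0] that[of 1])
  obtain l0 where l0: "l0 = 3 \<or> l0 = 4" "\<kappa>' = K l0"
    using u'(2) by (elim disjE) (auto simp: K_def intro: that[of 3] that[of 4])
  obtain q2 where q2: "q2 = 0 \<or> q2 = 1" "u = T q2 1"
    using u(1) by (elim disjE) (auto intro: that[of 0] that[of 1])
  obtain q3 where q3: "q3 = 3 \<or> q3 = 4" "u' = T q3 4"
    using u'(1) by (elim disjE) (auto intro: that[of 3] that[of 4])
  define q where "q i = (if i = 2 then q2 else if i = 3 then q3 else node_pos 2 i)" for i
  define a where "a e = (if e = 0 then 2 else 1 :: nat)" for e :: nat
  define b where "b e = (if e = 2 then 1 else 0 :: nat)" for e :: nat
  define c where "c e = (if e = 1 then 1 else 0 :: nat)" for e :: nat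
  have ok: "exponents_ok 2 a b c e" if "e < 2 * 2 - 1" for e
    using that by (auto simp: exponents_ok_def a_def b_def c_def)
  have q: "admissible 2 q"
    using q2(1) q3(1) by (auto simp: admissible_def q_def node_pos_def)
  let ?W = "std_words 2 2 a b c q" and ?N = "dim_sections 2 2"
  have N: "?N = 12" by (simp add: dim_sections_def)
  have W: "levelled 2 2 ?W" by (rule std_words_levelled[OF ok q]) simp_all
  have prod4: "(\<Prod>i<4. f i) = f 0 * f 1 * f 2 * f 3" and prod3: "(\<Prod>i<3. f i) = f 0 * f 1 * f 2"
    for f :: "nat \<Rightarrow> complex"
    by (simp_all add: eval_nat_numeral)
  have "fdet ?N (levi 2 2 T ?W) = (\<Prod>i<2*2. \<Prod>e<2*2-1.
    if e = 0 then T (q i) (node_pos 2 i) * T (node_pos 2 i) (node_pos 2 i) ^ (2 - 1)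
    else T (node_pos 2 i) (node_pos 2 i) ^ a e *
      T (node_pos 2 (Suc i mod (2 * 2))) (node_pos 2 (Suc i mod (2 * 2))) ^ b e * T 2 2 ^ c e)"
    by (rule std_words_fdet[OF T _ _ ok q]) auto
  also have "\<dots> = T 2 2 ^ 4 * (T 0 0 ^ 5 * T 1 1 ^ 4 * u) * (T 3 3 ^ 5 * T 4 4 ^ 4 * u')"
  proof -
    have n: "2 * 2 = (4::nat)" "4 - 1 = (3::nat)" "2 - 1 = (1::nat)" by simp_all
    show ?thesis
      unfolding n prod4 prod3
      by (simp add: q_def node_pos_def a_def b_def c_def q2(2) q3(2)) (simp add: power_numeral_reduce mult_ac)
  qed
  finally have det0: "fdet ?N (levi 2 2 T ?W)
      = T 2 2 ^ 4 * (T 0 0 ^ 5 * T 1 1 ^ 4 * u) * (T 3 3 ^ 5 * T 4 4 ^ 4 * u')" .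
  \<comment> \<open>The component with the nodes at positions \<open>j0\<close> and
    \<open>l0\<close>. Its word of exponent 2 is the one exchanged for y^2, since \<kappa> \<kappa>'
    is its coefficient in the expansion of y^2.\<close>
  define i0 where "i0 = (if l0 = 3 then if j0 = 0 then 0 else 1 else if j0 = 0 then 3 else 2 :: nat)"
  define r0 where "r0 = index_of 2 i0 2"
  have i0: "i0 < 2 * 2" "even_pos 2 i0 = j0" "odd_pos 2 i0 = l0"
    using j0(1) l0(1) by (auto simp: i0_def even_pos_def odd_pos_def)
  have r0: "r0 < ?N" "comp_of 2 r0 = i0" "expo_of 2 r0 = 2"
    unfolding r0_def using index_of_lt[OF i0(1), of 2 2] comp_expo_of[of 2 2 i0] by auto
  define W1 where "W1 r = (if r = r0 then [2, 2] else ?W r)" for r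
  have lev_r0: "level 2 r0 = 2" using r0 by (simp add: level_def)
  have W1: "levelled 2 2 W1"
    using W lev_r0 by (auto simp: levelled_def word_family_def W1_def height_def)
  \<comment> \<open>Coefficients of the leading part of the word [2, 2], which is (T 2 2)^2 y^2, in
    the four words of exponent 2; these sit in rows 2, 5, 8 and 11.\<close>
  define \<alpha> where "\<alpha> x = (if expo_of 2 x = 2 then T 2 2 ^ 2 * K (even_pos 2 (comp_of 2 x)) * K (odd_pos 2 (comp_of 2 x)) else 0)" for x
  have idx: "comp_of 2 2 = 0" "comp_of 2 5 = 1" "comp_of 2 8 = 2" "comp_of 2 11 = 3"
    "expo_of 2 2 = 2" "expo_of 2 5 = 2" "expo_of 2 8 = 2" "expo_of 2 11 = 2"
    "level 2 2 = 2" "level 2 5 = 2" "level 2 8 = 2" "level 2 11 = 2"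
    "even_pos 2 0 = 0" "even_pos 2 1 = 1" "even_pos 2 2 = 1" "even_pos 2 3 = 0"
    "odd_pos 2 0 = 3" "odd_pos 2 1 = 3" "odd_pos 2 2 = 4" "odd_pos 2 3 = 4"
    by (simp_all add: comp_of_def expo_of_def level_def even_pos_def odd_pos_def)
  have words: "?W 2 = [0, 3]" "?W 5 = [3, 1]" "?W 8 = [1, 4]" "?W 11 = [4, 0]"
    by (simp_all add: std_words_def std_row_def comp_of_def expo_of_def node_pos_def a_def b_def c_def)
  have lead: "lead 2 T i 0 = T 0 (even_pos 2 i)" "lead 2 T i 1 = T 1 (even_pos 2 i)"
    "lead 2 T i 3 = T 3 (odd_pos 2 i)" "lead 2 T i 4 = T 4 (odd_pos 2 i)" for i
    by (simp_all add: lead_def)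
  have row: "levi 2 2 T W1 r0 d = (\<Sum>x<?N. \<alpha> x * levi 2 2 T ?W x d)" if d: "d < ?N" for d
  proof -
    have "x \<in> {2, 5, 8, 11}" if "x < 12" "expo_of 2 x = 2" for x :: nat
    proof -
      have "x mod 3 = 2" using that by (simp add: expo_of_def)
      then show ?thesis using that(1) by simp presburger
    qed
    then have "(\<Sum>x<?N. \<alpha> x * levi 2 2 T ?W x d) = (\<Sum>x\<in>{2, 5, 8, 11}. \<alpha> x * levi 2 2 T ?W x d)"
      unfolding N by (intro sum.mono_neutral_right) (auto simp: \<alpha>_def)
    also have "\<dots> = (if level 2 d = 2 then T 2 2 ^ 2 *
        (K 0 * T 0 (even_pos 2 (comp_of 2 d)) + K 1 * T 1 (even_pos 2 (comp_of 2 d))) *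
        (K 3 * T 3 (odd_pos 2 (comp_of 2 d)) + K 4 * T 4 (odd_pos 2 (comp_of 2 d))) else 0)"
      by (simp add: \<alpha>_def levi_def idx words lead del: One_nat_def) (simp add: algebra_simps)
    also have "\<dots> = (if level 2 d = 2 then T 2 2 ^ 2 else 0)"
    proof -
      have "comp_of 2 d < 2 * 2" by (rule index_decompose(1)[OF d])
      then have "even_pos 2 (comp_of 2 d) \<in> {0, 1}" "odd_pos 2 (comp_of 2 d) \<in> {3, 4}"
        by (auto simp: even_pos_def odd_pos_def)
      then have "K 0 * T 0 (even_pos 2 (comp_of 2 d)) + K 1 * T 1 (even_pos 2 (comp_of 2 d)) = 1"
        "K 3 * T 3 (odd_pos 2 (comp_of 2 d)) + K 4 * T 4 (odd_pos 2 (comp_of 2 d)) = 1"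
        using nz z by (auto simp: K_def)
      then show ?thesis by simp
    qed
    also have "\<dots> = levi 2 2 T W1 r0 d"
      using lev_r0 by (auto simp: levi_def W1_def lead_def power2_eq_square)
    finally show ?thesis by simp
  qed
  have "word_det 2 2 T W1 = fdet ?N (levi 2 2 T W1)"
    by (rule word_det_levi[OF T _ W1]) simp
  also have "\<dots> = fdet ?N (\<lambda>r d. if r = r0 then \<Sum>x<?N. \<alpha> x * levi 2 2 T ?W x d else levi 2 2 T ?W r d)"
  proof (rule fdet_cong)
    fix r d assume d: "d < ?N"
    show "levi 2 2 T W1 r d = (if r = r0 then \<Sum>x<?N. \<alpha> x * levi 2 2 T ?W x d else levi 2 2 T ?W r d)"
    proof (cases "r = r0")
      case True
      then show ?thesis using row[OF d] by simp
    qed (simp add: levi_def W1_def)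
  qed
  also have "\<dots> = \<alpha> r0 * fdet ?N (levi 2 2 T ?W)"
    by (rule fdet_row_replace[OF r0(1)])
  also have "\<alpha> r0 = T 2 2 ^ 2 * \<kappa> * \<kappa>'"
    using r0 i0 j0(2) l0(2) by (simp add: \<alpha>_def)
  finally have "word_det 2 2 T W1 = T 2 2 ^ 6 *
      (T 0 0 ^ 5 * T 1 1 ^ 4 * (u * \<kappa>)) * (T 3 3 ^ 5 * T 4 4 ^ 4 * (u' * \<kappa>'))"
    unfolding det0 by (simp add: algebra_simps eval_nat_numeral)
  \<comment> \<open>Squared because the 12 words of length 2 contain six letters y, leaving degree
    18 for the four nodes, that is 9/2 for each.\<close>
  then have val: "(cmod (word_det 2 2 T W1))\<^sup>2 = cmod (T 2 2) ^ 12 *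
      (cmod (T 0 0) ^ 9 * cmod (T 1 1) ^ 8 * ((cmod (u * \<kappa>))\<^sup>2 * cmod (T 0 0))) *
      (cmod (T 3 3) ^ 9 * cmod (T 4 4) ^ 8 * ((cmod (u' * \<kappa>'))\<^sup>2 * cmod (T 3 3)))"
    by (simp add: norm_mult norm_power power_mult_distrib power_mult[symmetric] algebra_simps eval_nat_numeral)
  have "cmod (\<Prod>j<2*2+1. T j j) ^ 9 / 16 = cmod (T 2 2) ^ 9 *
      (cmod (T 0 0) ^ 9 * cmod (T 1 1) ^ 8 * (cmod (T 1 1) / 4)) *
      (cmod (T 3 3) ^ 9 * cmod (T 4 4) ^ 8 * (cmod (T 4 4) / 4))"
  proof -
    have "(\<Prod>j<2*2+1. T j j) = T 0 0 * T 1 1 * T 2 2 * T 3 3 * T 4 4" by (simp add: eval_nat_numeral)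
    moreover have "x ^ 9 = x ^ 8 * x" for x :: real by (simp add: power_numeral_reduce)
    ultimately show ?thesis by (simp add: norm_mult power_mult_distrib mult_ac)
  qed
  also have "\<dots> \<le> (cmod (word_det 2 2 T W1))\<^sup>2"
  proof -
    have "cmod (T 2 2) ^ 9 \<le> cmod (T 2 2) ^ 12" using s by (intro power_increasing) auto
    then show ?thesis
      unfolding val using u(3) u'(3)
      by (intro mult_mono mult_nonneg_nonneg zero_le_power order_refl) auto
  qed
  finally show ?thesis using W1 unfolding levelled_def by blast
qed

subsection \<open>Semistability\<close>

lemma triangular_word_bound:
  assumes k: "2 \<le> k" "k \<le> m" and \<Delta>: "0 < \<Delta>"
  shows "\<exists>c>0. \<forall>T. triangular k T \<longrightarrow> cmod (\<Prod>j<2*k+1. T j j) = \<Delta> \<longrightarrow>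
    (\<exists>W. word_family k m W \<and> c \<le> cmod (word_det k m T W))"
proof -
  define c where "c = min (\<Delta> ^ (m * (2 * m - 1) - (m - 1)))
    (min (\<Delta> ^ (m * (2 * m - 1) - ((m - 2)\<^sup>2 + 3)) / 4) (sqrt (\<Delta> ^ 9 / 16)))"
  have "0 < c" using \<Delta> by (simp add: c_def)
  moreover have "\<exists>W. word_family k m W \<and> c \<le> cmod (word_det k m T W)"
    if T: "triangular k T" and d: "cmod (\<Prod>j<2*k+1. T j j) = \<Delta>" for T
  proof -
    consider "cmod (T k k) \<le> 1" | "1 \<le> cmod (T k k)" "3 \<le> m" | "1 \<le> cmod (T k k)" "m = 2" "k = 2"
      using k by linarith
    then show ?thesis
    proof cases
      case 1
      have "2 \<le> m" using k by simp
      from poor_words_bound[OF T k this 1] show ?thesis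
        unfolding d c_def by (meson min.coboundedI1)
    next
      case 2
      from rich_words_bound[OF T k(1) 2(2,1)] show ?thesis
        unfolding d c_def by (meson min.coboundedI1 min.coboundedI2)
    next
      case 3
      from conic_words_bound[of T] T 3 obtain W where W: "word_family k m W"
        "\<Delta> ^ 9 / 16 \<le> (cmod (word_det k m T W))\<^sup>2"
        unfolding 3(2,3) d[unfolded 3(3)] by blast
      then have "sqrt (\<Delta> ^ 9 / 16) \<le> cmod (word_det k m T W)"
        by (intro real_le_lsqrt) auto
      then show ?thesis using W(1) unfolding c_def by (meson min.coboundedI2)
    qed
  qed
  ultimately show ?thesis by blast
qed

lemma word_det_lower_bound:
  assumes k: "2 \<le> k" "k \<le> m" and \<Delta>: "0 < \<Delta>"
  shows "\<exists>c>0. \<forall>X\<in>carrier_mat (2*k+1) (2*k+1). cmod (det X) = \<Delta> \<longrightarrow>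
    (\<exists>W. word_family k m W \<and> c \<le> cmod (word_det k m (\<lambda>j l. X $$ (j, l)) W))"
proof -
  define g where "g = 2 * k + 1"
  obtain B where B: "\<And>X. X \<in> carrier_mat g g \<Longrightarrow>
      \<exists>Y. row_reducible g B X Y \<and> (\<forall>j<g. \<forall>i<g. j < i \<longrightarrow> Y $$ (i, j) = 0)"
    using row_reducible_upper_triangular[of g] by blast
  obtain c where c: "0 < c" "\<And>T. triangular k T \<Longrightarrow> cmod (\<Prod>j<g. T j j) = \<Delta> \<Longrightarrow>
      \<exists>W. word_family k m W \<and> c \<le> cmod (word_det k m T W)"
    using triangular_word_bound[OF k \<Delta>] unfolding g_def by blast
  obtain K where K: "K > 0" "\<And>X X' M \<epsilon> W. (\<And>j l. X' j l = (\<Sum>t<2*k+1. M j t * X t l)) \<Longrightarrow>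
     (\<And>j t. j < 2*k+1 \<Longrightarrow> t < 2*k+1 \<Longrightarrow> cmod (M j t) \<le> B) \<Longrightarrow>
     (\<And>W'. word_family k m W' \<Longrightarrow> cmod (word_det k m X W') \<le> \<epsilon>) \<Longrightarrow>
     word_family k m W \<Longrightarrow> cmod (word_det k m X' W) \<le> K * \<epsilon>"
    using word_det_bound[of k B m] by blast
  \<comment> \<open>If all minors of X were at most c / (2K), those of the triangular matrix would
    be at most c / 2, contradicting the choice of \<open>c\<close>.\<close>
  have "\<exists>W. word_family k m W \<and> c / (2 * K) \<le> cmod (word_det k m (\<lambda>j l. X $$ (j, l)) W)"
    if X: "X \<in> carrier_mat g g" and detX: "cmod (det X) = \<Delta>" for X
  proof (rule ccontr)
    assume "\<not> ?thesis"
    then have small: "\<And>W. word_family k m W \<Longrightarrow> cmod (word_det k m (\<lambda>j l. X $$ (j, l)) W) \<le> c / (2 * K)"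
      by (meson less_imp_le not_le)
    obtain Y where Y: "row_reducible g B X Y" "\<And>i j. j < i \<Longrightarrow> i < g \<Longrightarrow> Y $$ (i, j) = 0"
      using B[OF X] by (meson less_trans)
    then obtain M where M: "M \<in> carrier_mat g g" "\<And>i j. i < g \<Longrightarrow> j < g \<Longrightarrow> cmod (M $$ (i, j)) \<le> B"
      "cmod (det M) = 1" "Y = M * X"
      unfolding row_reducible_def by blast
    define T where "T j l = (\<Sum>t<2*k+1. M $$ (j, t) * X $$ (t, l))" for j l
    have TY: "T j l = Y $$ (j, l)" if "j < g" "l < g" for j l
      using M(1,4) X that by (simp add: T_def g_def scalar_prod_def atLeast0LessThan)
    have "det Y = fdet g T"
      unfolding fdet_def using M(1,4) X TY by (intro arg_cong[where f = det] eq_matI) auto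
    also have "\<dots> = (\<Prod>j<g. T j j)"
      using Y(2) TY by (intro fdet_triangular[where key = id]) (metis id_apply nat_neq_iff)
    finally have "(\<Prod>j<g. T j j) = det M * det X"
      using M(1,4) X by (simp add: det_mult[of _ g])
    then have diag: "cmod (\<Prod>j<g. T j j) = \<Delta>" using M(3) detX by (simp add: norm_mult)
    then have "(\<Prod>j<g. T j j) \<noteq> 0" using \<Delta> by auto
    then have "T j j \<noteq> 0" if "j < g" for j using that by auto
    moreover have "T j l = 0" if "j < g" "l < j" for j l
      using Y(2)[OF that(2,1)] TY that by simp
    ultimately have "triangular k T"
      unfolding triangular_def g_def by blast
    then obtain W where W: "word_family k m W" "c \<le> cmod (word_det k m T W)"
      using c(2) diag by blast
    have "cmod (word_det k m T W) \<le> K * (c / (2 * K))"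
      using T_def M(2) small W(1) unfolding g_def
      by (intro K(2)[of T "\<lambda>j t. M $$ (j, t)" "\<lambda>j l. X $$ (j, l)"])
    then have "c \<le> c / 2" using W(2) K(1) by simp
    then show False using c(1) by simp
  qed
  moreover have "0 < c / (2 * K)" using c(1) K(1) by simp
  ultimately show ?thesis unfolding g_def by blast
qed

theorem theorem5p1:
  fixes g m N :: nat and w b :: "nat \<Rightarrow> nat \<Rightarrow> complex poly"
  assumes "odd g" and "5 \<le> g" and "2 \<le> m"
    and "is_basis_of (rosary_sections g 1) g w"
    and "is_basis_of (rosary_sections g m) N b"
  shows "hilbert_semistable g m w b N \<longleftrightarrow> g \<le> 2 * m + 1"
proof -
  obtain k where g: "g = 2 * k + 1" using \<open>odd g\<close> by (elim oddE)
  have k: "2 \<le> k" "0 < k" using \<open>5 \<le> g\<close> g by auto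
  obtain C where C: "C \<in> carrier_mat (2 * k + 1) (2 * k + 1)" "det C \<noteq> 0"
    and iff: "hilbert_semistable (2 * k + 1) m w b N \<longleftrightarrow>
      \<not> (\<exists>X. (\<forall>n::nat. X n \<in> carrier_mat (2 * k + 1) (2 * k + 1) \<and> det (X n) = det C) \<and>
        (\<forall>W. word_family k m W \<longrightarrow> (\<lambda>n. word_det k m (\<lambda>j l. X n $$ (j, l)) W) \<longlonglongrightarrow> 0))"
    using hilbert_semistable_iff_word_det[OF k(2) \<open>2 \<le> m\<close> assms(4,5)[unfolded g]] by blast
  show ?thesis
  proof (cases "k \<le> m")
    case True
    have "0 < cmod (det C)" using C(2) by simp
    from word_det_lower_bound[OF k(1) True this] obtain c where c: "0 < c"
      "\<And>X. X \<in> carrier_mat (2 * k + 1) (2 * k + 1) \<Longrightarrow> cmod (det X) = cmod (det C) \<Longrightarrow>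
        \<exists>W. word_family k m W \<and> c \<le> cmod (word_det k m (\<lambda>j l. X $$ (j, l)) W)"
      by blast
    have False if X: "\<forall>n::nat. X n \<in> carrier_mat (2 * k + 1) (2 * k + 1) \<and> det (X n) = det C"
      and lim: "\<forall>W. word_family k m W \<longrightarrow> (\<lambda>n. word_det k m (\<lambda>j l. X n $$ (j, l)) W) \<longlonglongrightarrow> 0" for X
    proof -
      \<comment> \<open>Only the finitely many relevant rows of a family matter. Restricted to them
        there are finitely many families, so convergence of each minor makes all of them smaller
        than \<open>c\<close> at a single n.\<close>
      define S where "S = {..<dim_sections k m} \<rightarrow>\<^sub>E {L. set L \<subseteq> {..<2 * k + 1} \<and> length L = m}"
      have "finite S"
        unfolding S_def by (intro finite_PiE finite_lists_length_eq) auto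
      moreover have "\<forall>W\<in>S. eventually (\<lambda>n. cmod (word_det k m (\<lambda>j l. X n $$ (j, l)) W) < c) sequentially"
      proof
        fix W assume "W \<in> S"
        then have "word_family k m W" by (fastforce simp: S_def word_family_def dest: PiE_mem)
        with lim have "(\<lambda>n. cmod (word_det k m (\<lambda>j l. X n $$ (j, l)) W)) \<longlonglongrightarrow> 0"
          using tendsto_norm_zero by blast
        then show "eventually (\<lambda>n. cmod (word_det k m (\<lambda>j l. X n $$ (j, l)) W) < c) sequentially"
          using c(1) by (rule order_tendstoD(2))
      qed
      ultimately have "eventually (\<lambda>n. \<forall>W\<in>S. cmod (word_det k m (\<lambda>j l. X n $$ (j, l)) W) < c) sequentially"
        by (rule eventually_ball_finite)
      then obtain n where n: "\<forall>W\<in>S. cmod (word_det k m (\<lambda>j l. X n $$ (j, l)) W) < c"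
        unfolding eventually_sequentially by blast
      obtain W where W: "word_family k m W" "c \<le> cmod (word_det k m (\<lambda>j l. X n $$ (j, l)) W)"
        using c(2)[of "X n"] X by auto
      have "restrict W {..<dim_sections k m} \<in> S"
        using W(1) by (auto simp: S_def word_family_def)
      moreover have "word_det k m Z (restrict W {..<dim_sections k m}) = word_det k m Z W" for Z
        unfolding word_det_def by (intro fdet_cong) simp
      ultimately show False using n W(2) by fastforce
    qed
    then have "hilbert_semistable g m w b N" unfolding g iff by blast
    then show ?thesis using True g by simp
  next
    case False
    then have "\<not> hilbert_semistable g m w b N"
      unfolding g iff using destabilizing_sequence[OF \<open>2 \<le> m\<close> _ C(1)] by simp
    then show ?thesis using False g by simp
  qed
qed

end
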